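(* Let $(\Omega,\mathcal F,P)$ be a probability space carrying a uniformly distributed $[0,1]$-valued random variable and let $\sigma$ be a distortion function. Then $|\cdot|_{\sigma,\infty}^*$ is a norm on $L_{\sigma,\infty}^*(P)$ turning it into a Banach space. Moreover, $$\Phi:(L_{\sigma,\infty}^*(P),|\cdot|_{\sigma,\infty}^* )\to(L_\sigma^1(P)^*,\|\cdot\|_{\sigma,1}^* ),\qquad Z\mapsto\big(Y\mapsto\Phi(Z)(Y):=\mathbb E(ZY)\big)$$ is an isometric isomorphism.
   Context: $\mathbb K\in\{\mathbb R,\mathbb C\}$. $\mathscr U(0,1)$ denotes the set of all $[0,1]$-valued random variables $U$ on $(\Omega,\mathcal F,P)$ with $P(U\le u)=u$ for all $u\in[0,1]$. A distortion function is a nondecreasing, left-continuous function $\sigma:[0,1)\to[0,\infty)$ with $\int_0^1\sigma(u)\,du=1$. $L_\sigma^1(P)$ is the Banach space of (a.e.-classes of) $\mathbb K$-valued random variables $Y$ with $\|Y\|_{\sigma,1}:=\sup_{U\in\mathscr U(0,1)}\mathbb E(\sigma(U)|Y|)<\infty$; $L_\sigma^1(P)^*$ is its continuous dual with dual norm $\|\cdot\|_{\sigma,1}^*$. For a real random variable $W$, $F_W(q)=P(W\le q)$ and $F_W^{-1}(\alpha)=\inf\{q: F_W(q)\ge\alpha\}$. $L^0(P)$ is the set of (a.e.-classes of) $\mathbb K$-valued random variables. For $Z\in L^0(P)$, $$|Z|_{\sigma,\infty}^*:=\sup_{\alpha\in[0,1)}\frac{\int_\alpha^1F_{|Z|}^{-1}(u)\,du}{\int_\alpha^1\sigma(u)\,du}\in[0,\infty],$$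 and $L_{\sigma,\infty}^*(P):=\{Z\in L^0(P): |Z|_{\sigma,\infty}^*<\infty\}$. *)

theory Defs
  imports "HOL-Probability.Probability" "HOL-Algebra.Module"
begin

section \<open>Normed spaces with an explicit carrier\<close>

text \<open>
  The spaces below consist of almost-everywhere classes with respect to a measure, so they cannot
  be types. Vector spaces are modules in the sense of HOL-Algebra over the scalar field;
  the ring fields \<^term>\<open>mult\<close> and \<^term>\<open>one\<close> of a module record play no role and are left
  \<^term>\<open>undefined\<close>.
\<close>

text \<open>The scalar field, as a ring and at the same time as a module over itself.\<close>

definition scalars :: "('k::field, 'k) module" where
  "scalars = \<lparr>carrier = UNIV, mult = (*), one = 1, zero = 0, add = (+), smult = (*)\<rparr>"

definition normed_space_on :: "('k::real_normed_field, 'v) module \<Rightarrow> ('v \<Rightarrow> real) \<Rightarrow> bool" where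
  "normed_space_on V nrm \<longleftrightarrow>
     module (scalars :: ('k, 'k) module) V \<and>
     (\<forall>x\<in>carrier V. 0 \<le> nrm x) \<and>
     (\<forall>x\<in>carrier V. nrm x = 0 \<longleftrightarrow> x = \<zero>\<^bsub>V\<^esub>) \<and>
     (\<forall>c. \<forall>x\<in>carrier V. nrm (c \<odot>\<^bsub>V\<^esub> x) = norm c * nrm x) \<and>
     (\<forall>x\<in>carrier V. \<forall>y\<in>carrier V. nrm (x \<oplus>\<^bsub>V\<^esub> y) \<le> nrm x + nrm y)"

text \<open>
  The locale \<^locale>\<open>Metric_space\<close> requires symmetry and nonnegativity on the whole type, hence the
  value 0 outside the carrier.
\<close>

definition norm_dist :: "('k, 'v) module \<Rightarrow> ('v \<Rightarrow> real) \<Rightarrow> 'v \<Rightarrow> 'v \<Rightarrow> real" where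
  "norm_dist V nrm x y =
     (if x \<in> carrier V \<and> y \<in> carrier V then nrm (x \<ominus>\<^bsub>V\<^esub> y) else 0)"

definition banach_space_on :: "('k::real_normed_field, 'v) module \<Rightarrow> ('v \<Rightarrow> real) \<Rightarrow> bool" where
  "banach_space_on V nrm \<longleftrightarrow>
     normed_space_on V nrm \<and> Metric_space.mcomplete (carrier V) (norm_dist V nrm)"

definition linear_map_on :: "('k, 'v) module \<Rightarrow> ('k, 'w) module \<Rightarrow> ('v \<Rightarrow> 'w) \<Rightarrow> bool" where
  "linear_map_on V W T \<longleftrightarrow>
     T \<in> carrier V \<rightarrow> carrier W \<and>
     (\<forall>x\<in>carrier V. \<forall>y\<in>carrier V. T (x \<oplus>\<^bsub>V\<^esub> y) = T x \<oplus>\<^bsub>W\<^esub> T y) \<and>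
     (\<forall>c. \<forall>x\<in>carrier V. T (c \<odot>\<^bsub>V\<^esub> x) = c \<odot>\<^bsub>W\<^esub> T x)"

text \<open>
  Functionals are extensional functions, so that they are determined by their values on the
  carrier.
\<close>

definition continuous_dual ::
    "('k::real_normed_field, 'v) module \<Rightarrow> ('v \<Rightarrow> real) \<Rightarrow> ('k, 'v \<Rightarrow> 'k) module" where
  "continuous_dual V nrm =
     \<lparr>carrier = {\<phi> \<in> extensional (carrier V).
        linear_map_on V scalars \<phi> \<and>
        continuous_map (Metric_space.mtopology (carrier V) (norm_dist V nrm)) euclidean \<phi>},
      mult = undefined, one = undefined,
      zero = (\<lambda>x\<in>carrier V. 0),
      add = (\<lambda>\<phi> \<psi>. \<lambda>x\<in>carrier V. \<phi> x + \<psi> x),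
      smult = (\<lambda>c \<phi>. \<lambda>x\<in>carrier V. c * \<phi> x)\<rparr>"

definition dual_norm ::
    "('k::real_normed_field, 'v) module \<Rightarrow> ('v \<Rightarrow> real) \<Rightarrow> ('v \<Rightarrow> 'k) \<Rightarrow> real" where
  "dual_norm V nrm \<phi> = (SUP x\<in>{x\<in>carrier V. nrm x \<le> 1}. norm (\<phi> x))"

definition isometric_isomorphism ::
    "('k, 'v) module \<Rightarrow> ('v \<Rightarrow> real) \<Rightarrow> ('k, 'w) module \<Rightarrow> ('w \<Rightarrow> real) \<Rightarrow> ('v \<Rightarrow> 'w) \<Rightarrow> bool" where
  "isometric_isomorphism V nrmV W nrmW T \<longleftrightarrow>
     linear_map_on V W T \<and> bij_betw T (carrier V) (carrier W) \<and>
     (\<forall>x\<in>carrier V. nrmW (T x) = nrmV x)"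

section \<open>Almost-everywhere classes of random variables\<close>

definition ae_class :: "'a measure \<Rightarrow> ('a \<Rightarrow> 'k::topological_space) \<Rightarrow> ('a \<Rightarrow> 'k) set" where
  "ae_class M f = {g \<in> borel_measurable M. AE x in M. g x = f x}"

definition L0 :: "'a measure \<Rightarrow> ('a \<Rightarrow> 'k::topological_space) set set" where
  "L0 M = ae_class M ` borel_measurable M"

definition rv :: "('a \<Rightarrow> 'k) set \<Rightarrow> 'a \<Rightarrow> 'k" where
  "rv Y = (SOME f. f \<in> Y)"

definition ae_module ::
    "'a measure \<Rightarrow> ('a \<Rightarrow> 'k) set set \<Rightarrow> ('k::real_normed_field, ('a \<Rightarrow> 'k) set) module" where
  "ae_module M A =
     \<lparr>carrier = A, mult = undefined, one = undefined,
      zero = ae_class M (\<lambda>x. 0),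
      add = (\<lambda>Y Z. ae_class M (\<lambda>x. rv Y x + rv Z x)),
      smult = (\<lambda>c Y. ae_class M (\<lambda>x. c * rv Y x))\<rparr>"

section \<open>Distortion functions and the associated spaces\<close>

definition uniform_rvs :: "'a measure \<Rightarrow> ('a \<Rightarrow> real) set" where
  "uniform_rvs M = {U \<in> borel_measurable M. (\<forall>x\<in>space M. U x \<in> {0..1}) \<and>
     (\<forall>u\<in>{0..1}. measure M {x\<in>space M. U x \<le> u} = u)}"

text \<open>
  Only the values of \<open>\<sigma>\<close> on \<open>[0,1)\<close> matter; a uniformly distributed random variable takes the
  value 1 with probability 0.
\<close>

definition distortion :: "(real \<Rightarrow> real) \<Rightarrow> bool" where
  "distortion \<sigma> \<longleftrightarrow>
     mono_on {0..<1} \<sigma> \<and> (\<forall>u\<in>{0<..<1}. continuous (at_left u) \<sigma>) \<and>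
     (\<forall>u\<in>{0..<1}. 0 \<le> \<sigma> u) \<and> (\<integral>\<^sup>+u\<in>{0..<1}. ennreal (\<sigma> u) \<partial>lborel) = 1"

definition sigma1_val ::
    "'a measure \<Rightarrow> (real \<Rightarrow> real) \<Rightarrow> ('a \<Rightarrow> 'k::real_normed_vector) \<Rightarrow> ennreal" where
  "sigma1_val M \<sigma> Y = (SUP U\<in>uniform_rvs M. \<integral>\<^sup>+x. ennreal (\<sigma> (U x) * norm (Y x)) \<partial>M)"

definition L_sigma1 ::
    "'a measure \<Rightarrow> (real \<Rightarrow> real) \<Rightarrow> ('k::real_normed_field, ('a \<Rightarrow> 'k) set) module" where
  "L_sigma1 M \<sigma> = ae_module M {Y \<in> L0 M. sigma1_val M \<sigma> (rv Y) < \<infinity>}"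

definition sigma1_norm ::
    "'a measure \<Rightarrow> (real \<Rightarrow> real) \<Rightarrow> ('a \<Rightarrow> 'k::real_normed_vector) set \<Rightarrow> real" where
  "sigma1_norm M \<sigma> Y = enn2real (sigma1_val M \<sigma> (rv Y))"

text \<open>
  For \<open>0 < \<alpha> < 1\<close> the set below is nonempty and bounded from below. At the endpoints its infimum may
  be infinite; the integrals of the quantile function range over open intervals, which makes no
  difference to their values.
\<close>

definition quantile :: "'a measure \<Rightarrow> ('a \<Rightarrow> real) \<Rightarrow> real \<Rightarrow> real" where
  "quantile M W \<alpha> = Inf {q. \<alpha> \<le> cdf (distr M borel W) q}"

definition sigma_inf_val ::
    "'a measure \<Rightarrow> (real \<Rightarrow> real) \<Rightarrow> ('a \<Rightarrow> 'k::real_normed_vector) \<Rightarrow> ennreal" where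
  "sigma_inf_val M \<sigma> Z =
     (SUP \<alpha>\<in>{0..<1}.
        (\<integral>\<^sup>+u\<in>{\<alpha><..<1}. ennreal (quantile M (\<lambda>x. norm (Z x)) u) \<partial>lborel) /
        (\<integral>\<^sup>+u\<in>{\<alpha><..<1}. ennreal (\<sigma> u) \<partial>lborel))"

definition L_sigma_inf ::
    "'a measure \<Rightarrow> (real \<Rightarrow> real) \<Rightarrow> ('k::real_normed_field, ('a \<Rightarrow> 'k) set) module" where
  "L_sigma_inf M \<sigma> = ae_module M {Z \<in> L0 M. sigma_inf_val M \<sigma> (rv Z) < \<infinity>}"

definition sigma_inf_norm ::
    "'a measure \<Rightarrow> (real \<Rightarrow> real) \<Rightarrow> ('a \<Rightarrow> 'k::real_normed_vector) set \<Rightarrow> real" where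
  "sigma_inf_norm M \<sigma> Z = enn2real (sigma_inf_val M \<sigma> (rv Z))"

definition Phi ::
    "'a measure \<Rightarrow> (real \<Rightarrow> real) \<Rightarrow> ('a \<Rightarrow> 'k::{real_normed_field, banach, second_countable_topology}) set
      \<Rightarrow> ('a \<Rightarrow> 'k) set \<Rightarrow> 'k" where
  "Phi M \<sigma> Z = (\<lambda>Y\<in>carrier (L_sigma1 M \<sigma> :: ('k, ('a \<Rightarrow> 'k) set) module).
     \<integral>x. rv Z x * rv Y x \<partial>M)"

end

theory Submission
  imports Defs
begin

text \<open>
  Write \<open>S p\<close> for the integral of \<open>\<sigma>\<close> over \<open>(1 - p, 1)\<close>. On a probability space carrying a uniform
  variable, the tail integral of the quantile function of \<open>\<bar>Z\<bar>\<close> over \<open>(\<alpha>, 1)\<close> is the maximum of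
  \<open>E(\<bar>Z\<bar> 1\<^bsub>A\<^esub>)\<close> over the events \<open>A\<close> of probability \<open>1 - \<alpha>\<close>. Hence \<open>\<bar>Z\<bar>\<^sup>*\<close> is the least \<open>c\<close> with
  \<open>E(\<bar>Z\<bar> 1\<^bsub>A\<^esub>) \<le> c S(P A)\<close> for all \<open>A\<close>, which makes it a norm, and complete by Fatou's lemma.

  The pairing inequality \<open>E\<bar>ZY\<bar> \<le> \<bar>Z\<bar>\<^sup>* \<parallel>Y\<parallel>\<close> follows by layer cake from these bounds on level sets of
  \<open>Y\<close>, because an integer-valued variable \<open>N\<close> admits a comonotone uniform \<open>U\<close>, for which
  \<open>E(\<sigma>(U) 1\<^bsub>{N \<ge> k}\<^esub>) = S(P(N \<ge> k))\<close>. Conversely \<open>\<parallel>1\<^bsub>A\<^esub>\<parallel> \<le> S(P A)\<close>, so a functional \<open>\<phi>\<close> induces a set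
  function \<open>A \<mapsto> \<phi>(1\<^bsub>A\<^esub>)\<close> that vanishes continuously with \<open>P A\<close>; its Radon--Nikodym density represents
  \<open>\<phi>\<close> on simple functions, and those are dense by dominated convergence in \<open>L\<^sub>\<sigma>\<^sup>1\<close>.
\<close>

section \<open>Bounded functionals\<close>

text \<open>Quantile functions are not subadditive in the variable, whereas integrals over a fixed
  event are, and they pass to limits. This is why the norm of Z is handled through bounds on events
  once \<open>sigma_inf_val_le_iff\<close> is available. The norm of Y is a supremum over all
  uniform variables, so limit theorems do not apply to it directly. What helps is one U that is
  optimal on all level sets at once. Rounding to an integer-valued N provides it: N + V with V
  uniform has no atoms and integer part N almost surely, so its distribution function, evaluated at
  itself, is uniform and ordered like N. In the pairing inequality N is the integer part of m |Y|,
  and the rounding error E|Z| does not grow with m. In the dominated convergence theorem the same U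
  serves all truncations of N. The density Z of a functional is at first only integrable. Its norm
  is bounded by testing simple functions that approximate |Z|/Z on an event. These lose a factor 2,
  which is harmless: only finiteness is at stake there, and the isometry is proved
  separately.\<close>

lemma scalars_simps [simp]:
  "carrier scalars = UNIV" "a \<otimes>\<^bsub>scalars\<^esub> b = a * b" "\<one>\<^bsub>scalars\<^esub> = 1"
  "\<zero>\<^bsub>scalars\<^esub> = 0" "a \<oplus>\<^bsub>scalars\<^esub> b = a + b" "a \<odot>\<^bsub>scalars\<^esub> b = a * b"
  by (simp_all add: scalars_def)

lemma cring_scalars: "cring (scalars :: ('k::field, 'k) module)"
proof (intro cringI abelian_groupI comm_monoidI)
  show "\<exists>y\<in>carrier scalars. y \<oplus>\<^bsub>scalars\<^esub> x = \<zero>\<^bsub>scalars\<^esub>" for x :: 'k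
    by (simp add: exI[of _ "-x"])
qed (auto simp: algebra_simps)

lemma a_inv_scalars [simp]: "\<ominus>\<^bsub>scalars\<^esub> c = - (c :: 'k::field)"
proof -
  interpret cring "scalars :: ('k, 'k) module"
    by (rule cring_scalars)
  show ?thesis
    by (rule minus_equality) auto
qed

context
  fixes V :: "('k::real_normed_field, 'v) module" and nrm :: "'v \<Rightarrow> real"
  assumes V: "normed_space_on V nrm"
begin

interpretation module "scalars :: ('k, 'k) module" V
  using V by (simp add: normed_space_on_def)

lemma normed_nonneg: "x \<in> carrier V \<Longrightarrow> 0 \<le> nrm x"
  and normed_eq_0_iff: "x \<in> carrier V \<Longrightarrow> nrm x = 0 \<longleftrightarrow> x = \<zero>\<^bsub>V\<^esub>"
  and normed_smult: "x \<in> carrier V \<Longrightarrow> nrm (c \<odot>\<^bsub>V\<^esub> x) = norm c * nrm x"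
  and normed_add: "x \<in> carrier V \<Longrightarrow> y \<in> carrier V \<Longrightarrow> nrm (x \<oplus>\<^bsub>V\<^esub> y) \<le> nrm x + nrm y"
  using V by (auto simp: normed_space_on_def)

lemma a_inv_eq_smult: "x \<in> carrier V \<Longrightarrow> \<ominus>\<^bsub>V\<^esub> x = (- 1) \<odot>\<^bsub>V\<^esub> x"
  using smult_l_minus[of 1 x] smult_one[of x] by simp

lemma a_minus_eq_smult: "x \<in> carrier V \<Longrightarrow> y \<in> carrier V \<Longrightarrow> x \<ominus>\<^bsub>V\<^esub> y = x \<oplus>\<^bsub>V\<^esub> (- 1) \<odot>\<^bsub>V\<^esub> y"
  by (simp add: a_minus_def a_inv_eq_smult)

lemma normed_Metric_space: "Metric_space (carrier V) (norm_dist V nrm)"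
proof
  fix x y z
  show "0 \<le> norm_dist V nrm x y"
    by (simp add: norm_dist_def normed_nonneg)
  show "norm_dist V nrm x y = norm_dist V nrm y x"
  proof (cases "x \<in> carrier V \<and> y \<in> carrier V")
    case True
    then have "y \<ominus>\<^bsub>V\<^esub> x = (- 1) \<odot>\<^bsub>V\<^esub> (x \<ominus>\<^bsub>V\<^esub> y)"
      by (simp add: a_inv_eq_smult[symmetric] a_minus_def M.minus_add M.a_comm)
    with True show ?thesis
      by (simp add: norm_dist_def normed_smult)
  qed (auto simp: norm_dist_def)
  assume xy: "x \<in> carrier V" "y \<in> carrier V"
  have "(x \<ominus>\<^bsub>V\<^esub> y) \<oplus>\<^bsub>V\<^esub> y = x" "x \<ominus>\<^bsub>V\<^esub> x = \<zero>\<^bsub>V\<^esub>"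
    using xy by (simp_all add: a_minus_def M.a_assoc M.l_neg M.r_neg)
  then have "x \<ominus>\<^bsub>V\<^esub> y = \<zero>\<^bsub>V\<^esub> \<longleftrightarrow> x = y"
    using xy by (metis M.l_zero)
  with xy show "norm_dist V nrm x y = 0 \<longleftrightarrow> x = y"
    by (simp add: norm_dist_def normed_eq_0_iff)
  assume z: "z \<in> carrier V"
  have "x \<ominus>\<^bsub>V\<^esub> z = (x \<ominus>\<^bsub>V\<^esub> y) \<oplus>\<^bsub>V\<^esub> (y \<ominus>\<^bsub>V\<^esub> z)"
    using xy z by (simp add: a_minus_def M.a_assoc M.r_neg1)
  with xy z show "norm_dist V nrm x z \<le> norm_dist V nrm x y + norm_dist V nrm y z"
    by (simp add: norm_dist_def normed_add)
qed

context
  fixes \<phi> :: "'v \<Rightarrow> 'k"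
  assumes \<phi>: "linear_map_on V scalars \<phi>"
begin

lemma linear_add: "x \<in> carrier V \<Longrightarrow> y \<in> carrier V \<Longrightarrow> \<phi> (x \<oplus>\<^bsub>V\<^esub> y) = \<phi> x + \<phi> y"
  and linear_smult: "x \<in> carrier V \<Longrightarrow> \<phi> (c \<odot>\<^bsub>V\<^esub> x) = c * \<phi> x"
  using \<phi> by (auto simp: linear_map_on_def)

lemma linear_zero: "\<phi> \<zero>\<^bsub>V\<^esub> = 0"
  using linear_smult[of "\<zero>\<^bsub>V\<^esub>" 0] smult_l_null[of "\<zero>\<^bsub>V\<^esub>"] by simp

lemma linear_minus: "x \<in> carrier V \<Longrightarrow> y \<in> carrier V \<Longrightarrow> \<phi> (x \<ominus>\<^bsub>V\<^esub> y) = \<phi> x - \<phi> y"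
  by (simp add: a_minus_eq_smult linear_add linear_smult)

text \<open>Linearity reduces continuity to continuity at zero, and homogeneity turns a ball on
  which the functional is small into a global constant. From here on the dual is described by bounds
  alone.\<close>

lemma continuous_linear_iff_bounded:
  "continuous_map (Metric_space.mtopology (carrier V) (norm_dist V nrm)) euclidean \<phi> \<longleftrightarrow>
     (\<exists>C\<ge>0. \<forall>x\<in>carrier V. norm (\<phi> x) \<le> C * nrm x)"
proof -
  interpret Metric_space "carrier V" "norm_dist V nrm"
    by (rule normed_Metric_space)
  have "continuous_map mtopology euclidean \<phi> \<longleftrightarrow> (\<forall>a\<in>carrier V. \<forall>\<epsilon>>0. \<exists>\<delta>>0. \<forall>x.
      x \<in> carrier V \<and> norm_dist V nrm a x < \<delta> \<longrightarrow> dist (\<phi> a) (\<phi> x) < \<epsilon>)" (is "_ \<longleftrightarrow> ?C")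
    using metric_continuous_map[OF Met_TC.Metric_space_axioms, of \<phi>] by simp
  also have "\<dots> \<longleftrightarrow> (\<exists>C\<ge>0. \<forall>x\<in>carrier V. norm (\<phi> x) \<le> C * nrm x)"
  proof
    assume ?C
    then obtain \<delta> where \<delta>: "0 < \<delta>" and
      small: "\<And>x. x \<in> carrier V \<Longrightarrow> norm_dist V nrm \<zero>\<^bsub>V\<^esub> x < \<delta> \<Longrightarrow> dist (\<phi> \<zero>\<^bsub>V\<^esub>) (\<phi> x) < 1"
      using M.zero_closed zero_less_one by metis
    have nrm_small: "norm (\<phi> x) < 1" if "x \<in> carrier V" "nrm x < \<delta>" for x
    proof -
      have "norm_dist V nrm x \<zero>\<^bsub>V\<^esub> = nrm x"
        using that by (simp add: norm_dist_def a_minus_eq_smult)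
      then show ?thesis
        using small[OF that(1)] that by (simp add: commute linear_zero)
    qed
    \<comment> \<open>Scaling \<open>x\<close> to norm \<open>\<delta> / 2\<close> puts it strictly
      inside the ball of radius \<open>\<delta>\<close>, hence the factor 2.\<close>
    have "norm (\<phi> x) \<le> 2 / \<delta> * nrm x" if x: "x \<in> carrier V" for x
    proof (cases "nrm x = 0")
      case True
      then have "x = \<zero>\<^bsub>V\<^esub>"
        using normed_eq_0_iff x by simp
      then show ?thesis
        using True by (simp add: linear_zero)
    next
      case False
      then have pos: "0 < nrm x"
        using normed_nonneg[OF x] by simp
      define c :: 'k where "c = of_real (\<delta> / (2 * nrm x))"
      have c: "norm c = \<delta> / (2 * nrm x)"
        using pos \<delta> by (simp add: c_def norm_divide norm_mult)
      have "norm c * norm (\<phi> x) < 1"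
        using nrm_small[of "c \<odot>\<^bsub>V\<^esub> x"] x pos \<delta>
        by (simp add: normed_smult linear_smult norm_mult c)
      then show ?thesis
        using pos \<delta> by (simp add: c field_simps)
    qed
    then show "\<exists>C\<ge>0. \<forall>x\<in>carrier V. norm (\<phi> x) \<le> C * nrm x"
      using \<delta> by (intro exI[of _ "2 / \<delta>"]) auto
  next
    assume "\<exists>C\<ge>0. \<forall>x\<in>carrier V. norm (\<phi> x) \<le> C * nrm x"
    then obtain C where C: "0 \<le> C" "\<And>x. x \<in> carrier V \<Longrightarrow> norm (\<phi> x) \<le> C * nrm x"
      by auto
    \<comment> \<open>The divisor \<open>C + 1\<close> is positive even when
      \<open>C = 0\<close>.\<close>
    have "dist (\<phi> a) (\<phi> x) < \<epsilon>"
      if "0 < \<epsilon>" "a \<in> carrier V" "x \<in> carrier V" "norm_dist V nrm a x < \<epsilon> / (C + 1)" for a x \<epsilon>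
    proof -
      have nn: "0 \<le> nrm (a \<ominus>\<^bsub>V\<^esub> x)"
        using that by (simp add: normed_nonneg)
      have "dist (\<phi> a) (\<phi> x) = norm (\<phi> (a \<ominus>\<^bsub>V\<^esub> x))"
        using that by (simp add: dist_norm linear_minus)
      also have "\<dots> \<le> C * nrm (a \<ominus>\<^bsub>V\<^esub> x)"
        using that by (intro C) simp
      also have "\<dots> \<le> (C + 1) * nrm (a \<ominus>\<^bsub>V\<^esub> x)"
        using nn by (simp add: algebra_simps)
      also have "\<dots> < \<epsilon>"
        using that C(1) by (simp add: norm_dist_def field_simps)
      finally show ?thesis .
    qed
    then show ?C
      using C(1) by (metis add_nonneg_pos divide_pos_pos zero_less_one)
  qed
  finally show ?thesis .
qed

end

lemma in_continuous_dual_iff: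
  "\<phi> \<in> carrier (continuous_dual V nrm) \<longleftrightarrow> \<phi> \<in> extensional (carrier V) \<and> linear_map_on V scalars \<phi> \<and>
     (\<exists>C\<ge>0. \<forall>x\<in>carrier V. norm (\<phi> x) \<le> C * nrm x)"
  by (auto simp: continuous_dual_def continuous_linear_iff_bounded)

lemma dual_norm_le:
  assumes "0 \<le> C" "\<And>x. x \<in> carrier V \<Longrightarrow> norm (\<phi> x) \<le> C * nrm x"
  shows "dual_norm V nrm \<phi> \<le> C"
  unfolding dual_norm_def
proof (rule cSUP_least)
  show "{x \<in> carrier V. nrm x \<le> 1} \<noteq> {}"
    using normed_eq_0_iff[of "\<zero>\<^bsub>V\<^esub>"] by (auto intro!: exI[of _ "\<zero>\<^bsub>V\<^esub>"])
  fix x assume "x \<in> {x \<in> carrier V. nrm x \<le> 1}"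
  then show "norm (\<phi> x) \<le> C"
    using assms(2)[of x] mult_left_le[OF _ assms(1), of "nrm x"] by simp
qed

text \<open>\<open>dual_norm\<close> is a supremum in the reals and carries information only if the
  values are bounded above. Membership in the dual supplies that bound; then \<open>x\<close> is
  scaled to norm 1.\<close>

lemma norm_le_dual_norm:
  assumes \<phi>: "\<phi> \<in> carrier (continuous_dual V nrm)" and x: "x \<in> carrier V"
  shows "norm (\<phi> x) \<le> dual_norm V nrm \<phi> * nrm x"
proof (cases "nrm x = 0")
  case True
  with x \<phi> have "\<phi> x = 0"
    by (auto simp: in_continuous_dual_iff normed_eq_0_iff linear_zero)
  with True show ?thesis
    by simp
next
  case False
  then have pos: "0 < nrm x"
    using normed_nonneg[OF x] by simp
  obtain C where C: "0 \<le> C" "\<And>x. x \<in> carrier V \<Longrightarrow> norm (\<phi> x) \<le> C * nrm x"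
    using \<phi> unfolding in_continuous_dual_iff by blast
  have lin: "linear_map_on V scalars \<phi>"
    using \<phi> by (simp add: in_continuous_dual_iff)
  let ?c = "of_real (inverse (nrm x)) :: 'k"
  have "norm (\<phi> (?c \<odot>\<^bsub>V\<^esub> x)) \<le> dual_norm V nrm \<phi>"
    unfolding dual_norm_def
  proof (rule cSUP_upper)
    show "?c \<odot>\<^bsub>V\<^esub> x \<in> {x \<in> carrier V. nrm x \<le> 1}"
      using x pos by (simp add: normed_smult norm_inverse)
    show "bdd_above ((\<lambda>x. norm (\<phi> x)) ` {x \<in> carrier V. nrm x \<le> 1})"
      using C by (auto intro!: bdd_aboveI[of _ C] order_trans[OF C(2)] mult_left_le)
  qed
  then show ?thesis
    using pos x by (simp add: linear_smult[OF lin] norm_mult norm_inverse norm_divide field_simps)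
qed

end

section \<open>Normed spaces of almost-everywhere classes\<close>

lemma mem_ae_class: "f \<in> borel_measurable M \<Longrightarrow> f \<in> ae_class M f"
  by (simp add: ae_class_def)

lemma rv_ae_class:
  assumes "f \<in> borel_measurable M"
  shows "rv (ae_class M f) \<in> borel_measurable M" "AE x in M. rv (ae_class M f) x = f x"
proof -
  have "rv (ae_class M f) \<in> ae_class M f"
    unfolding rv_def using mem_ae_class[OF assms] by (rule someI[where P="\<lambda>g. g \<in> ae_class M f"])
  then show "rv (ae_class M f) \<in> borel_measurable M" "AE x in M. rv (ae_class M f) x = f x"
    by (auto simp: ae_class_def)
qed

lemma ae_class_cong:
  assumes "AE x in M. f x = g x"
  shows "ae_class M f = ae_class M g"
proof -
  have "(AE x in M. h x = f x) \<longleftrightarrow> (AE x in M. h x = g x)" for h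
    using assms by (intro iffI; elim AE_mp) (auto elim: AE_mp)
  then show ?thesis
    by (simp add: ae_class_def)
qed

lemma ae_class_in_L0: "f \<in> borel_measurable M \<Longrightarrow> ae_class M f \<in> L0 M"
  by (simp add: L0_def)

lemma L0_rv:
  assumes "Y \<in> L0 M"
  shows "rv Y \<in> borel_measurable M" "ae_class M (rv Y) = Y"
proof -
  obtain f where f: "f \<in> borel_measurable M" "Y = ae_class M f"
    using assms by (auto simp: L0_def)
  show "rv Y \<in> borel_measurable M"
    unfolding f(2) by (rule rv_ae_class[OF f(1)])
  show "ae_class M (rv Y) = Y"
    unfolding f(2) by (rule ae_class_cong[OF rv_ae_class(2)[OF f(1)]])
qed

lemma L0_eqI:
  assumes "Y \<in> L0 M" "Z \<in> L0 M" "AE x in M. rv Y x = rv Z x"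
  shows "Y = Z"
  using ae_class_cong[OF assms(3)] L0_rv(2)[OF assms(1)] L0_rv(2)[OF assms(2)] by simp

text \<open>Both spaces are the finite part of an extended norm on measurable functions. Homogeneity
  is required as an inequality only, since scaling back by \<open>inverse c\<close> gives the
  converse.\<close>

locale ae_norm =
  fixes M :: "'a measure" and N :: "('a \<Rightarrow> 'k::{real_normed_field, second_countable_topology}) \<Rightarrow> ennreal"
  assumes N_cong: "\<And>f g. f \<in> borel_measurable M \<Longrightarrow> g \<in> borel_measurable M \<Longrightarrow>
      AE x in M. f x = g x \<Longrightarrow> N f = N g"
    and N_add: "\<And>f g. f \<in> borel_measurable M \<Longrightarrow> g \<in> borel_measurable M \<Longrightarrow>
      N (\<lambda>x. f x + g x) \<le> N f + N g"
    and N_scale_le: "\<And>f c. f \<in> borel_measurable M \<Longrightarrow> N (\<lambda>x. c * f x) \<le> ennreal (norm c) * N f"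
    and N_definite: "\<And>f. f \<in> borel_measurable M \<Longrightarrow> N f = 0 \<Longrightarrow> AE x in M. f x = 0"
begin

definition "V = ae_module M {Y \<in> L0 M. N (rv Y) < \<infinity>}"
abbreviation "nrm Y \<equiv> enn2real (N (rv Y))"

lemma N_zero: "N (\<lambda>x. 0) = 0"
  using N_scale_le[of "\<lambda>x. 0" 0] by simp

lemma N_scale:
  assumes [measurable]: "f \<in> borel_measurable M"
  shows "N (\<lambda>x. c * f x) = ennreal (norm c) * N f"
proof (cases "c = 0")
  case False
  have "N f = N (\<lambda>x. inverse c * (c * f x))"
    using False by (simp add: field_simps)
  also have "\<dots> \<le> ennreal (norm (inverse c)) * N (\<lambda>x. c * f x)"
    by (rule N_scale_le) simp
  finally have "ennreal (norm c) * N f \<le> ennreal (norm c) * (ennreal (norm (inverse c)) * N (\<lambda>x. c * f x))"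
    by (rule mult_left_mono) simp
  also have "\<dots> = N (\<lambda>x. c * f x)"
    using False by (simp add: mult.assoc[symmetric] ennreal_mult[symmetric] norm_inverse)
  finally show ?thesis
    using N_scale_le[of f c] by simp
qed (simp add: N_zero)

lemma carrier_iff: "Y \<in> carrier V \<longleftrightarrow> Y \<in> L0 M \<and> N (rv Y) < \<infinity>"
  by (simp add: V_def ae_module_def)

lemma rv_measurable: "Y \<in> carrier V \<Longrightarrow> rv Y \<in> borel_measurable M"
  by (simp add: carrier_iff L0_rv)

lemma N_rv_ae_class: "f \<in> borel_measurable M \<Longrightarrow> N (rv (ae_class M f)) = N f"
  by (intro N_cong rv_ae_class)

lemma ae_class_in_carrier: "f \<in> borel_measurable M \<Longrightarrow> N f < \<infinity> \<Longrightarrow> ae_class M f \<in> carrier V"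
  by (simp add: carrier_iff ae_class_in_L0 N_rv_ae_class)

lemma add_eq: "Y \<oplus>\<^bsub>V\<^esub> Z = ae_class M (\<lambda>x. rv Y x + rv Z x)"
  and smult_eq: "c \<odot>\<^bsub>V\<^esub> Y = ae_class M (\<lambda>x. c * rv Y x)"
  and zero_eq: "\<zero>\<^bsub>V\<^esub> = ae_class M (\<lambda>x. 0)"
  by (simp_all add: V_def ae_module_def)

lemma rv_add:
  "Y \<in> carrier V \<Longrightarrow> Z \<in> carrier V \<Longrightarrow> AE x in M. rv (Y \<oplus>\<^bsub>V\<^esub> Z) x = rv Y x + rv Z x"
  unfolding add_eq by (intro rv_ae_class borel_measurable_add rv_measurable)

lemma rv_smult: "Y \<in> carrier V \<Longrightarrow> AE x in M. rv (c \<odot>\<^bsub>V\<^esub> Y) x = c * rv Y x"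
  unfolding smult_eq by (intro rv_ae_class borel_measurable_times rv_measurable borel_measurable_const)

lemma rv_zero: "AE x in M. rv \<zero>\<^bsub>V\<^esub> x = 0"
  unfolding zero_eq by (intro rv_ae_class borel_measurable_const)

lemma add_ae_class:
  "f \<in> borel_measurable M \<Longrightarrow> g \<in> borel_measurable M \<Longrightarrow>
    ae_class M f \<oplus>\<^bsub>V\<^esub> ae_class M g = ae_class M (\<lambda>x. f x + g x)"
  unfolding add_eq using rv_ae_class(2)[of f M] rv_ae_class(2)[of g M] by (intro ae_class_cong) auto

lemma smult_ae_class:
  "f \<in> borel_measurable M \<Longrightarrow> c \<odot>\<^bsub>V\<^esub> ae_class M f = ae_class M (\<lambda>x. c * f x)"
  unfolding smult_eq using rv_ae_class(2)[of f M] by (intro ae_class_cong) auto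

lemma zero_in_carrier: "\<zero>\<^bsub>V\<^esub> \<in> carrier V"
  unfolding zero_eq by (intro ae_class_in_carrier) (auto simp: N_zero)

lemma add_in_carrier:
  assumes "Y \<in> carrier V" "Z \<in> carrier V"
  shows "Y \<oplus>\<^bsub>V\<^esub> Z \<in> carrier V"
  unfolding add_eq
proof (rule ae_class_in_carrier)
  note [measurable] = rv_measurable[OF assms(1)] rv_measurable[OF assms(2)]
  show "(\<lambda>x. rv Y x + rv Z x) \<in> borel_measurable M"
    by simp
  have "N (\<lambda>x. rv Y x + rv Z x) \<le> N (rv Y) + N (rv Z)"
    by (rule N_add) auto
  also have "\<dots> < \<infinity>"
    using assms by (simp add: carrier_iff)
  finally show "N (\<lambda>x. rv Y x + rv Z x) < \<infinity>" .
qed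

lemma smult_in_carrier:
  assumes "Y \<in> carrier V"
  shows "c \<odot>\<^bsub>V\<^esub> Y \<in> carrier V"
  unfolding smult_eq using assms rv_measurable[OF assms]
  by (intro ae_class_in_carrier) (auto simp: N_scale carrier_iff ennreal_mult_less_top)

lemma carrier_eqI:
  "Y \<in> carrier V \<Longrightarrow> Z \<in> carrier V \<Longrightarrow> AE x in M. rv Y x = rv Z x \<Longrightarrow> Y = Z"
  by (rule L0_eqI) (simp_all add: carrier_iff)

text \<open>The representative of a sum equals the sum of the representatives only almost
  everywhere. Each axiom is therefore checked pointwise off a null set and lifted to classes by
  \<open>carrier_eqI\<close>.\<close>

lemma module_V: "module (scalars :: ('k, 'k) module) V"
proof (intro moduleI cring_scalars abelian_groupI)
  note closed = add_in_carrier smult_in_carrier zero_in_carrier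
  fix Y Z W and a b :: 'k
  assume Y: "Y \<in> carrier V"
  show "\<zero>\<^bsub>V\<^esub> \<oplus>\<^bsub>V\<^esub> Y = Y"
    by (rule carrier_eqI) (use Y closed rv_add[OF zero_in_carrier Y] rv_zero in auto)
  have "(- 1) \<odot>\<^bsub>V\<^esub> Y \<oplus>\<^bsub>V\<^esub> Y = \<zero>\<^bsub>V\<^esub>"
    by (rule carrier_eqI)
      (use Y closed rv_add[OF smult_in_carrier[OF Y] Y, of "- 1"] rv_zero rv_smult[OF Y, of "- 1"] in auto)
  then show "\<exists>Z\<in>carrier V. Z \<oplus>\<^bsub>V\<^esub> Y = \<zero>\<^bsub>V\<^esub>"
    using smult_in_carrier[OF Y] by blast
  show "\<one>\<^bsub>scalars\<^esub> \<odot>\<^bsub>V\<^esub> Y = Y"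
    by (rule carrier_eqI) (use Y closed rv_smult[OF Y, of 1] in auto)
  show "(a \<oplus>\<^bsub>scalars\<^esub> b) \<odot>\<^bsub>V\<^esub> Y = a \<odot>\<^bsub>V\<^esub> Y \<oplus>\<^bsub>V\<^esub> b \<odot>\<^bsub>V\<^esub> Y"
  proof (rule carrier_eqI)
    show "AE x in M. rv ((a \<oplus>\<^bsub>scalars\<^esub> b) \<odot>\<^bsub>V\<^esub> Y) x = rv (a \<odot>\<^bsub>V\<^esub> Y \<oplus>\<^bsub>V\<^esub> b \<odot>\<^bsub>V\<^esub> Y) x"
      using rv_smult[OF Y, of "a + b"] rv_smult[OF Y, of a] rv_smult[OF Y, of b]
        rv_add[OF smult_in_carrier[OF Y] smult_in_carrier[OF Y], of a b]
      by eventually_elim (simp add: algebra_simps)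
  qed (use Y closed in auto)
  show "(a \<otimes>\<^bsub>scalars\<^esub> b) \<odot>\<^bsub>V\<^esub> Y = a \<odot>\<^bsub>V\<^esub> (b \<odot>\<^bsub>V\<^esub> Y)"
  proof (rule carrier_eqI)
    show "AE x in M. rv ((a \<otimes>\<^bsub>scalars\<^esub> b) \<odot>\<^bsub>V\<^esub> Y) x = rv (a \<odot>\<^bsub>V\<^esub> (b \<odot>\<^bsub>V\<^esub> Y)) x"
      using rv_smult[OF Y, of "a * b"] rv_smult[OF Y, of b] rv_smult[OF smult_in_carrier[OF Y], of a b]
      by eventually_elim (simp add: algebra_simps)
  qed (use Y closed in auto)
  assume Z: "Z \<in> carrier V"
  show "Y \<oplus>\<^bsub>V\<^esub> Z = Z \<oplus>\<^bsub>V\<^esub> Y"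
    by (simp add: add_eq add.commute)
  show "a \<odot>\<^bsub>V\<^esub> (Y \<oplus>\<^bsub>V\<^esub> Z) = a \<odot>\<^bsub>V\<^esub> Y \<oplus>\<^bsub>V\<^esub> a \<odot>\<^bsub>V\<^esub> Z"
  proof (rule carrier_eqI)
    show "AE x in M. rv (a \<odot>\<^bsub>V\<^esub> (Y \<oplus>\<^bsub>V\<^esub> Z)) x = rv (a \<odot>\<^bsub>V\<^esub> Y \<oplus>\<^bsub>V\<^esub> a \<odot>\<^bsub>V\<^esub> Z) x"
      using rv_smult[OF add_in_carrier[OF Y Z], of a] rv_add[OF Y Z] rv_smult[OF Y, of a] rv_smult[OF Z, of a]
        rv_add[OF smult_in_carrier[OF Y] smult_in_carrier[OF Z], of a a]
      by eventually_elim (simp add: algebra_simps)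
  qed (use Y Z closed in auto)
  assume W: "W \<in> carrier V"
  show "Y \<oplus>\<^bsub>V\<^esub> Z \<oplus>\<^bsub>V\<^esub> W = Y \<oplus>\<^bsub>V\<^esub> (Z \<oplus>\<^bsub>V\<^esub> W)"
  proof (rule carrier_eqI)
    show "AE x in M. rv (Y \<oplus>\<^bsub>V\<^esub> Z \<oplus>\<^bsub>V\<^esub> W) x = rv (Y \<oplus>\<^bsub>V\<^esub> (Z \<oplus>\<^bsub>V\<^esub> W)) x"
      using rv_add[OF add_in_carrier[OF Y Z] W] rv_add[OF Y Z] rv_add[OF Y add_in_carrier[OF Z W]] rv_add[OF Z W]
      by eventually_elim (simp add: algebra_simps)
  qed (use Y Z W closed in auto)
qed (use add_in_carrier smult_in_carrier zero_in_carrier in auto)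

lemma normed_space_V: "normed_space_on V nrm"
  unfolding normed_space_on_def
proof (intro conjI ballI allI module_V)
  fix Y and c :: 'k assume Y: "Y \<in> carrier V"
  show "0 \<le> nrm Y"
    by simp
  show "nrm (c \<odot>\<^bsub>V\<^esub> Y) = norm c * nrm Y"
    using rv_measurable[OF Y] by (simp add: smult_eq N_rv_ae_class N_scale enn2real_mult)
  show "nrm Y = 0 \<longleftrightarrow> Y = \<zero>\<^bsub>V\<^esub>"
  proof
    assume "nrm Y = 0"
    then have "N (rv Y) = 0"
      using Y by (auto simp: carrier_iff enn2real_eq_0_iff)
    then have "AE x in M. rv Y x = 0"
      by (rule N_definite[OF rv_measurable[OF Y]])
    then show "Y = \<zero>\<^bsub>V\<^esub>"
      using rv_zero by (intro carrier_eqI Y zero_in_carrier) auto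
  next
    assume "Y = \<zero>\<^bsub>V\<^esub>"
    then show "nrm Y = 0"
      by (simp add: zero_eq N_rv_ae_class N_zero)
  qed
  fix Z assume Z: "Z \<in> carrier V"
  note [measurable] = rv_measurable[OF Y] rv_measurable[OF Z]
  have "N (\<lambda>x. rv Y x + rv Z x) \<le> N (rv Y) + N (rv Z)"
    by (rule N_add) auto
  then have "enn2real (N (\<lambda>x. rv Y x + rv Z x)) \<le> enn2real (N (rv Y) + N (rv Z))"
    using Y Z by (intro enn2real_mono) (auto simp: carrier_iff)
  then show "nrm (Y \<oplus>\<^bsub>V\<^esub> Z) \<le> nrm Y + nrm Z"
    using Y Z by (simp add: add_eq N_rv_ae_class carrier_iff enn2real_plus)
qed

lemma minus_eq:
  assumes "Y \<in> carrier V" "Z \<in> carrier V"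
  shows "Y \<ominus>\<^bsub>V\<^esub> Z = ae_class M (\<lambda>x. rv Y x - rv Z x)"
proof -
  have "Y \<ominus>\<^bsub>V\<^esub> Z = ae_class M (\<lambda>x. rv Y x + rv ((- 1) \<odot>\<^bsub>V\<^esub> Z) x)"
    using assms by (simp add: a_minus_eq_smult[OF normed_space_V] add_eq)
  also have "\<dots> = ae_class M (\<lambda>x. rv Y x - rv Z x)"
    using rv_smult[OF assms(2), of "- 1"] by (intro ae_class_cong) auto
  finally show ?thesis .
qed

lemma minus_in_carrier: "Y \<in> carrier V \<Longrightarrow> Z \<in> carrier V \<Longrightarrow> Y \<ominus>\<^bsub>V\<^esub> Z \<in> carrier V"
  by (simp add: a_minus_eq_smult[OF normed_space_V] add_in_carrier smult_in_carrier)

lemma norm_dist_eq: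
  assumes "Y \<in> carrier V" "Z \<in> carrier V"
  shows "norm_dist V nrm Y Z = enn2real (N (\<lambda>x. rv Y x - rv Z x))"
  using assms rv_measurable[OF assms(1)] rv_measurable[OF assms(2)]
  by (simp add: norm_dist_def minus_eq N_rv_ae_class)

end

section \<open>Uniform random variables and the distortion function\<close>

locale distortion_prob_space = prob_space M for M :: "'a measure" +
  fixes \<sigma> :: "real \<Rightarrow> real"
  assumes uniform_rvs_nonempty: "uniform_rvs M \<noteq> {}"
    and distortion_sigma: "distortion \<sigma>"
begin

text \<open>Nothing is assumed about \<open>\<sigma>\<close> outside \<open>[0, 1)\<close>; cutting it off there makes it Borel measurable and
  nonnegative everywhere.\<close>

definition \<rho> :: "real \<Rightarrow> real" where
  "\<rho> u = (if u \<in> {0..<1} then \<sigma> u else 0)"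

text \<open>The fundamental function of the space: E(\<sigma>(U) 1_A) is at most
  \<open>S (prob A)\<close> for every uniform U, with equality when U is large precisely on A. For
  \<open>p = 1\<close> the interval misses only the point 0 of [0, 1).\<close>

definition S :: "real \<Rightarrow> ennreal" where
  "S p = (\<integral>\<^sup>+u\<in>{1-p<..<1}. ennreal (\<sigma> u) \<partial>lborel)"

lemma sigma_nonneg: "0 \<le> u \<Longrightarrow> u < 1 \<Longrightarrow> 0 \<le> \<sigma> u"
  using distortion_sigma by (auto simp: distortion_def)

lemma sigma_mono: "0 \<le> u \<Longrightarrow> u \<le> v \<Longrightarrow> v < 1 \<Longrightarrow> \<sigma> u \<le> \<sigma> v"
  using distortion_sigma by (auto simp: distortion_def mono_on_def)

lemma measurable_rho [measurable]: "\<rho> \<in> borel_measurable borel"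
proof -
  have "\<sigma> \<in> borel_measurable (restrict_space borel {0..<1})"
    using distortion_sigma by (intro borel_measurable_mono_on_fnc) (auto simp: distortion_def)
  then show ?thesis
    by (subst (asm) borel_measurable_restrict_space_iff)
      (auto simp: \<rho>_def[abs_def] indicator_def of_bool_def if_distrib if_distribR cong: if_cong)
qed

lemma rho_nonneg: "0 \<le> \<rho> u"
  by (auto simp: \<rho>_def sigma_nonneg)

text \<open>For \<open>p \<le> 1\<close> the interval does not reach below 0, and beyond 1
  \<open>\<rho>\<close> vanishes. So the half-line may replace the bounded interval.\<close>

lemma S_eq: "p \<le> 1 \<Longrightarrow> S p = (\<integral>\<^sup>+u. ennreal (\<rho> u) * indicator {1-p<..} u \<partial>lborel)"
  unfolding S_def by (intro nn_integral_cong) (auto simp: \<rho>_def indicator_def)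

lemma nn_integral_rho: "(\<integral>\<^sup>+u. ennreal (\<rho> u) \<partial>lborel) = 1"
proof -
  have "(\<integral>\<^sup>+u. ennreal (\<rho> u) \<partial>lborel) = (\<integral>\<^sup>+u\<in>{0..<1}. ennreal (\<sigma> u) \<partial>lborel)"
    by (intro nn_integral_cong) (auto simp: \<rho>_def indicator_def)
  then show ?thesis
    using distortion_sigma by (simp add: distortion_def)
qed

lemma S_one: "S 1 = 1"
proof -
  have "S 1 = (\<integral>\<^sup>+u. ennreal (\<rho> u) \<partial>lborel)"
    using AE_lborel_singleton[of 0] unfolding S_eq[OF order_refl]
    by (intro nn_integral_cong_AE) (auto simp: \<rho>_def indicator_def)
  then show ?thesis
    by (simp add: nn_integral_rho)
qed

lemma S_zero [simp]: "S 0 = 0"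
  by (simp add: S_eq \<rho>_def indicator_def cong: if_cong)
    (auto intro!: nn_integral_zero' simp: indicator_def)

lemma S_mono: "p \<le> q \<Longrightarrow> q \<le> 1 \<Longrightarrow> S p \<le> S q"
  by (simp add: S_eq) (intro nn_integral_mono, auto simp: indicator_def)

lemma S_le_one: "p \<le> 1 \<Longrightarrow> S p \<le> 1"
  using S_mono[of p 1] by (simp add: S_one)

lemma S_finite: "p \<le> 1 \<Longrightarrow> S p < \<infinity>"
  using S_le_one[of p] by (simp add: order_le_less_trans)

lemma uniform_nn_integral:
  assumes U: "U \<in> uniform_rvs M" and g [measurable]: "g \<in> borel_measurable borel"
  shows "(\<integral>\<^sup>+x. g (U x) \<partial>M) = (\<integral>\<^sup>+u. indicator {0..1} u * g u \<partial>lborel)"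
proof -
  have "distributed M lborel U (\<lambda>x. ennreal (indicator {0..1} x / measure lborel {0..1::real}))"
    using U by (intro uniform_distrI_borel_atLeastAtMost) (auto simp: uniform_rvs_def)
  from distributed_nn_integral[OF this, of g] show ?thesis
    by (simp add: ennreal_indicator)
qed

lemma uniform_measurable: "U \<in> uniform_rvs M \<Longrightarrow> U \<in> borel_measurable M"
  by (simp add: uniform_rvs_def)

lemma uniform_null:
  assumes U: "U \<in> uniform_rvs M"
  shows "AE x in M. U x \<noteq> u"
proof -
  note [measurable] = uniform_measurable[OF U]
  have "emeasure M {x\<in>space M. U x = u} = (\<integral>\<^sup>+x. indicator {x\<in>space M. U x = u} x \<partial>M)"
    by simp
  also have "\<dots> = (\<integral>\<^sup>+x. indicator {u} (U x) \<partial>M)"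
    by (intro nn_integral_cong) (auto split: split_indicator)
  also have "\<dots> = (\<integral>\<^sup>+v. indicator {0..1} v * indicator {u} v \<partial>lborel)"
    by (rule uniform_nn_integral[OF U]) auto
  also have "\<dots> = 0"
    using AE_lborel_singleton[of u]
    by (subst nn_integral_0_iff_AE) (auto simp: indicator_def)
  finally show ?thesis
    by (subst AE_iff_measurable[OF _ refl]) auto
qed

lemma uniform_AE_sigma:
  assumes U: "U \<in> uniform_rvs M"
  shows "AE x in M. \<sigma> (U x) = \<rho> (U x)"
  using uniform_null[OF U, of 1] AE_space
  by eventually_elim (use U in \<open>auto simp: uniform_rvs_def \<rho>_def less_le\<close>)

lemma uniform_nn_integral_rho:
  assumes U: "U \<in> uniform_rvs M" and a: "0 \<le> a"
  shows "(\<integral>\<^sup>+x. ennreal (\<rho> (U x)) * indicator {a<..} (U x) \<partial>M) = S (1 - a)"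
  using a by (simp add: uniform_nn_integral[OF U, where g="\<lambda>u. ennreal (\<rho> u) * indicator {a<..} u"] S_eq)
    (auto intro!: nn_integral_cong simp: indicator_def \<rho>_def)

lemma uniform_measure_gt:
  assumes U: "U \<in> uniform_rvs M" and a: "0 \<le> a" "a \<le> 1"
  shows "emeasure M {x\<in>space M. a < U x} = ennreal (1 - a)"
proof -
  note [measurable] = uniform_measurable[OF U]
  have "{x\<in>space M. a < U x} = space M - {x\<in>space M. U x \<le> a}"
    by auto
  then have "prob {x\<in>space M. a < U x} = 1 - prob {x\<in>space M. U x \<le> a}"
    by (simp add: prob_compl)
  also have "\<dots> = 1 - a"
    using U a by (auto simp: uniform_rvs_def)
  finally show ?thesis
    by (simp add: emeasure_eq_measure)
qed

text \<open>Bathtub principle: A is compared with the event \<open>{U > a}\<close> of the same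
  probability. On that event \<open>\<rho> (U x)\<close> is at least \<open>\<rho> a\<close>, off it
  at most \<open>\<rho> a\<close>, so exchanging A for it cannot lower the integral.\<close>

lemma nn_integral_rho_indicator_le:
  assumes U: "U \<in> uniform_rvs M" and A [measurable]: "A \<in> sets M"
  shows "(\<integral>\<^sup>+x. ennreal (\<rho> (U x)) * indicator A x \<partial>M) \<le> S (prob A)"
proof (cases "prob A = 0")
  \<comment> \<open>Here \<open>a\<close> would be 1, and \<open>\<rho> 1 = 0\<close> is no upper
    bound for the other values of \<open>\<rho>\<close>.\<close>
  case True
  then have "AE x in M. x \<notin> A"
    by (intro AE_not_in null_setsI) (auto simp: emeasure_eq_measure)
  then have "(\<integral>\<^sup>+x. ennreal (\<rho> (U x)) * indicator A x \<partial>M) = (\<integral>\<^sup>+x. 0 \<partial>M)"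
    by (intro nn_integral_cong_AE) auto
  then show ?thesis by simp
next
  case False
  define a where "a = 1 - prob A"
  have a: "0 \<le> a" "a < 1"
    using False by (auto simp: a_def zero_less_measure_iff)
  note [measurable] = uniform_measurable[OF U]
  let ?r = "\<lambda>x. ennreal (\<rho> (U x))" and ?B = "\<lambda>x. indicator {a<..} (U x) :: ennreal"
  \<comment> \<open>To avoid subtraction in \<open>ennreal\<close>, \<open>\<rho> a\<close> times
    the common probability of the two events is added on both sides. It is finite and cancels at the
    end.\<close>
  have "(\<integral>\<^sup>+x. ?r x * indicator A x \<partial>M) + ennreal (\<rho> a) * ennreal (1 - a)
      = (\<integral>\<^sup>+x. ?r x * indicator A x + ennreal (\<rho> a) * indicator {x\<in>space M. a < U x} x \<partial>M)"
    using a by (simp add: nn_integral_add nn_integral_cmult_indicator uniform_measure_gt[OF U])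
  also have "\<dots> \<le> (\<integral>\<^sup>+x. ?r x * ?B x + ennreal (\<rho> a) * indicator A x \<partial>M)"
  proof (rule nn_integral_mono_AE)
    show "AE x in M. ?r x * indicator A x + ennreal (\<rho> a) * indicator {x\<in>space M. a < U x} x
        \<le> ?r x * ?B x + ennreal (\<rho> a) * indicator A x"
      using uniform_null[OF U, of 1] AE_space
    proof eventually_elim
      case (elim x)
      then have "0 \<le> U x" "U x < 1"
        using U by (auto simp: uniform_rvs_def less_le)
      then have "a < U x \<Longrightarrow> \<rho> a \<le> \<rho> (U x)" "\<not> a < U x \<Longrightarrow> \<rho> (U x) \<le> \<rho> a"
        using a by (auto simp: \<rho>_def intro!: sigma_mono)
      with elim show ?case
        by (auto simp: indicator_def ennreal_leI add.commute)
    qed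
  qed
  also have "\<dots> = S (1 - a) + ennreal (\<rho> a) * ennreal (1 - a)"
    using a by (simp add: nn_integral_add nn_integral_cmult_indicator
        uniform_nn_integral_rho[OF U] emeasure_eq_measure a_def)
  finally show ?thesis
    by (auto simp: a_def ennreal_mult_eq_top_iff)
qed

text \<open>A nondecreasing function of mean 1 has mean at least 1 on every upper tail. Either
  \<open>\<sigma> a \<ge> 1\<close> and so \<open>\<sigma> \<ge> 1\<close> on the whole tail, or
  \<open>\<sigma> \<le> 1\<close> on [0, a] and the tail must hold the remaining mass. This makes
  the denominators of the dual norm positive and lets the primal norm dominate the \<open>L1\<close>
  norm.\<close>

lemma le_S:
  assumes "0 \<le> p" "p \<le> 1"
  shows "ennreal p \<le> S p"
proof (cases "p = 0")
  case False
  define a where "a = 1 - p"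
  have a: "0 \<le> a" "a < 1"
    using assms False by (auto simp: a_def)
  show ?thesis
  proof (cases "1 \<le> \<sigma> a")
    case True
    have ge: "1 \<le> \<sigma> u" if "a < u" "u < 1" for u
      using sigma_mono[of a u] a True that by simp
    have "ennreal p = (\<integral>\<^sup>+u. indicator {a<..<1} u \<partial>lborel)"
      using a by (simp add: a_def)
    also have "\<dots> \<le> S p"
      unfolding S_def a_def[symmetric]
      by (intro nn_integral_mono) (auto split: split_indicator dest: ge)
    finally show ?thesis .
  next
    case False
    have "1 = (\<integral>\<^sup>+u. ennreal (\<rho> u) \<partial>lborel)"
      by (simp add: nn_integral_rho)
    also have "\<dots> \<le> (\<integral>\<^sup>+u. indicator {0..a} u + ennreal (\<rho> u) * indicator {a<..} u \<partial>lborel)"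
      using sigma_mono[of _ a] a False
      by (intro nn_integral_mono) (force simp: indicator_def \<rho>_def)
    also have "\<dots> = ennreal a + S p"
      using a assms by (simp add: nn_integral_add S_eq a_def)
    finally have "ennreal p + ennreal a \<le> S p + ennreal a"
      using a assms by (simp add: ennreal_plus[symmetric] a_def add.commute del: ennreal_plus)
    then show ?thesis
      by simp
  qed
qed auto

lemma S_pos: "0 < p \<Longrightarrow> p \<le> 1 \<Longrightarrow> 0 < S p"
  using le_S[of p] by (metis ennreal_less_zero_iff less_eq_real_def order_less_le_trans)

text \<open>Continuity of \<open>S\<close> at 0, by dominated convergence: each \<open>u < 1\<close>
  eventually leaves the shrinking tail. It later makes set functions dominated by \<open>S\<close>
  continuous at the empty set.\<close>

lemma S_tendsto_0:
  assumes p: "p \<longlonglongrightarrow> 0" "\<And>n. 0 \<le> p n" "\<And>n. p n \<le> 1"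
  shows "(\<lambda>n::nat. S (p n)) \<longlonglongrightarrow> 0"
proof -
  have "(\<lambda>n. \<integral>\<^sup>+u. ennreal (\<rho> u) * indicator {1-p n<..} u \<partial>lborel) \<longlonglongrightarrow> (\<integral>\<^sup>+u. 0 \<partial>(lborel :: real measure))"
  proof (rule nn_integral_dominated_convergence)
    show "AE u in lborel. ennreal (\<rho> u) * indicator {1-p n<..} u \<le> ennreal (\<rho> u)" for n
      by (auto simp: indicator_def)
    show "(\<integral>\<^sup>+u. ennreal (\<rho> u) \<partial>lborel) < \<infinity>"
      by (simp add: nn_integral_rho)
    show "AE u in lborel. (\<lambda>n. ennreal (\<rho> u) * indicator {1-p n<..} u) \<longlonglongrightarrow> 0"
    proof (rule AE_I2)
      fix u :: real
      show "(\<lambda>n. ennreal (\<rho> u) * indicator {1-p n<..} u) \<longlonglongrightarrow> 0"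
      proof (cases "u < 1")
        case True
        then have "eventually (\<lambda>n. p n < 1 - u) sequentially"
          using p(1) by (intro order_tendstoD(2)) auto
        then have "eventually (\<lambda>n. ennreal (\<rho> u) * indicator {1-p n<..} u = 0) sequentially"
          by eventually_elim (auto simp: indicator_def)
        then show ?thesis
          by (rule tendsto_eventually)
      qed (simp add: \<rho>_def)
    qed
  qed auto
  then show ?thesis
    using p by (simp add: S_eq)
qed

end

section \<open>Probability integral transform and comonotone uniform variables\<close>

text \<open>Without atoms the distribution function F of W is continuous, so F(W) jumps over no
  value. The second conclusion uses that the strict and the weak inequality between W and t differ
  by a null event.\<close>

lemma (in prob_space) cdf_transform_uniform:
  fixes W :: "'a \<Rightarrow> real"
  assumes [measurable]: "W \<in> borel_measurable M"
    and atomless: "\<And>t. AE x in M. W x \<noteq> t"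
  shows "(\<lambda>x. cdf (distr M borel W) (W x)) \<in> uniform_rvs M"
    and "prob {x\<in>space M. t \<le> W x} = 1 - cdf (distr M borel W) t"
proof -
  interpret D: real_distribution "distr M borel W"
    by (rule real_distribution_distr) simp
  interpret D: cdf_distribution "distr M borel W" ..
  let ?F = "cdf (distr M borel W)"
  have F: "?F t = prob {x\<in>space M. W x \<le> t}" for t
    by (simp add: cdf_def measure_distr vimage_def Int_def conj_commute)
  have F_less: "?F t = prob {x\<in>space M. W x < t}" for t
    unfolding F using atomless[of t] by (intro finite_measure_eq_AE) auto
  show "prob {x\<in>space M. t \<le> W x} = 1 - ?F t"
  proof -
    have "{x\<in>space M. t \<le> W x} = space M - {x\<in>space M. W x < t}"
      by auto
    then show ?thesis
      by (simp add: prob_compl F_less)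
  qed
  have "measure (distr M borel W) {t} = 0" for t
  proof -
    have "measure (distr M borel W) {t} = prob {x\<in>space M. W x = t}"
      by (simp add: measure_distr vimage_def Int_def conj_commute)
    also have "\<dots> = 0"
      using atomless[of t] by (intro measure_eq_0_null_sets) (auto simp: AE_iff_null)
    finally show ?thesis .
  qed
  then have cont: "isCont ?F t" for t
    by (simp add: D.isCont_cdf)
  \<comment> \<open>The strict version comes first because the Galois connection between
    \<open>?F\<close> and its generalized inverse \<open>D.I\<close> turns
    \<open>?F (W x) < u\<close> into \<open>W x < D.I u\<close>.\<close>
  have less: "prob {x\<in>space M. ?F (W x) < u} = u" if u: "0 < u" "u < 1" for u
  proof -
    have iff: "u \<le> ?F x \<longleftrightarrow> D.I u \<le> x" for x
      using D.pseudoinverse[of u x] u by simp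
    have "{x\<in>space M. ?F (W x) < u} = {x\<in>space M. W x < D.I u}"
      using iff by (metis (no_types, lifting) not_le)
    then have "prob {x\<in>space M. ?F (W x) < u} = ?F (D.I u)"
      by (simp add: F_less)
    \<comment> \<open>If F exceeded \<open>u\<close> at \<open>D.I u\<close>, by continuity it would
      do so slightly to the left, although \<open>D.I u\<close> is the least point where F reaches
      \<open>u\<close>.\<close>
    moreover have "?F (D.I u) \<le> u"
    proof (rule ccontr)
      assume "\<not> ?F (D.I u) \<le> u"
      then have "eventually (\<lambda>x. u < ?F x) (at_left (D.I u))"
        using cont[of "D.I u"]
        by (intro order_tendstoD(1)[where y="?F (D.I u)"])
          (auto simp: isCont_def filterlim_at_split)
      then have "eventually (\<lambda>x. D.I u \<le> x) (at_left (D.I u))"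
        by eventually_elim (simp add: iff[symmetric])
      moreover have "eventually (\<lambda>x. x < D.I u) (at_left (D.I u))"
        by (simp add: eventually_at_filter)
      ultimately have "eventually (\<lambda>x. False) (at_left (D.I u))"
        by eventually_elim simp
      then show False
        by (simp add: trivial_limit_at_left_real)
    qed
    ultimately show ?thesis
      using iff[of "D.I u"] by simp
  qed
  have [measurable]: "(\<lambda>x. ?F (W x)) \<in> borel_measurable M"
    by (rule measurable_compose[OF _ D.measurable_C]) simp
  have bnd: "0 \<le> ?F t" "?F t \<le> 1" for t
    by (simp_all add: D.cdf_nonneg D.cdf_bounded_prob)
  have "prob {x\<in>space M. ?F (W x) \<le> u} = u" if u: "0 \<le> u" "u \<le> 1" for u
  proof (rule antisym)
    show "prob {x\<in>space M. ?F (W x) \<le> u} \<le> u"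
    proof (cases "u = 1")
      case False
      with u have "u < 1" by simp
      \<comment> \<open>The weak inequality at \<open>u\<close> is squeezed by the strict ones at
        every \<open>v > u\<close>.\<close>
      then show ?thesis
      proof (rule dense_ge_bounded)
        fix v assume v: "u < v" "v < 1"
        have "prob {x\<in>space M. ?F (W x) \<le> u} \<le> prob {x\<in>space M. ?F (W x) < v}"
          using v by (intro finite_measure_mono) auto
        then show "prob {x\<in>space M. ?F (W x) \<le> u} \<le> v"
          using less[of v] u v by simp
      qed
    qed simp
    show "u \<le> prob {x\<in>space M. ?F (W x) \<le> u}"
    proof (cases "u = 1")
      case True
      then have "{x\<in>space M. ?F (W x) \<le> u} = space M"
        using bnd by auto
      then show ?thesis
        using u by (simp add: prob_space)
    next
      case False
      have "prob {x\<in>space M. ?F (W x) < u} \<le> prob {x\<in>space M. ?F (W x) \<le> u}"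
        by (intro finite_measure_mono) auto
      with less[of u] False u show ?thesis
        by (cases "u = 0") auto
    qed
  qed
  then show "(\<lambda>x. ?F (W x)) \<in> uniform_rvs M"
    using bnd by (auto simp: uniform_rvs_def)
qed

text \<open>Perturbing an integer-valued \<open>N\<close> by a uniform variable removes all atoms without
  changing the order of the values of \<open>N\<close>.\<close>

lemma (in distortion_prob_space) comonotone_uniform:
  fixes N :: "'a \<Rightarrow> nat"
  assumes [measurable]: "N \<in> measurable M (count_space UNIV)"
  obtains U where "U \<in> uniform_rvs M"
    "\<And>k. S (prob {x\<in>space M. k \<le> N x}) \<le>
      (\<integral>\<^sup>+x. ennreal (\<rho> (U x)) * indicator {x\<in>space M. k \<le> N x} x \<partial>M)"
proof -
  obtain V where V: "V \<in> uniform_rvs M"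
    using uniform_rvs_nonempty by auto
  note [measurable] = uniform_measurable[OF V]
  define W where "W = (\<lambda>x. real (N x) + V x)"
  have [measurable]: "W \<in> borel_measurable M"
    by (simp add: W_def)
  \<comment> \<open>\<open>W = t\<close> would force V to take one of the countably many values
    \<open>t - n\<close>.\<close>
  have atomless: "AE x in M. W x \<noteq> t" for t
  proof -
    have "AE x in M. \<forall>n. V x \<noteq> t - real n"
      by (subst AE_all_countable) (auto intro: uniform_null[OF V])
    then show ?thesis
      by eventually_elim (auto simp: W_def algebra_simps)
  qed
  interpret D: real_distribution "distr M borel W"
    by (rule real_distribution_distr) simp
  define U where "U = (\<lambda>x. cdf (distr M borel W) (W x))"
  have U: "U \<in> uniform_rvs M"
    unfolding U_def by (rule cdf_transform_uniform) (auto intro: atomless)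
  note [measurable] = uniform_measurable[OF U]
  have "S (prob {x\<in>space M. k \<le> N x}) \<le>
      (\<integral>\<^sup>+x. ennreal (\<rho> (U x)) * indicator {x\<in>space M. k \<le> N x} x \<partial>M)" for k
  proof -
    define a where "a = cdf (distr M borel W) (real k)"
    \<comment> \<open>Almost surely \<open>0 \<le> V < 1\<close>, so N is the integer part of W and
      the level sets at integers agree.\<close>
    have iff: "AE x in M. k \<le> N x \<longleftrightarrow> real k \<le> W x"
      using uniform_null[OF V, of 1] AE_space
    proof eventually_elim
      case (elim x)
      then have "0 \<le> V x" "V x < 1"
        using V by (auto simp: uniform_rvs_def less_le)
      then show ?case
        by (auto simp: W_def)
    qed
    then have "prob {x\<in>space M. k \<le> N x} = prob {x\<in>space M. real k \<le> W x}"
      by (intro finite_measure_eq_AE) auto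
    also have "\<dots> = 1 - a"
      unfolding a_def by (rule cdf_transform_uniform) (auto intro: atomless)
    finally have "S (prob {x\<in>space M. k \<le> N x}) =
        (\<integral>\<^sup>+x. ennreal (\<rho> (U x)) * indicator {a<..} (U x) \<partial>M)"
      by (simp add: uniform_nn_integral_rho[OF U] a_def D.cdf_nonneg)
    also have "\<dots> \<le> (\<integral>\<^sup>+x. ennreal (\<rho> (U x)) * indicator {x\<in>space M. k \<le> N x} x \<partial>M)"
    proof (rule nn_integral_mono_AE)
      show "AE x in M. ennreal (\<rho> (U x)) * indicator {a<..} (U x) \<le>
          ennreal (\<rho> (U x)) * indicator {x\<in>space M. k \<le> N x} x"
        using iff AE_space
      proof eventually_elim
        case (elim x)
        have "real k \<le> W x" if "a < U x"
          using that D.cdf_nondecreasing[of "W x" "real k"] by (force simp: U_def a_def)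
        with elim show ?case
          by (auto simp: indicator_def)
      qed
    qed
    finally show ?thesis .
  qed
  with U show ?thesis
    by (rule that)
qed

section \<open>Layer cake for integer-valued variables\<close>

lemma ennreal_of_nat_eq_suminf:
  "(of_nat n :: ennreal) = (\<Sum>k. of_bool (k < n))"
proof -
  have "(\<Sum>k. of_bool (k < n) :: ennreal) = (\<Sum>k<n. of_bool (k < n))"
    by (rule suminf_finite) auto
  then show ?thesis
    by simp
qed

lemma nn_integral_layer_cake_nat:
  fixes N :: "'a \<Rightarrow> nat" and w :: "'a \<Rightarrow> ennreal"
  assumes [measurable]: "N \<in> measurable M (count_space UNIV)" "w \<in> borel_measurable M"
  shows "(\<integral>\<^sup>+x. w x * of_nat (N x) \<partial>M) = (\<Sum>k. \<integral>\<^sup>+x. w x * indicator {x\<in>space M. k < N x} x \<partial>M)"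
proof -
  have "(\<integral>\<^sup>+x. w x * of_nat (N x) \<partial>M) = (\<integral>\<^sup>+x. (\<Sum>k. w x * indicator {x\<in>space M. k < N x} x) \<partial>M)"
    by (intro nn_integral_cong)
      (simp add: ennreal_of_nat_eq_suminf ennreal_suminf_cmult indicator_def of_bool_def)
  also have "\<dots> = (\<Sum>k. \<integral>\<^sup>+x. w x * indicator {x\<in>space M. k < N x} x \<partial>M)"
    by (rule nn_integral_suminf) simp
  finally show ?thesis .
qed

text \<open>Since N is the sum of the indicators of its level sets, a comparison of the weights v
  and w on every level set carries over to the integrals against N.\<close>

lemma nn_integral_layer_mono:
  fixes N :: "'a \<Rightarrow> nat" and v w :: "'a \<Rightarrow> ennreal"
  assumes "N \<in> measurable M (count_space UNIV)" "v \<in> borel_measurable M" "w \<in> borel_measurable M"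
    and "\<And>k. (\<integral>\<^sup>+x. v x * indicator {x\<in>space M. k < N x} x \<partial>M) \<le>
      c * (\<integral>\<^sup>+x. w x * indicator {x\<in>space M. k < N x} x \<partial>M)"
  shows "(\<integral>\<^sup>+x. v x * of_nat (N x) \<partial>M) \<le> c * (\<integral>\<^sup>+x. w x * of_nat (N x) \<partial>M)"
  unfolding nn_integral_layer_cake_nat[OF assms(1,2)] nn_integral_layer_cake_nat[OF assms(1,3)]
    ennreal_suminf_cmult[symmetric]
  by (intro suminf_le assms(4) summableI)

text \<open>Dividing by \<open>m\<close> makes the additive error negligible. Here \<open>c\<close>
  will be the price of rounding \<open>m * norm (Y x)\<close> down to an integer.\<close>

lemma ennreal_le_of_nat_mult_le:
  fixes a b c :: ennreal
  assumes le: "\<And>m::nat. 0 < m \<Longrightarrow> of_nat m * a \<le> of_nat m * b + c" and c: "c < \<infinity>"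
  shows "a \<le> b"
proof (cases "b = \<infinity>")
  case False
  have "a \<noteq> \<infinity>"
    using le[of 1] c False by (auto simp: top_unique)
  with False c obtain x y z where r: "a = ennreal x" "b = ennreal y" "c = ennreal z" "0 \<le> x" "0 \<le> y" "0 \<le> z"
    by (metis ennreal_cases infinity_ennreal_def less_irrefl)
  have "real m * x \<le> real m * y + z" if "0 < m" for m
    using le[OF that] r
    by (simp add: ennreal_of_nat_eq_real_of_nat ennreal_mult[symmetric] ennreal_plus[symmetric] del: ennreal_plus)
  then have m: "real m * (x - y) \<le> z" if "0 < m" for m
    using that by (simp add: algebra_simps)
  have "x \<le> y"
  proof (rule ccontr)
    assume "\<not> x \<le> y"
    then obtain m where "z < real m * (x - y)"
      using reals_Archimedean3[of "x - y"] by auto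
    with m[of m] r show False
      by (cases "m = 0") auto
  qed
  with r show ?thesis
    by (simp add: ennreal_leI)
qed simp

section \<open>Bounds on events and the pairing inequality\<close>

context distortion_prob_space
begin

text \<open>The constant is an extended number, so that the possibly infinite dual norm of Z is
  itself always admissible (\<open>bounded_by_S_sigma_inf_val\<close>).\<close>

definition bounded_by_S :: "('a \<Rightarrow> 'b::real_normed_vector) \<Rightarrow> ennreal \<Rightarrow> bool" where
  "bounded_by_S Z c \<longleftrightarrow>
     (\<forall>A\<in>sets M. (\<integral>\<^sup>+x. ennreal (norm (Z x)) * indicator A x \<partial>M) \<le> c * S (prob A))"

lemma sigma1_val_eq:
  assumes "Y \<in> borel_measurable M"
  shows "sigma1_val M \<sigma> Y = (SUP U\<in>uniform_rvs M. \<integral>\<^sup>+x. ennreal (\<rho> (U x)) * ennreal (norm (Y x)) \<partial>M)"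
  unfolding sigma1_val_def
proof (intro SUP_cong refl nn_integral_cong_AE)
  fix U assume "U \<in> uniform_rvs M"
  from uniform_AE_sigma[OF this]
  show "AE x in M. ennreal (\<sigma> (U x) * norm (Y x)) = ennreal (\<rho> (U x)) * ennreal (norm (Y x))"
    by eventually_elim (simp add: ennreal_mult rho_nonneg)
qed

lemma nn_integral_le_sigma1_val:
  assumes "Y \<in> borel_measurable M" "U \<in> uniform_rvs M"
  shows "(\<integral>\<^sup>+x. ennreal (\<rho> (U x)) * ennreal (norm (Y x)) \<partial>M) \<le> sigma1_val M \<sigma> Y"
  unfolding sigma1_val_eq[OF assms(1)] using assms(2) by (rule SUP_upper)

lemma nn_integral_norm_le:
  assumes "bounded_by_S Z c"
  shows "(\<integral>\<^sup>+x. ennreal (norm (Z x)) \<partial>M) \<le> c"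
proof -
  have "(\<integral>\<^sup>+x. ennreal (norm (Z x)) \<partial>M) = (\<integral>\<^sup>+x. ennreal (norm (Z x)) * indicator (space M) x \<partial>M)"
    by (intro nn_integral_cong) auto
  also have "\<dots> \<le> c * S (prob (space M))"
    using assms unfolding bounded_by_S_def by (rule bspec) simp
  finally show ?thesis
    by (simp add: prob_space S_one)
qed

text \<open>With N the integer part of m |Y| and U comonotone with N, layer cake gives E(|Z| N)
  \<le> c E(\<sigma>(U) N), which is at most c m times the norm of Y. Rounding costs E|Z| \<le> c.
  The variable U depends on m, but the norm of Y is a supremum over all uniform variables.\<close>

lemma bounded_by_S_pairing:
  fixes Z :: "'a \<Rightarrow> 'b::{real_normed_vector, second_countable_topology}"
    and Y :: "'a \<Rightarrow> 'c::{real_normed_vector, second_countable_topology}"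
  assumes [measurable]: "Z \<in> borel_measurable M" "Y \<in> borel_measurable M"
    and Z: "bounded_by_S Z c" and c: "c < \<infinity>"
  shows "(\<integral>\<^sup>+x. ennreal (norm (Z x)) * ennreal (norm (Y x)) \<partial>M) \<le> c * sigma1_val M \<sigma> Y"
proof (rule ennreal_le_of_nat_mult_le[OF _ c])
  fix m :: nat assume m: "0 < m"
  define N where "N = (\<lambda>x. nat \<lfloor>real m * norm (Y x)\<rfloor>)"
  have [measurable]: "N \<in> measurable M (count_space UNIV)"
    by (simp add: N_def)
  have N_le: "real (N x) \<le> real m * norm (Y x)" for x
    by (simp add: N_def of_nat_nat)
  have le_N: "real m * norm (Y x) \<le> real (N x) + 1" for x
    unfolding N_def by (simp add: of_nat_nat)
  obtain U where U: "U \<in> uniform_rvs M" and UN: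
    "\<And>k. S (prob {x\<in>space M. k \<le> N x}) \<le>
      (\<integral>\<^sup>+x. ennreal (\<rho> (U x)) * indicator {x\<in>space M. k \<le> N x} x \<partial>M)"
    using comonotone_uniform[of N] by auto
  note [measurable] = uniform_measurable[OF U]
  have ZN: "(\<integral>\<^sup>+x. ennreal (norm (Z x)) * of_nat (N x) \<partial>M)
      \<le> c * (\<integral>\<^sup>+x. ennreal (\<rho> (U x)) * of_nat (N x) \<partial>M)"
  proof (rule nn_integral_layer_mono)
    fix k
    have "(\<integral>\<^sup>+x. ennreal (norm (Z x)) * indicator {x\<in>space M. k < N x} x \<partial>M)
        \<le> c * S (prob {x\<in>space M. k < N x})"
      using Z by (simp add: bounded_by_S_def)
    also have "\<dots> \<le> c * (\<integral>\<^sup>+x. ennreal (\<rho> (U x)) * indicator {x\<in>space M. k < N x} x \<partial>M)"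
      using UN[of "Suc k"] by (intro mult_left_mono) (auto simp: Suc_le_eq)
    finally show "(\<integral>\<^sup>+x. ennreal (norm (Z x)) * indicator {x\<in>space M. k < N x} x \<partial>M)
        \<le> c * (\<integral>\<^sup>+x. ennreal (\<rho> (U x)) * indicator {x\<in>space M. k < N x} x \<partial>M)" .
  qed auto
  have "(\<integral>\<^sup>+x. ennreal (\<rho> (U x)) * of_nat (N x) \<partial>M)
      \<le> (\<integral>\<^sup>+x. of_nat m * (ennreal (\<rho> (U x)) * ennreal (norm (Y x))) \<partial>M)"
  proof (rule nn_integral_mono)
    fix x
    have "ennreal (\<rho> (U x) * real (N x)) \<le> ennreal (\<rho> (U x) * (real m * norm (Y x)))"
      by (intro ennreal_leI mult_left_mono N_le rho_nonneg)
    then show "ennreal (\<rho> (U x)) * of_nat (N x) \<le> of_nat m * (ennreal (\<rho> (U x)) * ennreal (norm (Y x)))"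
      by (simp add: ennreal_mult ennreal_of_nat_eq_real_of_nat rho_nonneg ac_simps)
  qed
  also have "\<dots> = of_nat m * (\<integral>\<^sup>+x. ennreal (\<rho> (U x)) * ennreal (norm (Y x)) \<partial>M)"
    by (rule nn_integral_cmult) auto
  also have "\<dots> \<le> of_nat m * sigma1_val M \<sigma> Y"
    by (intro mult_left_mono nn_integral_le_sigma1_val U) auto
  finally have UN_le: "(\<integral>\<^sup>+x. ennreal (\<rho> (U x)) * of_nat (N x) \<partial>M) \<le> of_nat m * sigma1_val M \<sigma> Y" .
  have "of_nat m * (\<integral>\<^sup>+x. ennreal (norm (Z x)) * ennreal (norm (Y x)) \<partial>M)
      = (\<integral>\<^sup>+x. ennreal (norm (Z x)) * ennreal (real m * norm (Y x)) \<partial>M)"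
    by (subst nn_integral_cmult[symmetric])
      (auto intro!: nn_integral_cong simp: ennreal_mult ennreal_of_nat_eq_real_of_nat ac_simps)
  also have "\<dots> \<le> (\<integral>\<^sup>+x. ennreal (norm (Z x)) * of_nat (N x) + ennreal (norm (Z x)) \<partial>M)"
  proof (rule nn_integral_mono)
    fix x
    have "norm (Z x) * (real m * norm (Y x)) \<le> norm (Z x) * (real (N x) + 1)"
      by (intro mult_left_mono le_N) simp
    then have "ennreal (norm (Z x) * (real m * norm (Y x))) \<le> ennreal (norm (Z x) * real (N x) + norm (Z x))"
      by (intro ennreal_leI) (simp add: algebra_simps)
    then show "ennreal (norm (Z x)) * ennreal (real m * norm (Y x))
        \<le> ennreal (norm (Z x)) * of_nat (N x) + ennreal (norm (Z x))"
      by (simp add: ennreal_mult ennreal_of_nat_eq_real_of_nat)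
  qed
  also have "\<dots> = (\<integral>\<^sup>+x. ennreal (norm (Z x)) * of_nat (N x) \<partial>M) + (\<integral>\<^sup>+x. ennreal (norm (Z x)) \<partial>M)"
    by (rule nn_integral_add) auto
  also have "\<dots> \<le> c * (\<integral>\<^sup>+x. ennreal (\<rho> (U x)) * of_nat (N x) \<partial>M) + c"
    by (intro add_mono ZN nn_integral_norm_le Z)
  also have "\<dots> \<le> c * (of_nat m * sigma1_val M \<sigma> Y) + c"
    by (intro add_right_mono mult_left_mono UN_le) simp
  finally show "of_nat m * (\<integral>\<^sup>+x. ennreal (norm (Z x)) * ennreal (norm (Y x)) \<partial>M)
      \<le> of_nat m * (c * sigma1_val M \<sigma> Y) + c"
    by (simp add: ac_simps)
qed

end

section \<open>Tail integrals of quantiles as maxima over events\<close>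

text \<open>The representation of the tail integral of the quantile function as a minimum over \<open>t\<close>
  (conditional value at risk), with the minimiser \<open>t\<close>.\<close>

lemma (in prob_space) quantile_tail_integral:
  fixes W :: "'a \<Rightarrow> real"
  assumes [measurable]: "W \<in> borel_measurable M" and W: "\<And>x. 0 \<le> W x"
    and \<alpha>: "0 \<le> \<alpha>" "\<alpha> < 1"
  obtains t where "0 \<le> t" "prob {x\<in>space M. t < W x} \<le> 1 - \<alpha>" "1 - \<alpha> \<le> prob {x\<in>space M. t \<le> W x}"
    "(\<integral>\<^sup>+u\<in>{\<alpha><..<1}. ennreal (quantile M W u) \<partial>lborel)
      = (\<integral>\<^sup>+x. ennreal (W x - t) \<partial>M) + ennreal t * ennreal (1 - \<alpha>)"
proof -
  interpret D: real_distribution "distr M borel W"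
    by (rule real_distribution_distr) simp
  interpret D: cdf_distribution "distr M borel W" ..
  let ?F = "cdf (distr M borel W)"
  have q: "quantile M W = D.I"
    by (simp add: fun_eq_iff quantile_def)
  have F: "?F t = prob {x\<in>space M. W x \<le> t}" for t
    by (simp add: cdf_def measure_distr vimage_def Int_def conj_commute)
  have I: "u \<le> ?F x \<longleftrightarrow> D.I u \<le> x" if "0 < u" "u < 1" for u x
    using D.pseudoinverse[of u x] that by simp
  have I_mono: "D.I u \<le> D.I v" if "0 < u" "u \<le> v" "v < 1" for u v
    using I[of u "D.I v"] I[of v "D.I v"] that by simp
  have I_nonneg: "0 \<le> D.I u" if "0 < u" "u < 1" for u
  proof (rule ccontr)
    assume "\<not> 0 \<le> D.I u"
    then have "{x\<in>space M. W x \<le> D.I u} = {}"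
      using W by (metis (no_types, lifting) Collect_empty_eq order_trans)
    then have "?F (D.I u) = 0"
      unfolding F by (simp only: measure_empty)
    then show False
      using I[of u "D.I u"] that by simp
  qed
  \<comment> \<open>The threshold is the \<open>\<alpha>\<close>-quantile. At
    \<open>\<alpha> = 0\<close> the infimum runs over the whole line and has no useful value; 0 is
    then a lower bound of W.\<close>
  define t where "t = (if \<alpha> = 0 then 0 else D.I \<alpha>)"
  have t: "0 \<le> t"
    using I_nonneg[of \<alpha>] \<alpha> by (simp add: t_def)
  have above: "t \<le> D.I u" if "\<alpha> < u" "u < 1" for u
    using that \<alpha> I_nonneg[of u] I_mono[of \<alpha> u] by (auto simp: t_def)
  have below: "D.I u \<le> t" if "0 < u" "u \<le> \<alpha>" for u
    using that \<alpha> I_mono[of u \<alpha>] by (auto simp: t_def)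
  have [measurable]: "(\<lambda>u. ennreal (D.I u - t) * indicator {0<..<1} u) \<in> borel_measurable borel"
  proof -
    have "(\<lambda>u. ennreal (D.I u - t)) \<in> borel_measurable (restrict_space borel {0<..<1})"
      by measurable
    then show ?thesis
      by (subst (asm) borel_measurable_restrict_space_iff_ennreal) auto
  qed
  \<comment> \<open>As \<open>ennreal\<close> cuts off at 0, \<open>ennreal (W x - t)\<close> is the
    positive part of \<open>W x - t\<close>. The quantile function on (0, 1) with Lebesgue measure
    has the law of W, so W may be replaced by \<open>D.I\<close>.\<close>
  have "(\<integral>\<^sup>+x. ennreal (W x - t) \<partial>M) = (\<integral>\<^sup>+y. ennreal (y - t) \<partial>distr M borel W)"
    by (simp add: nn_integral_distr)
  also have "\<dots> = (\<integral>\<^sup>+y. ennreal (y - t) \<partial>distr (restrict_space lborel {0<..<1::real}) borel D.I)"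
    by (simp only: D.distr_I_eq_M)
  also have "\<dots> = (\<integral>\<^sup>+u. ennreal (D.I u - t) \<partial>restrict_space lborel {0<..<1})"
    by (subst nn_integral_distr) auto
  also have "\<dots> = (\<integral>\<^sup>+u. ennreal (D.I u - t) * indicator {0<..<1} u \<partial>lborel)"
    by (subst nn_integral_restrict_space) auto
  finally have E: "(\<integral>\<^sup>+x. ennreal (W x - t) \<partial>M)
      = (\<integral>\<^sup>+u. ennreal (D.I u - t) * indicator {0<..<1} u \<partial>lborel)" .
  have "(\<integral>\<^sup>+u\<in>{\<alpha><..<1}. ennreal (quantile M W u) \<partial>lborel)
      = (\<integral>\<^sup>+u. ennreal (D.I u - t) * indicator {0<..<1} u + ennreal t * indicator {\<alpha><..<1} u \<partial>lborel)"
  proof (rule nn_integral_cong)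
    fix u :: real
    consider "u \<le> 0" | "1 \<le> u" | "0 < u" "u \<le> \<alpha>" | "\<alpha> < u" "u < 1"
      by linarith
    then show "ennreal (quantile M W u) * indicator {\<alpha><..<1} u
        = ennreal (D.I u - t) * indicator {0<..<1} u + ennreal t * indicator {\<alpha><..<1} u"
    proof cases
      case 3
      then show ?thesis
        using below[of u] \<alpha> by (simp add: ennreal_neg)
    next
      case 4
      then show ?thesis
        using above[of u] \<alpha> t by (simp add: q ennreal_plus[symmetric] del: ennreal_plus)
    qed (use \<alpha> in auto)
  qed
  also have "\<dots> = (\<integral>\<^sup>+x. ennreal (W x - t) \<partial>M) + ennreal t * ennreal (1 - \<alpha>)"
    unfolding E using \<alpha> by (subst nn_integral_add) (auto simp: nn_integral_cmult_indicator)
  finally have eq: "(\<integral>\<^sup>+u\<in>{\<alpha><..<1}. ennreal (quantile M W u) \<partial>lborel)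
      = (\<integral>\<^sup>+x. ennreal (W x - t) \<partial>M) + ennreal t * ennreal (1 - \<alpha>)" .
  have "{x\<in>space M. t < W x} = space M - {x\<in>space M. W x \<le> t}"
    by auto
  then have "prob {x\<in>space M. t < W x} = 1 - ?F t"
    by (simp add: prob_compl F)
  moreover have "\<alpha> \<le> ?F t"
    using I[of \<alpha> t] \<alpha> D.cdf_nonneg[of 0] by (cases "\<alpha> = 0") (auto simp: t_def)
  ultimately have 1: "prob {x\<in>space M. t < W x} \<le> 1 - \<alpha>"
    by simp
  \<comment> \<open>This is the left limit of the distribution function at t, and to the left of the
    \<open>\<alpha>\<close>-quantile its values lie below \<open>\<alpha>\<close>.\<close>
  have "prob {x\<in>space M. W x < t} \<le> \<alpha>"
  proof (cases "\<alpha> = 0")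
    case True
    then have "{x\<in>space M. W x < t} = {}"
      using W by (auto simp: t_def not_less)
    with True show ?thesis
      by (simp only: measure_empty order_refl)
  next
    case False
    have "eventually (\<lambda>x. ?F x \<le> \<alpha>) (at_left t)"
    proof (rule eventually_at_leftI[of "t - 1"])
      fix x assume "x \<in> {t - 1<..<t}"
      then show "?F x \<le> \<alpha>"
        using I[of \<alpha> x] False \<alpha> by (auto simp: t_def not_le[symmetric])
    qed simp
    then have "measure (distr M borel W) {..<t} \<le> \<alpha>"
      using D.cdf_at_left[of t] by (intro tendsto_upperbound) auto
    then show ?thesis
      by (simp add: measure_distr vimage_def Int_def conj_commute)
  qed
  moreover have "{x\<in>space M. t \<le> W x} = space M - {x\<in>space M. W x < t}"
    by auto
  ultimately have 2: "1 - \<alpha> \<le> prob {x\<in>space M. t \<le> W x}"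
    by (simp add: prob_compl)
  show ?thesis
    by (rule that[OF t 1 2 eq])
qed

text \<open>A is enlarged by the part of B on which a uniform V is at most v. The probability is
  1-Lipschitz in v and runs from that of A to that of B, so the intermediate value theorem applies.
  This splits a possible atom of |Z| at the threshold t in the right proportion.\<close>

lemma (in distortion_prob_space) intermediate_event:
  assumes [measurable]: "A \<in> sets M" "B \<in> sets M" and AB: "A \<subseteq> B"
    and p: "prob A \<le> p" "p \<le> prob B"
  obtains C where "C \<in> sets M" "A \<subseteq> C" "C \<subseteq> B" "prob C = p"
proof -
  obtain V where V: "V \<in> uniform_rvs M"
    using uniform_rvs_nonempty by auto
  note [measurable] = uniform_measurable[OF V]
  define C where "C v = A \<union> {x\<in>B. V x \<le> v}" for v
  have sp: "B \<subseteq> space M"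
    by (rule sets.sets_into_space) simp
  have [measurable]: "C v \<in> sets M" for v
  proof -
    have "C v = A \<union> (B \<inter> {x\<in>space M. V x \<le> v})"
      using sp by (auto simp: C_def)
    then show ?thesis
      by simp
  qed
  have lip: "prob (C v) \<le> prob (C u) + (v - u)" if "0 \<le> u" "u \<le> v" "v \<le> 1" for u v
  proof -
    let ?G = "\<lambda>v. {x\<in>space M. V x \<le> v}"
    have G: "prob (?G v) = v" if "0 \<le> v" "v \<le> 1" for v
      using V that by (simp add: uniform_rvs_def)
    have "prob (C v) \<le> prob (C u \<union> (?G v - ?G u))"
      using sp by (intro finite_measure_mono) (auto simp: C_def)
    also have "\<dots> \<le> prob (C u) + prob (?G v - ?G u)"
      by (rule measure_Un_le) auto
    also have "prob (?G v - ?G u) = v - u"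
      using that G[of u] G[of v] by (subst finite_measure_Diff) auto
    finally show ?thesis by simp
  qed
  have mono: "prob (C u) \<le> prob (C v)" if "u \<le> v" for u v
    using that by (intro finite_measure_mono) (auto simp: C_def)
  have "continuous_on {0..1} (\<lambda>v. prob (C v))"
  proof (rule continuous_on_iff[THEN iffD2], intro ballI allI impI)
    fix u e :: real assume u: "u \<in> {0..1}" "0 < e"
    have "dist (prob (C v)) (prob (C u)) < e" if "v \<in> {0..1}" "dist v u < e" for v
      using that u lip[of u v] lip[of v u] mono[of u v] mono[of v u]
      by (cases "u \<le> v") (auto simp: dist_real_def)
    with u show "\<exists>d>0. \<forall>v\<in>{0..1}. dist v u < d \<longrightarrow> dist (prob (C v)) (prob (C u)) < e"
      by blast
  qed
  moreover have "prob (C 0) = prob A"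
  proof (rule finite_measure_eq_AE)
    show "AE x in M. x \<in> C 0 \<longleftrightarrow> x \<in> A"
      using uniform_null[OF V, of 0] AE_space
      by eventually_elim (use V sp in \<open>auto simp: uniform_rvs_def C_def intro: antisym\<close>)
  qed auto
  moreover have "C 1 = B"
    using AB sp V by (auto simp: uniform_rvs_def C_def)
  ultimately obtain v where "0 \<le> v" "v \<le> 1" "prob (C v) = p"
    using IVT'[of "\<lambda>v. prob (C v)" 0 p 1] p by auto
  then show ?thesis
    using AB by (intro that[of "C v"]) (auto simp: C_def)
qed

lemma ennreal_divide_le_iff:
  fixes x y c :: ennreal
  assumes "y \<noteq> 0" "y \<noteq> \<infinity>"
  shows "x / y \<le> c \<longleftrightarrow> x \<le> c * y"
proof
  assume "x / y \<le> c"
  then have "y * (x / y) \<le> y * c"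
    by (rule mult_left_mono) simp
  moreover have "y * (x / y) = x"
    using assms by (simp add: ennreal_times_divide mult.commute[of y] ennreal_mult_divide_eq)
  ultimately show "x \<le> c * y"
    by (simp add: mult.commute)
next
  assume "x \<le> c * y"
  then show "x / y \<le> c"
    using assms by (intro divide_le_posI_ennreal) (auto simp: mult.commute zero_less_iff_neq_zero)
qed

context distortion_prob_space
begin

text \<open>Both halves rest on the inequality |Z| \<le> (|Z| - t)^+ + t, which is an equality
  exactly where |Z| \<ge> t, with t the threshold from
  \<open>quantile_tail_integral\<close>.\<close>

lemma sigma_inf_val_le_iff:
  fixes Z :: "'a \<Rightarrow> 'b::{real_normed_vector, second_countable_topology}"
  assumes [measurable]: "Z \<in> borel_measurable M"
  shows "sigma_inf_val M \<sigma> Z \<le> c \<longleftrightarrow> bounded_by_S Z c"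
proof -
  let ?W = "\<lambda>x. norm (Z x)"
  define Q where "Q \<alpha> = (\<integral>\<^sup>+u\<in>{\<alpha><..<1}. ennreal (quantile M ?W u) \<partial>lborel)" for \<alpha> :: real
  have split: "(\<integral>\<^sup>+x. ennreal (?W x - t) * indicator A x \<partial>M) + ennreal t * emeasure M A
      = (\<integral>\<^sup>+x. (ennreal (?W x - t) + ennreal t) * indicator A x \<partial>M)"
    if [measurable]: "A \<in> sets M" for A t
    by (simp add: distrib_right nn_integral_add nn_integral_cmult_indicator)
  have Q_upper: "(\<integral>\<^sup>+x. ennreal (?W x) * indicator A x \<partial>M) \<le> Q \<alpha>"
    if \<alpha>: "0 \<le> \<alpha>" "\<alpha> < 1" and A [measurable]: "A \<in> sets M" and pA: "prob A = 1 - \<alpha>" for \<alpha> A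
  proof -
    obtain t where t: "0 \<le> t"
      "Q \<alpha> = (\<integral>\<^sup>+x. ennreal (?W x - t) \<partial>M) + ennreal t * ennreal (1 - \<alpha>)"
      using quantile_tail_integral[of ?W \<alpha>] \<alpha> unfolding Q_def by auto
    have "(\<integral>\<^sup>+x. ennreal (?W x) * indicator A x \<partial>M)
        \<le> (\<integral>\<^sup>+x. (ennreal (?W x - t) + ennreal t) * indicator A x \<partial>M)"
    proof (intro nn_integral_mono mult_right_mono)
      fix x
      have "ennreal (?W x) \<le> ennreal (max 0 (?W x - t) + t)"
        by (intro ennreal_leI) auto
      also have "\<dots> = ennreal (?W x - t) + ennreal t"
        using t by (simp add: max_def ennreal_neg)
      finally show "ennreal (?W x) \<le> ennreal (?W x - t) + ennreal t" .
    qed simp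
    also have "\<dots> \<le> Q \<alpha>"
      unfolding split[OF A, symmetric] t(2)
      by (intro add_mono nn_integral_mono) (auto simp: emeasure_eq_measure pA split: split_indicator)
    finally show ?thesis .
  qed
  \<comment> \<open>A maximiser contains the event \<open>t < ?W x\<close> and is contained in
    \<open>t \<le> ?W x\<close>: on it the inequality above is an equality, and off it the positive
    part vanishes.\<close>
  have Q_attained: "\<exists>A\<in>sets M. prob A = 1 - \<alpha> \<and> (\<integral>\<^sup>+x. ennreal (?W x) * indicator A x \<partial>M) = Q \<alpha>"
    if \<alpha>: "0 \<le> \<alpha>" "\<alpha> < 1" for \<alpha>
  proof -
    obtain t where t: "0 \<le> t" "prob {x\<in>space M. t < ?W x} \<le> 1 - \<alpha>" "1 - \<alpha> \<le> prob {x\<in>space M. t \<le> ?W x}"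
      "Q \<alpha> = (\<integral>\<^sup>+x. ennreal (?W x - t) \<partial>M) + ennreal t * ennreal (1 - \<alpha>)"
      using quantile_tail_integral[of ?W \<alpha>] \<alpha> unfolding Q_def by auto
    obtain A where A [measurable]: "A \<in> sets M" and sub: "{x\<in>space M. t < ?W x} \<subseteq> A" "A \<subseteq> {x\<in>space M. t \<le> ?W x}"
      and pA: "prob A = 1 - \<alpha>"
      using t(2,3) by (rule intermediate_event[rotated 3]) auto
    have "(\<integral>\<^sup>+x. ennreal (?W x) * indicator A x \<partial>M)
        = (\<integral>\<^sup>+x. (ennreal (?W x - t) + ennreal t) * indicator A x \<partial>M)"
      using sub t(1)
      by (intro nn_integral_cong) (auto split: split_indicator simp: ennreal_plus[symmetric] simp del: ennreal_plus)
    also have "\<dots> = (\<integral>\<^sup>+x. ennreal (?W x - t) * indicator A x \<partial>M) + ennreal t * ennreal (1 - \<alpha>)"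
      by (simp add: split[symmetric] emeasure_eq_measure pA)
    also have "(\<integral>\<^sup>+x. ennreal (?W x - t) * indicator A x \<partial>M) = (\<integral>\<^sup>+x. ennreal (?W x - t) \<partial>M)"
    proof (rule nn_integral_cong)
      fix x assume "x \<in> space M"
      then show "ennreal (?W x - t) * indicator A x = ennreal (?W x - t)"
        using sub by (cases "t < ?W x") (auto simp: ennreal_neg)
    qed
    finally show ?thesis
      using pA t(4) A by auto
  qed
  have "sigma_inf_val M \<sigma> Z = (SUP \<alpha>\<in>{0..<1}. Q \<alpha> / S (1 - \<alpha>))"
    by (simp add: sigma_inf_val_def Q_def S_def)
  then have "sigma_inf_val M \<sigma> Z \<le> c \<longleftrightarrow> (\<forall>\<alpha>\<in>{0..<1}. Q \<alpha> / S (1 - \<alpha>) \<le> c)"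
    by (simp add: SUP_le_iff)
  also have "\<dots> \<longleftrightarrow> (\<forall>\<alpha>\<in>{0..<1}. Q \<alpha> \<le> c * S (1 - \<alpha>))"
  proof (intro ball_cong refl)
    fix \<alpha> :: real assume "\<alpha> \<in> {0..<1}"
    then have "0 < S (1 - \<alpha>)" "S (1 - \<alpha>) < \<infinity>"
      using S_finite[of "1 - \<alpha>"] by (auto intro!: S_pos)
    then show "Q \<alpha> / S (1 - \<alpha>) \<le> c \<longleftrightarrow> Q \<alpha> \<le> c * S (1 - \<alpha>)"
      by (intro ennreal_divide_le_iff) auto
  qed
  also have "\<dots> \<longleftrightarrow> bounded_by_S Z c"
    unfolding bounded_by_S_def
  proof safe
    fix A assume Q: "\<forall>\<alpha>\<in>{0..<1}. Q \<alpha> \<le> c * S (1 - \<alpha>)" and A [measurable]: "A \<in> sets M"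
    show "(\<integral>\<^sup>+x. ennreal (norm (Z x)) * indicator A x \<partial>M) \<le> c * S (prob A)"
    \<comment> \<open>Null events correspond to \<open>\<alpha> = 1\<close>, which the supremum
      excludes; for them both sides vanish.\<close>
    proof (cases "prob A = 0")
      case True
      then have "AE x in M. x \<notin> A"
        by (intro AE_not_in null_setsI) (auto simp: emeasure_eq_measure)
      then have "(\<integral>\<^sup>+x. ennreal (norm (Z x)) * indicator A x \<partial>M) = (\<integral>\<^sup>+x. 0 \<partial>M)"
        by (intro nn_integral_cong_AE) auto
      then show ?thesis by simp
    next
      case False
      then have "1 - prob A \<in> {0..<1}"
        by (auto simp: zero_less_measure_iff)
      then have "Q (1 - prob A) \<le> c * S (prob A)" and *: "0 \<le> 1 - prob A" "1 - prob A < 1"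
        using Q by fastforce+
      then show ?thesis
        using Q_upper[OF * A] by simp
    qed
  next
    fix \<alpha> :: real
    assume *: "\<forall>A\<in>sets M. (\<integral>\<^sup>+x. ennreal (norm (Z x)) * indicator A x \<partial>M) \<le> c * S (prob A)"
      and "\<alpha> \<in> {0..<1}"
    with Q_attained[of \<alpha>] show "Q \<alpha> \<le> c * S (1 - \<alpha>)"
      by force
  qed
  finally show ?thesis .
qed

end

section \<open>The two extended norms, and completeness of the dual one\<close>

lemma ennreal_tendsto_0I:
  fixes f :: "'b \<Rightarrow> ennreal"
  assumes "\<And>e::real. 0 < e \<Longrightarrow> eventually (\<lambda>n. f n \<le> ennreal e) F"
  shows "(f \<longlongrightarrow> 0) F"
proof (rule order_tendstoI)
  fix a :: ennreal assume "0 < a"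
  then obtain b where b: "0 < b" "b < a"
    using dense by blast
  then obtain e where e: "b = ennreal e" "0 < e"
    by (cases b) auto
  show "eventually (\<lambda>n. f n < a) F"
    using assms[OF e(2)] by eventually_elim (use b e in auto)
qed simp

context distortion_prob_space
begin

lemma bounded_by_S_sigma_inf_val:
  fixes Z :: "'a \<Rightarrow> 'b::{real_normed_vector, second_countable_topology}"
  shows "Z \<in> borel_measurable M \<Longrightarrow> bounded_by_S Z (sigma_inf_val M \<sigma> Z)"
  using sigma_inf_val_le_iff[of Z "sigma_inf_val M \<sigma> Z"] by simp

text \<open>A restatement of \<open>le_S\<close>. Pairing with the constant 1 then bounds E|Y| by
  the norm of Y, whence definiteness.\<close>

lemma bounded_by_S_one: "bounded_by_S (\<lambda>x. 1::real) 1"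
proof -
  have "(\<integral>\<^sup>+x. indicator A x \<partial>M) \<le> S (prob A)" if "A \<in> sets M" for A
    using that le_S[of "prob A"] by (simp add: emeasure_eq_measure)
  then show ?thesis
    by (simp add: bounded_by_S_def)
qed

lemma nn_integral_le_sigma1:
  fixes Y :: "'a \<Rightarrow> 'b::{real_normed_vector, second_countable_topology}"
  assumes "Y \<in> borel_measurable M"
  shows "(\<integral>\<^sup>+x. ennreal (norm (Y x)) \<partial>M) \<le> sigma1_val M \<sigma> Y"
  using bounded_by_S_pairing[OF _ assms bounded_by_S_one] by simp

lemma ae_norm_sigma1:
  "ae_norm M (sigma1_val M \<sigma> :: ('a \<Rightarrow> 'k::{real_normed_field, second_countable_topology}) \<Rightarrow> ennreal)"
proof
  fix f g :: "'a \<Rightarrow> 'k" and c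
  assume f [measurable]: "f \<in> borel_measurable M"
  show "sigma1_val M \<sigma> (\<lambda>x. c * f x) \<le> ennreal (norm c) * sigma1_val M \<sigma> f"
  proof (subst sigma1_val_eq, simp, rule SUP_least)
    fix U assume U: "U \<in> uniform_rvs M"
    note [measurable] = uniform_measurable[OF U]
    have "(\<integral>\<^sup>+x. ennreal (\<rho> (U x)) * ennreal (norm (c * f x)) \<partial>M)
        = (\<integral>\<^sup>+x. ennreal (norm c) * (ennreal (\<rho> (U x)) * ennreal (norm (f x))) \<partial>M)"
      by (intro nn_integral_cong) (simp add: norm_mult ennreal_mult ac_simps)
    also have "\<dots> = ennreal (norm c) * (\<integral>\<^sup>+x. ennreal (\<rho> (U x)) * ennreal (norm (f x)) \<partial>M)"
      by (rule nn_integral_cmult) simp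
    also have "\<dots> \<le> ennreal (norm c) * sigma1_val M \<sigma> f"
      by (intro mult_left_mono nn_integral_le_sigma1_val U) auto
    finally show "(\<integral>\<^sup>+x. ennreal (\<rho> (U x)) * ennreal (norm (c * f x)) \<partial>M) \<le> \<dots>" .
  qed
  show "AE x in M. f x = 0" if "sigma1_val M \<sigma> f = 0"
  proof -
    have "(\<integral>\<^sup>+x. ennreal (norm (f x)) \<partial>M) = 0"
      using nn_integral_le_sigma1[OF f] that by simp
    then show ?thesis
      by (subst (asm) nn_integral_0_iff_AE) auto
  qed
  assume g [measurable]: "g \<in> borel_measurable M"
  show "sigma1_val M \<sigma> f = sigma1_val M \<sigma> g" if "AE x in M. f x = g x"
    using that unfolding sigma1_val_def by (intro SUP_cong refl nn_integral_cong_AE) auto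
  show "sigma1_val M \<sigma> (\<lambda>x. f x + g x) \<le> sigma1_val M \<sigma> f + sigma1_val M \<sigma> g"
  proof (subst sigma1_val_eq, simp, rule SUP_least)
    fix U assume U: "U \<in> uniform_rvs M"
    note [measurable] = uniform_measurable[OF U]
    have "(\<integral>\<^sup>+x. ennreal (\<rho> (U x)) * ennreal (norm (f x + g x)) \<partial>M)
        \<le> (\<integral>\<^sup>+x. ennreal (\<rho> (U x)) * ennreal (norm (f x)) + ennreal (\<rho> (U x)) * ennreal (norm (g x)) \<partial>M)"
      unfolding distrib_left[symmetric]
      by (intro nn_integral_mono mult_left_mono)
        (auto simp: ennreal_plus[symmetric] norm_triangle_ineq simp del: ennreal_plus)
    also have "\<dots> = (\<integral>\<^sup>+x. ennreal (\<rho> (U x)) * ennreal (norm (f x)) \<partial>M)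
        + (\<integral>\<^sup>+x. ennreal (\<rho> (U x)) * ennreal (norm (g x)) \<partial>M)"
      by (rule nn_integral_add) auto
    also have "\<dots> \<le> sigma1_val M \<sigma> f + sigma1_val M \<sigma> g"
      by (intro add_mono nn_integral_le_sigma1_val U) auto
    finally show "(\<integral>\<^sup>+x. ennreal (\<rho> (U x)) * ennreal (norm (f x + g x)) \<partial>M) \<le> \<dots>" .
  qed
qed

text \<open>Every axiom is read off from the bounds on events, in particular the triangle
  inequality, which quantiles do not satisfy pointwise. Definiteness comes from the event
  \<open>space M\<close>.\<close>

lemma ae_norm_sigma_inf:
  "ae_norm M (sigma_inf_val M \<sigma> :: ('a \<Rightarrow> 'k::{real_normed_field, second_countable_topology}) \<Rightarrow> ennreal)"
proof
  fix f g :: "'a \<Rightarrow> 'k" and c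
  assume f [measurable]: "f \<in> borel_measurable M"
  show "sigma_inf_val M \<sigma> (\<lambda>x. c * f x) \<le> ennreal (norm c) * sigma_inf_val M \<sigma> f"
  proof (subst sigma_inf_val_le_iff, simp, unfold bounded_by_S_def, rule ballI)
    fix A assume A [measurable]: "A \<in> sets M"
    have "(\<integral>\<^sup>+x. ennreal (norm (c * f x)) * indicator A x \<partial>M)
        = (\<integral>\<^sup>+x. ennreal (norm c) * (ennreal (norm (f x)) * indicator A x) \<partial>M)"
      by (intro nn_integral_cong) (simp add: norm_mult ennreal_mult ac_simps)
    also have "\<dots> = ennreal (norm c) * (\<integral>\<^sup>+x. ennreal (norm (f x)) * indicator A x \<partial>M)"
      by (rule nn_integral_cmult) simp
    also have "\<dots> \<le> ennreal (norm c) * (sigma_inf_val M \<sigma> f * S (prob A))"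
      using bounded_by_S_sigma_inf_val[OF f] A
      by (intro mult_left_mono) (simp_all add: bounded_by_S_def)
    finally show "(\<integral>\<^sup>+x. ennreal (norm (c * f x)) * indicator A x \<partial>M)
        \<le> ennreal (norm c) * sigma_inf_val M \<sigma> f * S (prob A)"
      by (simp add: mult.assoc)
  qed
  show "AE x in M. f x = 0" if "sigma_inf_val M \<sigma> f = 0"
  proof -
    have "(\<integral>\<^sup>+x. ennreal (norm (f x)) \<partial>M) = 0"
      using nn_integral_norm_le[OF bounded_by_S_sigma_inf_val[OF f]] that by simp
    then show ?thesis
      by (subst (asm) nn_integral_0_iff_AE) auto
  qed
  assume g [measurable]: "g \<in> borel_measurable M"
  show "sigma_inf_val M \<sigma> f = sigma_inf_val M \<sigma> g" if eq: "AE x in M. f x = g x"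
  proof -
    have "(\<integral>\<^sup>+x. ennreal (norm (f x)) * indicator A x \<partial>M) = (\<integral>\<^sup>+x. ennreal (norm (g x)) * indicator A x \<partial>M)" for A
      using eq by (intro nn_integral_cong_AE) auto
    then have "sigma_inf_val M \<sigma> f \<le> c \<longleftrightarrow> sigma_inf_val M \<sigma> g \<le> c" for c
      by (simp add: sigma_inf_val_le_iff bounded_by_S_def)
    then show ?thesis
      by (meson order_antisym order_refl)
  qed
  show "sigma_inf_val M \<sigma> (\<lambda>x. f x + g x) \<le> sigma_inf_val M \<sigma> f + sigma_inf_val M \<sigma> g"
  proof (subst sigma_inf_val_le_iff, simp, unfold bounded_by_S_def, rule ballI)
    fix A assume A [measurable]: "A \<in> sets M"
    have "(\<integral>\<^sup>+x. ennreal (norm (f x + g x)) * indicator A x \<partial>M)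
        \<le> (\<integral>\<^sup>+x. ennreal (norm (f x)) * indicator A x + ennreal (norm (g x)) * indicator A x \<partial>M)"
      unfolding distrib_right[symmetric]
      by (intro nn_integral_mono mult_right_mono)
        (auto simp: ennreal_plus[symmetric] norm_triangle_ineq simp del: ennreal_plus)
    also have "\<dots> = (\<integral>\<^sup>+x. ennreal (norm (f x)) * indicator A x \<partial>M)
        + (\<integral>\<^sup>+x. ennreal (norm (g x)) * indicator A x \<partial>M)"
      by (rule nn_integral_add) auto
    also have "\<dots> \<le> sigma_inf_val M \<sigma> f * S (prob A) + sigma_inf_val M \<sigma> g * S (prob A)"
      using bounded_by_S_sigma_inf_val[OF f] bounded_by_S_sigma_inf_val[OF g] A
      by (intro add_mono) (simp_all add: bounded_by_S_def)
    finally show "(\<integral>\<^sup>+x. ennreal (norm (f x + g x)) * indicator A x \<partial>M)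
        \<le> (sigma_inf_val M \<sigma> f + sigma_inf_val M \<sigma> g) * S (prob A)"
      by (simp add: distrib_right)
  qed
qed

text \<open>The norm dominates the \<open>L1\<close> norm, so a Cauchy sequence has a subsequence
  converging almost everywhere. Fatou's lemma along it transfers the Cauchy bound to the limit on
  each event separately.\<close>

lemma sigma_inf_val_complete:
  fixes f :: "nat \<Rightarrow> 'a \<Rightarrow> 'k::{banach, second_countable_topology}"
  assumes f [measurable]: "\<And>n. f n \<in> borel_measurable M"
    and fin: "\<And>n. sigma_inf_val M \<sigma> (f n) < \<infinity>"
    and cauchy: "\<And>e::real. 0 < e \<Longrightarrow> \<exists>k. \<forall>m\<ge>k. \<forall>n\<ge>k. sigma_inf_val M \<sigma> (\<lambda>x. f m x - f n x) \<le> ennreal e"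
  shows "\<exists>g\<in>borel_measurable M.
    \<forall>e>0. \<exists>k. \<forall>n\<ge>k. sigma_inf_val M \<sigma> (\<lambda>x. f n x - g x) \<le> ennreal e"
proof -
  have int: "integrable M (f n)" for n
    using le_less_trans[OF nn_integral_norm_le[OF bounded_by_S_sigma_inf_val[OF f]] fin, of n]
    by (simp add: integrable_iff_bounded)
  have L1_cauchy: "\<exists>k. \<forall>m\<ge>k. \<forall>n\<ge>k. (LINT x|M. norm (f m x - f n x)) < e" if e: "0 < e" for e :: real
  proof -
    obtain k where k: "\<And>m n. k \<le> m \<Longrightarrow> k \<le> n \<Longrightarrow> sigma_inf_val M \<sigma> (\<lambda>x. f m x - f n x) \<le> ennreal (e/2)"
      using cauchy[of "e/2"] e by auto
    have "(LINT x|M. norm (f m x - f n x)) < e" if "k \<le> m" "k \<le> n" for m n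
    proof -
      have "ennreal (LINT x|M. norm (f m x - f n x)) = (\<integral>\<^sup>+x. ennreal (norm (f m x - f n x)) \<partial>M)"
        using int by (intro nn_integral_eq_integral[symmetric]) auto
      also have "\<dots> \<le> ennreal (e/2)"
        using nn_integral_norm_le[OF bounded_by_S_sigma_inf_val] k[OF that] by (rule order_trans) simp
      finally show ?thesis
        using e by (simp add: ennreal_le_iff)
    qed
    then show ?thesis
      by blast
  qed
  obtain r where r: "strict_mono r" "AE x in M. Cauchy (\<lambda>i. f (r i) x)"
    using cauchy_L1_AE_cauchy_subseq[OF int L1_cauchy] by auto
  define g where "g x = lim (\<lambda>i. f (r i) x)" for x
  have [measurable]: "g \<in> borel_measurable M"
    unfolding g_def[abs_def] by measurable
  have lim: "AE x in M. (\<lambda>i. f (r i) x) \<longlonglongrightarrow> g x"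
    using r(2) by eventually_elim (simp add: g_def convergent_LIMSEQ_iff[symmetric] Cauchy_convergent_iff)
  have "\<exists>k. \<forall>n\<ge>k. sigma_inf_val M \<sigma> (\<lambda>x. f n x - g x) \<le> ennreal e" if e: "0 < e" for e :: real
  proof -
    obtain k where k: "\<And>m n. k \<le> m \<Longrightarrow> k \<le> n \<Longrightarrow> sigma_inf_val M \<sigma> (\<lambda>x. f m x - f n x) \<le> ennreal e"
      using cauchy[OF e] by auto
    have "sigma_inf_val M \<sigma> (\<lambda>x. f n x - g x) \<le> ennreal e" if n: "k \<le> n" for n
    proof (subst sigma_inf_val_le_iff, simp, unfold bounded_by_S_def, rule ballI)
      fix A assume A [measurable]: "A \<in> sets M"
      let ?h = "\<lambda>i x. ennreal (norm (f n x - f (r i) x)) * indicator A x"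
      have "(\<integral>\<^sup>+x. ennreal (norm (f n x - g x)) * indicator A x \<partial>M) = (\<integral>\<^sup>+x. liminf (\<lambda>i. ?h i x) \<partial>M)"
      proof (rule nn_integral_cong_AE, use lim in eventually_elim)
        case (elim x)
        then have "(\<lambda>i. ?h i x) \<longlonglongrightarrow> ennreal (norm (f n x - g x)) * indicator A x"
          by (intro tendsto_intros ennreal_tendsto_cmult[OF _ _, of "indicator A x", unfolded mult.commute[of "indicator A x"]])
            (auto split: split_indicator)
        then show ?case
          by (intro lim_imp_Liminf[symmetric]) auto
      qed
      also have "\<dots> \<le> liminf (\<lambda>i. \<integral>\<^sup>+x. ?h i x \<partial>M)"
        by (rule nn_integral_liminf) simp
      also have "\<dots> \<le> ennreal e * S (prob A)"
      proof (rule Liminf_le)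
        have "(\<integral>\<^sup>+x. ?h i x \<partial>M) \<le> ennreal e * S (prob A)" if "k \<le> i" for i
        proof -
          have "k \<le> r i"
            using that seq_suble[OF r(1), of i] by simp
          from k[OF n this] have "bounded_by_S (\<lambda>x. f n x - f (r i) x) (ennreal e)"
            by (subst (asm) sigma_inf_val_le_iff) auto
          then show ?thesis
            by (simp add: bounded_by_S_def)
        qed
        then show "eventually (\<lambda>i. (\<integral>\<^sup>+x. ?h i x \<partial>M) \<le> ennreal e * S (prob A)) sequentially"
          by (rule eventually_sequentiallyI)
      qed simp
      finally show "(\<integral>\<^sup>+x. ennreal (norm (f n x - g x)) * indicator A x \<partial>M) \<le> ennreal e * S (prob A)" .
    qed
    then show ?thesis
      by blast
  qed
  then show ?thesis
    by (intro bexI[of _ g]) auto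
qed

section \<open>Dominated convergence in the primal norm\<close>

text \<open>One uniform variable \<open>U\<close>, comonotone with \<open>N\<close>, controls the tails of \<open>N\<close> for all
  uniform variables at once; this is what makes bounded functions dense.\<close>

lemma uniform_tail_control:
  fixes N :: "'a \<Rightarrow> nat"
  assumes [measurable]: "N \<in> measurable M (count_space UNIV)"
  obtains U where "U \<in> uniform_rvs M"
    "\<And>U' n. U' \<in> uniform_rvs M \<Longrightarrow>
      (\<integral>\<^sup>+x. ennreal (\<rho> (U' x)) * of_nat (if n \<le> N x then N x else 0) \<partial>M) \<le>
      (\<integral>\<^sup>+x. ennreal (\<rho> (U x)) * of_nat (if n \<le> N x then N x else 0) \<partial>M)"
proof -
  obtain U where U: "U \<in> uniform_rvs M" and UN:
    "\<And>k. S (prob {x\<in>space M. k \<le> N x}) \<le>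
      (\<integral>\<^sup>+x. ennreal (\<rho> (U x)) * indicator {x\<in>space M. k \<le> N x} x \<partial>M)"
    using comonotone_uniform[of N] by auto
  note [measurable] = uniform_measurable[OF U]
  have "(\<integral>\<^sup>+x. ennreal (\<rho> (U' x)) * of_nat (if n \<le> N x then N x else 0) \<partial>M) \<le>
      1 * (\<integral>\<^sup>+x. ennreal (\<rho> (U x)) * of_nat (if n \<le> N x then N x else 0) \<partial>M)"
    if U': "U' \<in> uniform_rvs M" for U' n
  proof (rule nn_integral_layer_mono)
    note [measurable] = uniform_measurable[OF U']
    show "(\<lambda>x. ennreal (\<rho> (U' x))) \<in> borel_measurable M"
      by measurable
    fix k
    \<comment> \<open>Level sets of the truncation at n are again level sets of N, so the U that is
      comonotone with N is optimal for every truncation.\<close>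
    have "{x\<in>space M. k < (if n \<le> N x then N x else 0)} = {x\<in>space M. max (Suc k) n \<le> N x}"
      by auto
    then show "(\<integral>\<^sup>+x. ennreal (\<rho> (U' x)) * indicator {x\<in>space M. k < (if n \<le> N x then N x else 0)} x \<partial>M)
        \<le> 1 * (\<integral>\<^sup>+x. ennreal (\<rho> (U x)) * indicator {x\<in>space M. k < (if n \<le> N x then N x else 0)} x \<partial>M)"
      using order_trans[OF nn_integral_rho_indicator_le[OF U'] UN[of "max (Suc k) n"]] by simp
  qed auto
  then show ?thesis
    using U by (intro that[of U]) auto
qed

text \<open>The estimate must be uniform over all uniform variables. Where N \<ge> n, the function
  is dominated by the tail of N, which is controlled by a single U. Elsewhere it is at most n, and
  it exceeds e/5 only on \<open>A i\<close>, whose probability tends to 0; there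
  \<open>n * S (prob (A i))\<close> is a bound valid for all uniform variables.\<close>

lemma sigma1_val_dominated_convergence:
  fixes f :: "nat \<Rightarrow> 'a \<Rightarrow> 'b::{real_normed_vector, second_countable_topology}" and g :: "'a \<Rightarrow> real"
  assumes f [measurable]: "\<And>i. f i \<in> borel_measurable M" and g [measurable]: "g \<in> borel_measurable M"
    and dom: "\<And>i x. x \<in> space M \<Longrightarrow> norm (f i x) \<le> g x" and fin: "sigma1_val M \<sigma> g < \<infinity>"
    and lim: "AE x in M. (\<lambda>i. f i x) \<longlonglongrightarrow> 0"
  shows "(\<lambda>i. sigma1_val M \<sigma> (f i)) \<longlonglongrightarrow> 0"
proof (rule ennreal_tendsto_0I)
  fix e :: real assume e: "0 < e"
  define N where "N = (\<lambda>x. nat \<lfloor>g x\<rfloor>)"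
  have [measurable]: "N \<in> measurable M (count_space UNIV)"
    by (simp add: N_def)
  have g_nonneg: "0 \<le> g x" if "x \<in> space M" for x
    using dom[OF that, of 0] norm_ge_zero order_trans by blast
  define N' where "N' n x = (if n \<le> N x then N x else 0)" for n x
  have [measurable]: "N' n \<in> measurable M (count_space UNIV)" for n
    by (simp add: N'_def[abs_def])
  obtain U where U: "U \<in> uniform_rvs M" and UN:
    "\<And>U' n. U' \<in> uniform_rvs M \<Longrightarrow> (\<integral>\<^sup>+x. ennreal (\<rho> (U' x)) * of_nat (N' n x) \<partial>M)
      \<le> (\<integral>\<^sup>+x. ennreal (\<rho> (U x)) * of_nat (N' n x) \<partial>M)"
    using uniform_tail_control[of N] unfolding N'_def by auto
  note [measurable] = uniform_measurable[OF U]
  define T where "T n = (\<integral>\<^sup>+x. ennreal (\<rho> (U x)) * of_nat (N' n x) \<partial>M)" for n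
  have "T \<longlonglongrightarrow> (\<integral>\<^sup>+x. 0 \<partial>M)"
    unfolding T_def[abs_def]
  proof (rule nn_integral_dominated_convergence)
    show "AE x in M. ennreal (\<rho> (U x)) * of_nat (N' n x) \<le> ennreal (\<rho> (U x)) * ennreal (norm (g x))" for n
    proof (intro AE_I2 mult_left_mono)
      fix x assume "x \<in> space M"
      then have "real (N' n x) \<le> norm (g x)"
        using g_nonneg by (simp add: N'_def N_def)
      then show "of_nat (N' n x) \<le> ennreal (norm (g x))"
        by (simp add: ennreal_of_nat_eq_real_of_nat ennreal_leI)
    qed simp
    show "(\<integral>\<^sup>+x. ennreal (\<rho> (U x)) * ennreal (norm (g x)) \<partial>M) < \<infinity>"
      using nn_integral_le_sigma1_val[OF g U] fin by (rule le_less_trans)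
    show "AE x in M. (\<lambda>n. ennreal (\<rho> (U x)) * of_nat (N' n x)) \<longlonglongrightarrow> 0"
    proof (rule AE_I2, rule tendsto_eventually)
      fix x
      show "eventually (\<lambda>n. ennreal (\<rho> (U x)) * of_nat (N' n x) = 0) sequentially"
        using eventually_gt_at_top[of "N x"] by eventually_elim (simp add: N'_def)
    qed
  qed auto
  then have "eventually (\<lambda>n. T n < ennreal (e/5)) sequentially"
    using e by (intro order_tendstoD(2)[where y=0]) auto
  \<comment> \<open>\<open>1 \<le> n\<close> ensures N + 1 \<le> 2 N where N \<ge> n, so that twice
    the tail of N absorbs the rounding of \<open>g\<close>.\<close>
  moreover have "eventually (\<lambda>n::nat. 1 \<le> n) sequentially"
    by (rule eventually_ge_at_top)
  ultimately obtain n where n: "T n < ennreal (e/5)" "1 \<le> n"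
    using eventually_happens[OF eventually_conj] by (metis (mono_tags, lifting) trivial_limit_sequentially)
  have expand: "ennreal (r * (2 * real k + (d + real n * indicator B x)))
      = 2 * (ennreal r * of_nat k) + (ennreal d * ennreal r + of_nat n * (ennreal r * indicator B x))"
    if "0 \<le> r" "0 \<le> d" for r d :: real and k and B :: "'a set" and x
    using that by (simp add: ennreal_mult distrib_left ennreal_of_nat_eq_real_of_nat ennreal_indicator ac_simps)
  define A where "A i = {x\<in>space M. e/5 < norm (f i x)}" for i
  have [measurable]: "A i \<in> sets M" for i
    by (simp add: A_def)
  have "(\<lambda>i. \<integral>\<^sup>+x. indicator (A i) x \<partial>M) \<longlonglongrightarrow> (\<integral>\<^sup>+x. 0 \<partial>M)"
  proof (rule nn_integral_dominated_convergence)
    show "AE x in M. indicator (A i) x \<le> (1::ennreal)" for i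
      by (auto split: split_indicator)
    show "(\<integral>\<^sup>+x. 1 \<partial>M) < \<infinity>"
      by (simp add: emeasure_space_1)
    show "AE x in M. (\<lambda>i. indicator (A i) x :: ennreal) \<longlonglongrightarrow> 0"
      using lim
    proof eventually_elim
      case (elim x)
      then have "(\<lambda>i. norm (f i x)) \<longlonglongrightarrow> 0"
        by (rule tendsto_norm_zero)
      then have "eventually (\<lambda>i. norm (f i x) < e/5) sequentially"
        using e by (intro order_tendstoD(2)) auto
      then have "eventually (\<lambda>i. indicator (A i) x = (0::ennreal)) sequentially"
        by eventually_elim (auto simp: A_def)
      then show ?case
        by (rule tendsto_eventually)
    qed
  qed auto
  then have "(\<lambda>i. ennreal (prob (A i))) \<longlonglongrightarrow> ennreal 0"
    by (simp add: emeasure_eq_measure)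
  then have "(\<lambda>i. prob (A i)) \<longlonglongrightarrow> 0"
    by (rule tendsto_ennrealD) auto
  then have "(\<lambda>i. S (prob (A i))) \<longlonglongrightarrow> 0"
    by (rule S_tendsto_0) auto
  then have "(\<lambda>i. of_nat n * S (prob (A i))) \<longlonglongrightarrow> of_nat n * 0"
    by (intro ennreal_tendsto_cmult) (auto simp: ennreal_of_nat_eq_real_of_nat)
  then have "eventually (\<lambda>i. of_nat n * S (prob (A i)) < ennreal (e/5)) sequentially"
    using e by (intro order_tendstoD(2)[where y=0]) auto
  then show "eventually (\<lambda>i. sigma1_val M \<sigma> (f i) \<le> ennreal e) sequentially"
  proof eventually_elim
    case (elim i)
    show ?case
    proof (subst sigma1_val_eq, simp, rule SUP_least)
      fix U' assume U': "U' \<in> uniform_rvs M"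
      note [measurable] = uniform_measurable[OF U']
      let ?r = "\<lambda>x. ennreal (\<rho> (U' x))"
      have r_space: "(\<integral>\<^sup>+x. ?r x \<partial>M) \<le> 1"
      proof -
        have "(\<integral>\<^sup>+x. ?r x \<partial>M) = (\<integral>\<^sup>+x. ?r x * indicator (space M) x \<partial>M)"
          by (intro nn_integral_cong) simp
        also have "\<dots> \<le> 1"
          using nn_integral_rho_indicator_le[OF U', of "space M"] by (simp add: prob_space S_one)
        finally show ?thesis .
      qed
      have "(\<integral>\<^sup>+x. ?r x * ennreal (norm (f i x)) \<partial>M)
          \<le> (\<integral>\<^sup>+x. 2 * (?r x * of_nat (N' n x)) + (ennreal (e/5) * ?r x + of_nat n * (?r x * indicator (A i) x)) \<partial>M)"
      proof (rule nn_integral_mono)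
        fix x assume x: "x \<in> space M"
        have "norm (f i x) \<le> 2 * real (N' n x) + (e/5 + real n * indicator (A i) x)"
        proof (cases "n \<le> N x")
          case True
          have "g x \<le> real (N x) + 1"
            using g_nonneg[OF x] unfolding N_def by (simp add: of_nat_nat)
          also have "\<dots> \<le> 2 * real (N' n x)"
            using True n by (simp add: N'_def)
          also have "\<dots> \<le> 2 * real (N' n x) + (e/5 + real n * indicator (A i) x)"
            using e by simp
          finally show ?thesis
            using dom[OF x, of i] by simp
        next
          case False
          then have "g x < real n"
            using g_nonneg[OF x] unfolding N_def by linarith
          with dom[OF x, of i] have "norm (f i x) \<le> real n"
            by simp
          with x e show ?thesis
            by (cases "x \<in> A i") (auto simp: A_def)
        qed
        then have "\<rho> (U' x) * norm (f i x) \<le> \<rho> (U' x) * (2 * real (N' n x) + (e/5 + real n * indicator (A i) x))"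
          by (intro mult_left_mono rho_nonneg)
        then have "ennreal (\<rho> (U' x) * norm (f i x))
            \<le> ennreal (\<rho> (U' x) * (2 * real (N' n x) + (e/5 + real n * indicator (A i) x)))"
          by (rule ennreal_leI)
        also have "\<dots> = 2 * (?r x * of_nat (N' n x)) + (ennreal (e/5) * ?r x + of_nat n * (?r x * indicator (A i) x))"
          using e by (intro expand rho_nonneg) simp
        finally show "?r x * ennreal (norm (f i x)) \<le> \<dots>"
          by (simp add: ennreal_mult rho_nonneg)
      qed
      also have "\<dots> = 2 * (\<integral>\<^sup>+x. ?r x * of_nat (N' n x) \<partial>M)
          + (ennreal (e/5) * (\<integral>\<^sup>+x. ?r x \<partial>M) + of_nat n * (\<integral>\<^sup>+x. ?r x * indicator (A i) x \<partial>M))"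
        by (simp add: nn_integral_add nn_integral_cmult)
      \<comment> \<open>Budget: the tail counts twice, the values up to e/5 once, and the event
        \<open>A i\<close> once, four fifths of e in total.\<close>
      also have "\<dots> \<le> 2 * ennreal (e/5) + (ennreal (e/5) * 1 + ennreal (e/5))"
      proof (intro add_mono mult_left_mono r_space)
        show "(\<integral>\<^sup>+x. ?r x * of_nat (N' n x) \<partial>M) \<le> ennreal (e/5)"
          using UN[OF U', of n] n(1) by (simp add: T_def)
        have "of_nat n * (\<integral>\<^sup>+x. ?r x * indicator (A i) x \<partial>M) \<le> of_nat n * S (prob (A i))"
          by (intro mult_left_mono nn_integral_rho_indicator_le U') auto
        then show "of_nat n * (\<integral>\<^sup>+x. ?r x * indicator (A i) x \<partial>M) \<le> ennreal (e/5)"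
          using elim by simp
      qed auto
      also have "\<dots> = ennreal (4 * (e/5))"
      proof -
        have "2 * ennreal (e/5) = ennreal (2 * (e/5))"
          using e by (subst ennreal_mult) auto
        then show ?thesis
          using e by (simp add: ennreal_plus[symmetric] del: ennreal_plus)
      qed
      also have "\<dots> \<le> ennreal e"
        using e by (intro ennreal_leI) simp
      finally show "(\<integral>\<^sup>+x. ?r x * ennreal (norm (f i x)) \<partial>M) \<le> ennreal e" .
    qed
  qed
qed

end

section \<open>Densities of set functions dominated by the distortion\<close>

context distortion_prob_space
begin

text \<open>Domination by \<open>S\<close> provides both ingredients of the Radon-Nikodym theorem:
  \<open>S_tendsto_0\<close> upgrades finite to countable additivity, and \<open>S 0 = 0\<close>
  gives absolute continuity.\<close>

lemma radon_nikodym_nonneg: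
  fixes \<nu> :: "'a set \<Rightarrow> real"
  assumes add: "\<And>A B. A \<in> sets M \<Longrightarrow> B \<in> sets M \<Longrightarrow> A \<inter> B = {} \<Longrightarrow> \<nu> (A \<union> B) = \<nu> A + \<nu> B"
    and nonneg: "\<And>A. A \<in> sets M \<Longrightarrow> 0 \<le> \<nu> A"
    and bound: "\<And>A. A \<in> sets M \<Longrightarrow> \<nu> A \<le> C * enn2real (S (prob A))"
  shows "\<exists>f :: 'a \<Rightarrow> real. integrable M f \<and> (\<forall>A\<in>sets M. (LINT x:A|M. f x) = \<nu> A)"
proof -
  define N where "N = measure_of (space M) (sets M) (\<lambda>A. ennreal (\<nu> A))"
  have \<nu>_null: "\<nu> A = 0" if "A \<in> sets M" "prob A = 0" for A
    using nonneg[OF that(1)] bound[OF that(1)] that(2) by simp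
  have "countably_additive (sets M) (\<lambda>A. ennreal (\<nu> A))"
  proof (rule sets.empty_continuous_imp_countably_additive)
    show "positive (sets M) (\<lambda>A. ennreal (\<nu> A))"
      using \<nu>_null[of "{}"] by (simp add: positive_def)
    show "additive (sets M) (\<lambda>A. ennreal (\<nu> A))"
      using add nonneg by (auto simp: additive_def)
    fix A :: "nat \<Rightarrow> 'a set" assume A: "range A \<subseteq> sets M" "decseq A" "(\<Inter>i. A i) = {}"
    have "(\<lambda>i. prob (A i)) \<longlonglongrightarrow> prob (\<Inter>i. A i)"
      using A by (intro finite_Lim_measure_decseq) auto
    then have "(\<lambda>i. S (prob (A i))) \<longlonglongrightarrow> 0"
      using A by (intro S_tendsto_0) auto
    then have "(\<lambda>i. enn2real (S (prob (A i)))) \<longlonglongrightarrow> enn2real 0"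
      by (intro tendsto_enn2real) auto
    then have "(\<lambda>i. C * enn2real (S (prob (A i)))) \<longlonglongrightarrow> C * 0"
      by (intro tendsto_mult tendsto_const) simp
    then have "(\<lambda>i. C * enn2real (S (prob (A i)))) \<longlonglongrightarrow> 0"
      by simp
    then have "(\<lambda>i. \<nu> (A i)) \<longlonglongrightarrow> 0"
      by (rule Lim_null_comparison[rotated]) (use A nonneg bound in \<open>auto intro!: always_eventually\<close>)
    then show "(\<lambda>i. ennreal (\<nu> (A i))) \<longlonglongrightarrow> 0"
      using tendsto_ennrealI[of "\<lambda>i. \<nu> (A i)" 0] by simp
  qed simp
  then have emeasure_N: "emeasure N A = ennreal (\<nu> A)" if "A \<in> sets M" for A
    unfolding N_def using \<nu>_null[of "{}"] that
    by (intro emeasure_measure_of_sigma sets.sigma_algebra_axioms) (auto simp: positive_def)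
  have sets_N: "sets N = sets M" and space_N: "space N = space M"
    by (simp_all add: N_def)
  have ac: "absolutely_continuous M N"
    using \<nu>_null by (auto simp: absolutely_continuous_def null_sets_def sets_N emeasure_N emeasure_eq_measure)
  have fin: "finite_measure N"
    by (rule finite_measureI) (simp add: space_N emeasure_N)
  have "\<exists>f\<in>borel_measurable M. (AE x in M. RN_deriv M N x = ennreal (f x)) \<and> (\<forall>x. 0 \<le> f x)"
    by (rule real_RN_deriv[OF fin ac sets_N]) blast
  then obtain f where f [measurable]: "f \<in> borel_measurable M"
    and RN: "AE x in M. RN_deriv M N x = ennreal (f x)" and f_nonneg: "\<And>x. 0 \<le> f x"
    by blast
  have nn: "(\<integral>\<^sup>+x. ennreal (indicator A x * f x) \<partial>M) = ennreal (\<nu> A)" if A [measurable]: "A \<in> sets M" for A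
  proof -
    have "ennreal (\<nu> A) = emeasure (density M (RN_deriv M N)) A"
      using A by (simp add: density_RN_deriv[OF ac sets_N] emeasure_N)
    also have "\<dots> = (\<integral>\<^sup>+x. RN_deriv M N x * indicator A x \<partial>M)"
      by (rule emeasure_density) auto
    also have "\<dots> = (\<integral>\<^sup>+x. ennreal (indicator A x * f x) \<partial>M)"
      by (rule nn_integral_cong_AE, use RN in eventually_elim) (auto split: split_indicator)
    finally show ?thesis by simp
  qed
  show ?thesis
  proof (intro exI[of _ f] conjI ballI)
    have "(\<integral>\<^sup>+x. ennreal (f x) \<partial>M) = (\<integral>\<^sup>+x. ennreal (indicator (space M) x * f x) \<partial>M)"
      by (intro nn_integral_cong) simp
    then show "integrable M f"
      using nn[of "space M"] f_nonneg by (intro integrableI_nonneg) auto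
    show "(LINT x:A|M. f x) = \<nu> A" if A [measurable]: "A \<in> sets M" for A
    proof -
      have "(LINT x:A|M. f x) = enn2real (\<integral>\<^sup>+x. ennreal (indicator A x * f x) \<partial>M)"
        unfolding set_lebesgue_integral_def real_scaleR_def
        using f_nonneg by (intro integral_eq_nn_integral) auto
      then show ?thesis
        using nonneg[OF A] by (simp add: nn)
    qed
  qed
qed

text \<open>The positive variation \<open>\<mu>\<close> of \<open>\<nu>\<close> replaces a Hahn decomposition.\<close>

lemma radon_nikodym_real:
  fixes \<nu> :: "'a set \<Rightarrow> real"
  assumes add: "\<And>A B. A \<in> sets M \<Longrightarrow> B \<in> sets M \<Longrightarrow> A \<inter> B = {} \<Longrightarrow> \<nu> (A \<union> B) = \<nu> A + \<nu> B"
    and C: "0 \<le> C"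
    and bound: "\<And>A. A \<in> sets M \<Longrightarrow> \<bar>\<nu> A\<bar> \<le> C * enn2real (S (prob A))"
  shows "\<exists>f. integrable M f \<and> (\<forall>A\<in>sets M. (LINT x:A|M. f x) = \<nu> A)"
proof -
  define sub where "sub A = {B \<in> sets M. B \<subseteq> A}" for A
  define \<mu> where "\<mu> A = (SUP B\<in>sub A. \<nu> B)" for A
  have le_bound: "\<nu> B \<le> C * enn2real (S (prob A))" if "A \<in> sets M" "B \<in> sub A" for A B
  proof -
    have "prob B \<le> prob A"
      using that by (intro finite_measure_mono) (auto simp: sub_def)
    then have "enn2real (S (prob B)) \<le> enn2real (S (prob A))"
      using S_finite[of "prob A"] by (intro enn2real_mono S_mono) auto
    then have "C * enn2real (S (prob B)) \<le> C * enn2real (S (prob A))"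
      using C by (rule mult_left_mono)
    then show ?thesis
      using bound[of B] that by (simp add: sub_def)
  qed
  have upper: "\<nu> B \<le> \<mu> A" if "A \<in> sets M" "B \<in> sub A" for A B
    unfolding \<mu>_def using that by (intro cSUP_upper bdd_aboveI2[where M="C * enn2real (S (prob A))"] le_bound)
  have least: "\<mu> A \<le> c" if "\<And>B. B \<in> sub A \<Longrightarrow> \<nu> B \<le> c" for A c
    unfolding \<mu>_def using that by (intro cSUP_least) (auto simp: sub_def)
  have \<nu>_empty: "\<nu> {} = 0"
    using add[of "{}" "{}"] by simp
  have \<mu>_nonneg: "0 \<le> \<mu> A" if "A \<in> sets M" for A
    using upper[OF that, of "{}"] \<nu>_empty by (simp add: sub_def)
  have \<mu>_ge: "\<nu> A \<le> \<mu> A" if "A \<in> sets M" for A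
    using upper[OF that, of A] that by (simp add: sub_def)
  have \<mu>_bound: "\<mu> A \<le> C * enn2real (S (prob A))" if "A \<in> sets M" for A
    using le_bound[OF that] by (rule least)
  have \<mu>_add: "\<mu> (A \<union> B) = \<mu> A + \<mu> B" if AB [measurable]: "A \<in> sets M" "B \<in> sets M" and disj: "A \<inter> B = {}" for A B
  proof (rule antisym)
    show "\<mu> (A \<union> B) \<le> \<mu> A + \<mu> B"
    proof (rule least)
      fix D assume D: "D \<in> sub (A \<union> B)"
      then have [measurable]: "D \<in> sets M"
        by (simp add: sub_def)
      have "D = (D \<inter> A) \<union> (D \<inter> B)"
        using D by (auto simp: sub_def)
      moreover have "\<nu> ((D \<inter> A) \<union> (D \<inter> B)) = \<nu> (D \<inter> A) + \<nu> (D \<inter> B)"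
        using disj by (intro add) auto
      ultimately have "\<nu> D = \<nu> (D \<inter> A) + \<nu> (D \<inter> B)"
        by simp
      also have "\<dots> \<le> \<mu> A + \<mu> B"
        by (intro add_mono upper) (auto simp: sub_def)
      finally show "\<nu> D \<le> \<mu> A + \<mu> B" .
    qed
    have "\<nu> D + \<nu> E \<le> \<mu> (A \<union> B)" if "D \<in> sub A" "E \<in> sub B" for D E
    proof -
      have "\<nu> D + \<nu> E = \<nu> (D \<union> E)"
        using that disj by (intro add[symmetric]) (auto simp: sub_def)
      also have "\<dots> \<le> \<mu> (A \<union> B)"
        using that by (intro upper) (auto simp: sub_def)
      finally show ?thesis .
    qed
    then have "\<mu> A \<le> \<mu> (A \<union> B) - \<nu> E" if "E \<in> sub B" for E
      using that by (intro least) (simp add: le_diff_eq)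
    then have "\<mu> B \<le> \<mu> (A \<union> B) - \<mu> A"
      by (intro least) (simp add: algebra_simps)
    then show "\<mu> A + \<mu> B \<le> \<mu> (A \<union> B)"
      by simp
  qed
  have "\<exists>f. integrable M f \<and> (\<forall>A\<in>sets M. (LINT x:A|M. f x) = \<mu> A)"
    using \<mu>_add \<mu>_nonneg \<mu>_bound by (rule radon_nikodym_nonneg)
  then obtain f where f: "integrable M f" "\<And>A. A \<in> sets M \<Longrightarrow> (LINT x:A|M. f x) = \<mu> A"
    by blast
  \<comment> \<open>Now \<open>\<nu>\<close> is the difference of the nonnegative set functions
    \<open>\<mu>\<close> and \<open>\<mu> - \<nu>\<close>. The second has constant
    \<open>2 * C\<close>, as \<open>\<mu>\<close> and \<open>- \<nu>\<close> each contribute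
    \<open>C\<close>.\<close>
  have "\<exists>g. integrable M g \<and> (\<forall>A\<in>sets M. (LINT x:A|M. g x) = \<mu> A - \<nu> A)"
  proof (rule radon_nikodym_nonneg[of "\<lambda>A. \<mu> A - \<nu> A" "2 * C"])
    show "\<mu> A - \<nu> A \<le> 2 * C * enn2real (S (prob A))" if "A \<in> sets M" for A
      using \<mu>_bound[OF that] bound[OF that] by linarith
  qed (auto simp: \<mu>_add add \<mu>_ge)
  then obtain g where g: "integrable M g" "\<And>A. A \<in> sets M \<Longrightarrow> (LINT x:A|M. g x) = \<mu> A - \<nu> A"
    by blast
  have "(LINT x:A|M. f x - g x) = \<nu> A" if "A \<in> sets M" for A
    using that f g
    by (subst set_integral_diff(2)) (auto simp: set_integrable_def simp del: real_scaleR_def intro!: integrable_mult_indicator)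
  then show ?thesis
    using f(1) g(1) by (intro exI[of _ "\<lambda>x. f x - g x"]) simp
qed

lemma radon_nikodym_complex:
  fixes \<nu> :: "'a set \<Rightarrow> complex"
  assumes add: "\<And>A B. A \<in> sets M \<Longrightarrow> B \<in> sets M \<Longrightarrow> A \<inter> B = {} \<Longrightarrow> \<nu> (A \<union> B) = \<nu> A + \<nu> B"
    and C: "0 \<le> C"
    and bound: "\<And>A. A \<in> sets M \<Longrightarrow> norm (\<nu> A) \<le> C * enn2real (S (prob A))"
  shows "\<exists>f. integrable M f \<and> (\<forall>A\<in>sets M. (LINT x:A|M. f x) = \<nu> A)"
proof -
  obtain f where f: "integrable M f" "\<And>A. A \<in> sets M \<Longrightarrow> (LINT x:A|M. f x) = Re (\<nu> A)"
    using radon_nikodym_real[of "\<lambda>A. Re (\<nu> A)" C] add C order_trans[OF abs_Re_le_cmod bound] by auto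
  obtain g where g: "integrable M g" "\<And>A. A \<in> sets M \<Longrightarrow> (LINT x:A|M. g x) = Im (\<nu> A)"
    using radon_nikodym_real[of "\<lambda>A. Im (\<nu> A)" C] add C order_trans[OF abs_Im_le_cmod bound] by auto
  let ?h = "\<lambda>x. Complex (f x) (g x)"
  have h: "integrable M ?h"
    using f(1) g(1) by (simp add: Complex_eq)
  have "(LINT x:A|M. ?h x) = \<nu> A" if A: "A \<in> sets M" for A
  proof (rule complex_eqI)
    have int: "integrable M (\<lambda>x. indicator A x *\<^sub>R ?h x)"
      by (rule integrable_mult_indicator[OF A h])
    show "Re (LINT x:A|M. ?h x) = Re (\<nu> A)"
      using f(2)[OF A] int by (simp add: set_lebesgue_integral_def integral_Re[symmetric])
    show "Im (LINT x:A|M. ?h x) = Im (\<nu> A)"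
      using g(2)[OF A] int by (simp add: set_lebesgue_integral_def integral_Im[symmetric])
  qed
  then show ?thesis
    using h by blast
qed

end

section \<open>Duality\<close>

lemma enn2real_le_iff: "x < \<infinity> \<Longrightarrow> 0 \<le> r \<Longrightarrow> enn2real x \<le> r \<longleftrightarrow> x \<le> ennreal r"
  by (cases x) auto

text \<open>The sign of a real number, the conjugate over the modulus of a complex one; written with
  \<open>inverse\<close> to cover both fields. As \<open>inverse 0 = 0\<close>, it vanishes at
  0.\<close>

definition phase :: "'k::real_normed_field \<Rightarrow> 'k" where
  "phase z = of_real (norm z) * inverse z"

lemma norm_phase_le: "norm (phase z) \<le> 1"
  by (cases "z = 0") (simp_all add: phase_def norm_mult norm_inverse)

lemma mult_phase: "z * phase z = of_real (norm z)"
  by (cases "z = 0") (simp_all add: phase_def)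

lemma measurable_phase [measurable]:
  "phase \<in> borel_measurable (borel :: 'k::{real_normed_field, second_countable_topology} measure)"
  unfolding phase_def[abs_def] by measurable

text \<open>The assumption is all that distinguishes the real from the complex scalars below.\<close>

locale sigma_duality = distortion_prob_space M \<sigma> for M :: "'a measure" and \<sigma> +
  fixes scalar_type :: "'k::{real_normed_field, banach, second_countable_topology} itself"
  assumes radon_nikodym: "\<And>(\<nu> :: 'a set \<Rightarrow> 'k) C.
    (\<And>A B. A \<in> sets M \<Longrightarrow> B \<in> sets M \<Longrightarrow> A \<inter> B = {} \<Longrightarrow> \<nu> (A \<union> B) = \<nu> A + \<nu> B) \<Longrightarrow> 0 \<le> C \<Longrightarrow>
    (\<And>A. A \<in> sets M \<Longrightarrow> norm (\<nu> A) \<le> C * enn2real (S (prob A))) \<Longrightarrow>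
    \<exists>f. integrable M f \<and> (\<forall>A\<in>sets M. (LINT x:A|M. f x) = \<nu> A)"
begin

sublocale X: ae_norm M "sigma1_val M \<sigma> :: ('a \<Rightarrow> 'k) \<Rightarrow> ennreal"
  by (rule ae_norm_sigma1)

sublocale L: ae_norm M "sigma_inf_val M \<sigma> :: ('a \<Rightarrow> 'k) \<Rightarrow> ennreal"
  by (rule ae_norm_sigma_inf)

lemma X_eq: "L_sigma1 M \<sigma> = X.V"
  by (simp add: L_sigma1_def X.V_def)

lemma L_eq: "L_sigma_inf M \<sigma> = L.V"
  by (simp add: L_sigma_inf_def L.V_def)

lemma normed_X: "normed_space_on X.V (sigma1_norm M \<sigma>)"
  using X.normed_space_V by (simp add: sigma1_norm_def[abs_def])

lemma normed_L: "normed_space_on L.V (sigma_inf_norm M \<sigma>)"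
  using L.normed_space_V by (simp add: sigma_inf_norm_def[abs_def])

lemma sigma1_norm_ae_class: "f \<in> borel_measurable M \<Longrightarrow> sigma1_norm M \<sigma> (ae_class M f) = enn2real (sigma1_val M \<sigma> f)"
  for f :: "'a \<Rightarrow> 'k"
  by (simp add: sigma1_norm_def X.N_rv_ae_class)

text \<open>Serves indicators and phases on A with b = 1, and simple functions approximating such
  phases with b = 2.\<close>

lemma sigma1_val_indicator_le:
  fixes f :: "'a \<Rightarrow> 'k"
  assumes [measurable]: "f \<in> borel_measurable M" "A \<in> sets M"
    and b: "0 \<le> b" "\<And>x. x \<in> space M \<Longrightarrow> norm (f x) \<le> b * indicator A x"
  shows "sigma1_val M \<sigma> f \<le> ennreal b * S (prob A)"
proof (subst sigma1_val_eq, simp, rule SUP_least)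
  fix U assume U: "U \<in> uniform_rvs M"
  note [measurable] = uniform_measurable[OF U]
  have "(\<integral>\<^sup>+x. ennreal (\<rho> (U x)) * ennreal (norm (f x)) \<partial>M)
      \<le> (\<integral>\<^sup>+x. ennreal b * (ennreal (\<rho> (U x)) * indicator A x) \<partial>M)"
  proof (rule nn_integral_mono)
    fix x assume "x \<in> space M"
    then have "ennreal (norm (f x)) \<le> ennreal (b * indicator A x)"
      by (intro ennreal_leI b)
    also have "\<dots> = ennreal b * indicator A x"
      by (auto split: split_indicator)
    finally have "ennreal (\<rho> (U x)) * ennreal (norm (f x)) \<le> ennreal (\<rho> (U x)) * (ennreal b * indicator A x)"
      by (rule mult_left_mono) simp
    then show "ennreal (\<rho> (U x)) * ennreal (norm (f x)) \<le> ennreal b * (ennreal (\<rho> (U x)) * indicator A x)"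
      by (simp add: ac_simps)
  qed
  also have "\<dots> = ennreal b * (\<integral>\<^sup>+x. ennreal (\<rho> (U x)) * indicator A x \<partial>M)"
    by (rule nn_integral_cmult) simp
  also have "\<dots> \<le> ennreal b * S (prob A)"
    by (intro mult_left_mono nn_integral_rho_indicator_le U) auto
  finally show "(\<integral>\<^sup>+x. ennreal (\<rho> (U x)) * ennreal (norm (f x)) \<partial>M) \<le> \<dots>" .
qed

lemma indicator_bounded:
  fixes f :: "'a \<Rightarrow> 'k"
  assumes f: "f \<in> borel_measurable M" and A: "A \<in> sets M"
    and b: "0 \<le> b" "\<And>x. x \<in> space M \<Longrightarrow> norm (f x) \<le> b * indicator A x"
  shows "ae_class M f \<in> carrier X.V" "sigma1_norm M \<sigma> (ae_class M f) \<le> b * enn2real (S (prob A))"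
proof -
  note le = sigma1_val_indicator_le[OF f A b]
  have fin: "ennreal b * S (prob A) < Orderings.top"
    using S_finite[of "prob A"] by (simp add: ennreal_mult_less_top)
  show "ae_class M f \<in> carrier X.V"
    using le_less_trans[OF le fin] by (intro X.ae_class_in_carrier f) simp
  have "enn2real (sigma1_val M \<sigma> f) \<le> enn2real (ennreal b * S (prob A))"
    by (intro enn2real_mono le fin)
  then show "sigma1_norm M \<sigma> (ae_class M f) \<le> b * enn2real (S (prob A))"
    using b(1) by (simp add: sigma1_norm_ae_class f enn2real_mult)
qed

lemma pairing:
  fixes Z Y :: "'a \<Rightarrow> 'k"
  assumes [measurable]: "Z \<in> borel_measurable M" "Y \<in> borel_measurable M"
    and fin: "sigma_inf_val M \<sigma> Z < \<infinity>" "sigma1_val M \<sigma> Y < \<infinity>"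
  shows "integrable M (\<lambda>x. Z x * Y x)"
    and "norm (\<integral>x. Z x * Y x \<partial>M) \<le> enn2real (sigma_inf_val M \<sigma> Z) * enn2real (sigma1_val M \<sigma> Y)"
proof -
  have "(\<integral>\<^sup>+x. ennreal (norm (Z x * Y x)) \<partial>M) = (\<integral>\<^sup>+x. ennreal (norm (Z x)) * ennreal (norm (Y x)) \<partial>M)"
    by (simp add: norm_mult ennreal_mult)
  also have "\<dots> \<le> sigma_inf_val M \<sigma> Z * sigma1_val M \<sigma> Y"
    by (intro bounded_by_S_pairing bounded_by_S_sigma_inf_val fin) auto
  finally have le: "(\<integral>\<^sup>+x. ennreal (norm (Z x * Y x)) \<partial>M) \<le> sigma_inf_val M \<sigma> Z * sigma1_val M \<sigma> Y" .
  have prod_fin: "sigma_inf_val M \<sigma> Z * sigma1_val M \<sigma> Y < \<infinity>"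
    using fin by (simp add: ennreal_mult_less_top)
  show int: "integrable M (\<lambda>x. Z x * Y x)"
    using le_less_trans[OF le prod_fin] by (simp add: integrable_iff_bounded)
  have "norm (\<integral>x. Z x * Y x \<partial>M) \<le> (\<integral>x. norm (Z x * Y x) \<partial>M)"
    by (rule integral_norm_bound)
  also have "\<dots> = enn2real (\<integral>\<^sup>+x. ennreal (norm (Z x * Y x)) \<partial>M)"
    by (rule integral_eq_nn_integral) auto
  also have "\<dots> \<le> enn2real (sigma_inf_val M \<sigma> Z * sigma1_val M \<sigma> Y)"
    using prod_fin by (intro enn2real_mono le) simp
  finally show "norm (\<integral>x. Z x * Y x \<partial>M) \<le> enn2real (sigma_inf_val M \<sigma> Z) * enn2real (sigma1_val M \<sigma> Y)"
    by (simp add: enn2real_mult)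
qed

section \<open>The map \<open>Phi\<close> into the dual, its isometry and injectivity\<close>

lemma integrable_rv:
  assumes "Z \<in> carrier L.V" "Y \<in> carrier X.V"
  shows "integrable M (\<lambda>x. rv Z x * rv Y x)"
  using assms by (intro pairing L.rv_measurable X.rv_measurable) (auto simp: L.carrier_iff X.carrier_iff)

lemma Phi_apply: "Y \<in> carrier X.V \<Longrightarrow> Phi M \<sigma> Z Y = (\<integral>x. rv Z x * rv Y x \<partial>M)"
  by (simp add: Phi_def X_eq)

lemma norm_Phi_le:
  assumes "Z \<in> carrier L.V" "Y \<in> carrier X.V"
  shows "norm (Phi M \<sigma> Z Y) \<le> sigma_inf_norm M \<sigma> Z * sigma1_norm M \<sigma> Y"
  using pairing(2)[OF L.rv_measurable[OF assms(1)] X.rv_measurable[OF assms(2)]] assms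
  by (simp add: Phi_apply sigma_inf_norm_def sigma1_norm_def L.carrier_iff X.carrier_iff)

lemma Phi_ae_class:
  assumes Z: "Z \<in> carrier L.V" and f [measurable]: "f \<in> borel_measurable M" and F: "ae_class M f \<in> carrier X.V"
  shows "Phi M \<sigma> Z (ae_class M f) = (\<integral>x. rv Z x * f x \<partial>M)"
proof -
  note [measurable] = L.rv_measurable[OF Z] X.rv_measurable[OF F]
  show ?thesis
    unfolding Phi_apply[OF F] using rv_ae_class(2)[OF f] by (intro integral_cong_AE) auto
qed

lemma linear_map_Phi_Z:
  assumes Z: "Z \<in> carrier L.V"
  shows "linear_map_on X.V scalars (Phi M \<sigma> Z)"
  unfolding linear_map_on_def
proof (intro conjI ballI allI)
  note [measurable] = L.rv_measurable[OF Z]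
  fix Y Y' and c :: 'k assume Y: "Y \<in> carrier X.V"
  note [measurable] = X.rv_measurable[OF Y]
  have "Phi M \<sigma> Z (c \<odot>\<^bsub>X.V\<^esub> Y) = (\<integral>x. rv Z x * (c * rv Y x) \<partial>M)"
    unfolding X.smult_eq using X.smult_in_carrier[OF Y, of c]
    by (intro Phi_ae_class[OF Z]) (auto simp: X.smult_eq)
  also have "\<dots> = (\<integral>x. c * (rv Z x * rv Y x) \<partial>M)"
    by (simp add: ac_simps)
  also have "\<dots> = c * Phi M \<sigma> Z Y"
    by (simp add: Phi_apply Y)
  finally show "Phi M \<sigma> Z (c \<odot>\<^bsub>X.V\<^esub> Y) = c \<odot>\<^bsub>scalars\<^esub> Phi M \<sigma> Z Y"
    by simp
  assume Y': "Y' \<in> carrier X.V"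
  note [measurable] = X.rv_measurable[OF Y']
  have "Phi M \<sigma> Z (Y \<oplus>\<^bsub>X.V\<^esub> Y') = (\<integral>x. rv Z x * (rv Y x + rv Y' x) \<partial>M)"
    unfolding X.add_eq using X.add_in_carrier[OF Y Y']
    by (intro Phi_ae_class[OF Z]) (auto simp: X.add_eq)
  also have "\<dots> = Phi M \<sigma> Z Y + Phi M \<sigma> Z Y'"
    using integrable_rv[OF Z] Y Y' by (simp add: Phi_apply distrib_left)
  finally show "Phi M \<sigma> Z (Y \<oplus>\<^bsub>X.V\<^esub> Y') = Phi M \<sigma> Z Y \<oplus>\<^bsub>scalars\<^esub> Phi M \<sigma> Z Y'"
    by simp
qed simp

abbreviation "X_dual \<equiv> continuous_dual X.V (sigma1_norm M \<sigma>)"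
abbreviation "X_dual_norm \<equiv> dual_norm X.V (sigma1_norm M \<sigma>)"

lemma Phi_in_dual:
  assumes Z: "Z \<in> carrier L.V"
  shows "Phi M \<sigma> Z \<in> carrier X_dual"
  unfolding in_continuous_dual_iff[OF normed_X]
  using linear_map_Phi_Z[OF Z] norm_Phi_le[OF Z] normed_nonneg[OF normed_L Z]
  by (auto simp: Phi_def X_eq)

lemma linear_map_Phi: "linear_map_on L.V X_dual (Phi M \<sigma>)"
  unfolding linear_map_on_def
proof (intro conjI ballI allI)
  show "Phi M \<sigma> \<in> carrier L.V \<rightarrow> carrier X_dual"
    using Phi_in_dual by blast
  fix Z Z' and c :: 'k assume Z: "Z \<in> carrier L.V"
  note [measurable] = L.rv_measurable[OF Z]
  show "Phi M \<sigma> (c \<odot>\<^bsub>L.V\<^esub> Z) = c \<odot>\<^bsub>X_dual\<^esub> Phi M \<sigma> Z"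
  proof
    fix Y
    show "Phi M \<sigma> (c \<odot>\<^bsub>L.V\<^esub> Z) Y = (c \<odot>\<^bsub>X_dual\<^esub> Phi M \<sigma> Z) Y"
    proof (cases "Y \<in> carrier X.V")
      case True
      note [measurable] = X.rv_measurable[OF True] L.rv_measurable[OF L.smult_in_carrier[OF Z]]
      have "(\<integral>x. rv (c \<odot>\<^bsub>L.V\<^esub> Z) x * rv Y x \<partial>M) = (\<integral>x. c * (rv Z x * rv Y x) \<partial>M)"
        using L.rv_smult[OF Z, of c] by (intro integral_cong_AE) (auto simp: mult.assoc)
      then show ?thesis
        using True by (simp add: continuous_dual_def Phi_apply)
    qed (simp add: continuous_dual_def Phi_def X_eq)
  qed
  assume Z': "Z' \<in> carrier L.V"
  note [measurable] = L.rv_measurable[OF Z']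
  show "Phi M \<sigma> (Z \<oplus>\<^bsub>L.V\<^esub> Z') = Phi M \<sigma> Z \<oplus>\<^bsub>X_dual\<^esub> Phi M \<sigma> Z'"
  proof
    fix Y
    show "Phi M \<sigma> (Z \<oplus>\<^bsub>L.V\<^esub> Z') Y = (Phi M \<sigma> Z \<oplus>\<^bsub>X_dual\<^esub> Phi M \<sigma> Z') Y"
    proof (cases "Y \<in> carrier X.V")
      case True
      note [measurable] = X.rv_measurable[OF True] L.rv_measurable[OF L.add_in_carrier[OF Z Z']]
      have "(\<integral>x. rv (Z \<oplus>\<^bsub>L.V\<^esub> Z') x * rv Y x \<partial>M) = (\<integral>x. rv Z x * rv Y x + rv Z' x * rv Y x \<partial>M)"
        using L.rv_add[OF Z Z'] by (intro integral_cong_AE) (auto simp: distrib_right)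
      then show ?thesis
        using True integrable_rv[OF Z True] integrable_rv[OF Z' True]
        by (simp add: continuous_dual_def Phi_apply)
    qed (simp add: continuous_dual_def Phi_def X_eq)
  qed
qed

text \<open>Testing against \<open>phase Z\<close> on an event \<open>A\<close> recovers the integral of \<open>\<bar>Z\<bar>\<close> over \<open>A\<close>.\<close>

lemma dual_norm_Phi:
  assumes Z: "Z \<in> carrier L.V"
  shows "X_dual_norm (Phi M \<sigma> Z) = sigma_inf_norm M \<sigma> Z"
proof (rule antisym)
  note [measurable] = L.rv_measurable[OF Z]
  show "X_dual_norm (Phi M \<sigma> Z) \<le> sigma_inf_norm M \<sigma> Z"
    using normed_nonneg[OF normed_L Z] norm_Phi_le[OF Z] by (rule dual_norm_le[OF normed_X])
  let ?D = "X_dual_norm (Phi M \<sigma> Z)"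
  have bound: "norm (Phi M \<sigma> Z Y) \<le> ?D * sigma1_norm M \<sigma> Y" if "Y \<in> carrier X.V" for Y
    by (rule norm_le_dual_norm[OF normed_X Phi_in_dual[OF Z] that])
  have Z_int: "integrable M (\<lambda>x. norm (rv Z x))"
    using le_less_trans[OF nn_integral_norm_le[OF bounded_by_S_sigma_inf_val], of "rv Z" \<infinity>] Z
    by (simp add: L.carrier_iff L.rv_measurable integrable_iff_bounded)
  have test: "(\<integral>x. norm (rv Z x) * indicator A x \<partial>M) \<le> ?D * sigma1_norm M \<sigma> (ae_class M (\<lambda>x. phase (rv Z x) * indicator A x))
      \<and> sigma1_norm M \<sigma> (ae_class M (\<lambda>x. phase (rv Z x) * indicator A x)) \<le> enn2real (S (prob A))"
    if A [measurable]: "A \<in> sets M" for A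
  proof -
    let ?Y = "\<lambda>x. phase (rv Z x) * indicator A x"
    have "norm (?Y x) \<le> 1 * indicator A x" for x
      by (auto simp: norm_phase_le split: split_indicator)
    note Y = indicator_bounded[OF _ A zero_le_one this]
    have "Phi M \<sigma> Z (ae_class M ?Y) = (\<integral>x. rv Z x * ?Y x \<partial>M)"
      by (rule Phi_ae_class[OF Z _ Y(1)]) auto
    also have "\<dots> = (\<integral>x. of_real (norm (rv Z x) * indicator A x) \<partial>M)"
      by (intro Bochner_Integration.integral_cong)
        (auto simp: mult_phase mult.assoc[symmetric] split: split_indicator)
    also have "\<dots> = of_real (\<integral>x. norm (rv Z x) * indicator A x \<partial>M)"
      using Z_int by (intro integral_of_real integrable_real_mult_indicator) auto
    finally have "norm (Phi M \<sigma> Z (ae_class M ?Y)) = (\<integral>x. norm (rv Z x) * indicator A x \<partial>M)"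
      by simp
    then show ?thesis
      using bound[OF Y(1)] Y(2) by simp
  qed
  \<comment> \<open>A negative value would be cut off by \<open>ennreal ?D\<close>. The sign follows
    by evaluating \<open>bound\<close> at the constant 1, whose norm is positive.\<close>
  have D_nonneg: "0 \<le> ?D"
  proof -
    have "0 \<le> ?D * sigma1_norm M \<sigma> (ae_class M (\<lambda>x. 1 :: 'k))"
      using indicator_bounded(1)[of "\<lambda>x. 1" "space M" 1]
      by (intro order_trans[OF norm_ge_zero bound]) auto
    moreover have "0 < sigma1_norm M \<sigma> (ae_class M (\<lambda>x. 1 :: 'k))"
    proof -
      have C: "ae_class M (\<lambda>x. 1 :: 'k) \<in> carrier X.V"
        by (rule indicator_bounded(1)[of _ "space M" 1]) auto
      have "sigma1_norm M \<sigma> (ae_class M (\<lambda>x. 1 :: 'k)) \<noteq> 0"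
      proof
        assume "sigma1_norm M \<sigma> (ae_class M (\<lambda>x. 1 :: 'k)) = 0"
        then have "ae_class M (\<lambda>x. 1 :: 'k) = \<zero>\<^bsub>X.V\<^esub>"
          using normed_eq_0_iff[OF normed_X C] by simp
        then have "AE x in M. rv (ae_class M (\<lambda>x. 1 :: 'k)) x = 0"
          using X.rv_zero by simp
        then have "AE x in M. False"
          using rv_ae_class(2)[OF borel_measurable_const, of M "1 :: 'k"] by eventually_elim simp
        then show False
          by simp
      qed
      then show ?thesis
        using normed_nonneg[OF normed_X C] by simp
    qed
    ultimately show ?thesis
      by (simp add: zero_le_mult_iff)
  qed
  have "sigma_inf_val M \<sigma> (rv Z) \<le> ennreal ?D"
  proof (subst sigma_inf_val_le_iff, simp, unfold bounded_by_S_def, rule ballI)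
    fix A assume A [measurable]: "A \<in> sets M"
    have "(\<integral>\<^sup>+x. ennreal (norm (rv Z x)) * indicator A x \<partial>M) = (\<integral>\<^sup>+x. ennreal (norm (rv Z x) * indicator A x) \<partial>M)"
      by (intro nn_integral_cong) (auto split: split_indicator)
    also have "\<dots> = ennreal (\<integral>x. norm (rv Z x) * indicator A x \<partial>M)"
      using Z_int by (intro nn_integral_eq_integral integrable_real_mult_indicator) auto
    also have "\<dots> \<le> ennreal (?D * enn2real (S (prob A)))"
      using test[OF A] D_nonneg by (intro ennreal_leI) (meson mult_left_mono order_trans)
    also have "\<dots> = ennreal ?D * S (prob A)"
      using D_nonneg S_finite[of "prob A"] by (simp add: ennreal_mult)
    finally show "(\<integral>\<^sup>+x. ennreal (norm (rv Z x)) * indicator A x \<partial>M) \<le> ennreal ?D * S (prob A)" .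
  qed
  then show "sigma_inf_norm M \<sigma> Z \<le> ?D"
    using D_nonneg Z by (simp add: sigma_inf_norm_def L.carrier_iff enn2real_le_iff)
qed

text \<open>Injectivity follows from the isometry: the difference of two elements with the same
  image has norm 0.\<close>

lemma inj_Phi: "inj_on (Phi M \<sigma>) (carrier L.V)"
proof (rule inj_onI)
  fix Z Z' assume Z: "Z \<in> carrier L.V" and Z': "Z' \<in> carrier L.V" and eq: "Phi M \<sigma> Z = Phi M \<sigma> Z'"
  interpret L_metric: Metric_space "carrier L.V" "norm_dist L.V (sigma_inf_norm M \<sigma>)"
    by (rule normed_Metric_space[OF normed_L])
  let ?W = "Z \<oplus>\<^bsub>L.V\<^esub> (- 1) \<odot>\<^bsub>L.V\<^esub> Z'"
  have W: "?W \<in> carrier L.V"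
    by (intro L.add_in_carrier L.smult_in_carrier Z Z')
  have "Phi M \<sigma> ?W Y = 0" if "Y \<in> carrier X.V" for Y
    using linear_map_Phi L.smult_in_carrier[OF Z', of "- 1"] Z Z' that
    by (simp add: linear_map_on_def eq continuous_dual_def)
  then have "X_dual_norm (Phi M \<sigma> ?W) \<le> 0"
    by (intro dual_norm_le[OF normed_X]) auto
  then have "sigma_inf_norm M \<sigma> ?W = 0"
    using normed_nonneg[OF normed_L W] by (simp add: dual_norm_Phi[OF W])
  then have "norm_dist L.V (sigma_inf_norm M \<sigma>) Z Z' = 0"
    using Z Z' by (simp add: norm_dist_def a_minus_eq_smult[OF normed_L])
  then show "Z = Z'"
    using Z Z' by simp
qed

section \<open>Completeness in terms of classes\<close>

lemma banach_L: "banach_space_on L.V (sigma_inf_norm M \<sigma>)"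
  unfolding banach_space_on_def
proof (intro conjI normed_L)
  interpret L_metric: Metric_space "carrier L.V" "norm_dist L.V (sigma_inf_norm M \<sigma>)"
    by (rule normed_Metric_space[OF normed_L])
  have dist: "norm_dist L.V (sigma_inf_norm M \<sigma>) Y Z = enn2real (sigma_inf_val M \<sigma> (\<lambda>x. rv Y x - rv Z x))"
    if "Y \<in> carrier L.V" "Z \<in> carrier L.V" for Y Z
    using L.norm_dist_eq[OF that] by (simp add: sigma_inf_norm_def[abs_def])
  \<comment> \<open>\<open>enn2real\<close> sends infinity to 0, so a bound on the real norm says
    something about the extended norm only once finiteness is known.\<close>
  have diff_fin: "sigma_inf_val M \<sigma> (\<lambda>x. f x - g x) < \<infinity>"
    if [measurable]: "f \<in> borel_measurable M" "g \<in> borel_measurable M"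
      and "sigma_inf_val M \<sigma> f < \<infinity>" "sigma_inf_val M \<sigma> g < \<infinity>" for f g :: "'a \<Rightarrow> 'k"
  proof -
    have "sigma_inf_val M \<sigma> (\<lambda>x. f x + (- 1) * g x) \<le> sigma_inf_val M \<sigma> f + sigma_inf_val M \<sigma> (\<lambda>x. (- 1) * g x)"
      by (rule L.N_add) auto
    also have "\<dots> < \<infinity>"
      using that by (simp add: L.N_scale[of g "- 1", simplified])
    finally show ?thesis
      by simp
  qed
  show "L_metric.mcomplete"
    unfolding L_metric.mcomplete_def
  proof (intro allI impI)
    fix s assume "L_metric.MCauchy s"
    then have s: "s n \<in> carrier L.V" and
      cauchy: "\<And>e. 0 < e \<Longrightarrow> \<exists>k. \<forall>m n. k \<le> m \<longrightarrow> k \<le> n \<longrightarrow> norm_dist L.V (sigma_inf_norm M \<sigma>) (s m) (s n) < e" for n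
      unfolding L_metric.MCauchy_def by auto
    have [measurable]: "rv (s n) \<in> borel_measurable M" and fin: "sigma_inf_val M \<sigma> (rv (s n)) < \<infinity>" for n
      using s[of n] by (auto simp: L.rv_measurable L.carrier_iff)
    have "\<exists>k. \<forall>m\<ge>k. \<forall>n\<ge>k. sigma_inf_val M \<sigma> (\<lambda>x. rv (s m) x - rv (s n) x) \<le> ennreal e" if e: "0 < e" for e :: real
    proof -
      obtain k where k: "\<And>m n. k \<le> m \<Longrightarrow> k \<le> n \<Longrightarrow> norm_dist L.V (sigma_inf_norm M \<sigma>) (s m) (s n) < e"
        using cauchy[OF e] by blast
      have "sigma_inf_val M \<sigma> (\<lambda>x. rv (s m) x - rv (s n) x) \<le> ennreal e" if "k \<le> m" "k \<le> n" for m n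
        using k[OF that] e diff_fin[of "rv (s m)" "rv (s n)"] fin
        by (subst enn2real_le_iff[symmetric]) (auto simp: dist s)
      then show ?thesis
        by blast
    qed
    then obtain g where g [measurable]: "g \<in> borel_measurable M" and
      lim: "\<And>e::real. 0 < e \<Longrightarrow> \<exists>k. \<forall>n\<ge>k. sigma_inf_val M \<sigma> (\<lambda>x. rv (s n) x - g x) \<le> ennreal e"
      using sigma_inf_val_complete[of "\<lambda>n. rv (s n)"] fin by auto
    have g_fin: "sigma_inf_val M \<sigma> g < \<infinity>"
    proof -
      obtain n where n: "sigma_inf_val M \<sigma> (\<lambda>x. rv (s n) x - g x) \<le> ennreal 1"
        using lim[of 1] by auto
      have "sigma_inf_val M \<sigma> (\<lambda>x. rv (s n) x - (rv (s n) x - g x)) < \<infinity>"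
        by (rule diff_fin[OF _ _ fin le_less_trans[OF n]]) auto
      then show ?thesis
        by simp
    qed
    have G: "ae_class M g \<in> carrier L.V"
      by (rule L.ae_class_in_carrier[OF g g_fin])
    have "limitin L_metric.mtopology s (ae_class M g) sequentially"
      unfolding L_metric.limitin_metric
    proof (intro conjI allI impI G)
      fix e :: real assume e: "0 < e"
      then obtain k where k: "\<And>n. k \<le> n \<Longrightarrow> sigma_inf_val M \<sigma> (\<lambda>x. rv (s n) x - g x) \<le> ennreal (e/2)"
        using lim[of "e/2"] by auto
      have "norm_dist L.V (sigma_inf_norm M \<sigma>) (s n) (ae_class M g) < e" if "k \<le> n" for n
      proof -
        have "sigma_inf_val M \<sigma> (\<lambda>x. rv (s n) x - rv (ae_class M g) x) = sigma_inf_val M \<sigma> (\<lambda>x. rv (s n) x - g x)"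
          using rv_ae_class[OF g] by (intro L.N_cong) auto
        moreover have "enn2real (sigma_inf_val M \<sigma> (\<lambda>x. rv (s n) x - g x)) \<le> e/2"
          using k[OF that] e diff_fin[of "rv (s n)" g] fin g_fin
          by (subst enn2real_le_iff) auto
        ultimately show ?thesis
          using e by (simp add: dist s G)
      qed
      then show "eventually (\<lambda>n. s n \<in> carrier L.V \<and> norm_dist L.V (sigma_inf_norm M \<sigma>) (s n) (ae_class M g) < e) sequentially"
        using s by (intro eventually_sequentiallyI[of k]) auto
    qed
    then show "\<exists>Z. limitin L_metric.mtopology s Z sequentially"
      by blast
  qed
qed

section \<open>Representation of functionals by densities\<close>

lemma ae_class_simple_function:
  fixes s :: "'a \<Rightarrow> 'k"
  assumes s: "simple_function M s"
  shows "ae_class M s \<in> carrier X.V"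
proof -
  have "finite (norm ` s ` space M)"
    using s by (simp add: simple_function_def)
  then obtain b where b: "\<And>x. x \<in> space M \<Longrightarrow> norm (s x) \<le> b"
    by (meson bdd_above_finite bdd_above.unfold imageI)
  have "norm (s x) \<le> max 0 b * indicator (space M) x" if "x \<in> space M" for x
    using b[OF that] that by simp
  then show ?thesis
    using s by (intro indicator_bounded(1)[of _ "space M" "max 0 b"])
      (auto intro: borel_measurable_simple_function)
qed

lemma functional_simple_function:
  fixes s Z :: "'a \<Rightarrow> 'k"
  assumes \<phi>: "linear_map_on X.V scalars \<phi>" and Z: "integrable M Z"
    and density: "\<And>A. A \<in> sets M \<Longrightarrow> (LINT x:A|M. Z x) = \<phi> (ae_class M (indicator A))"
    and s: "simple_function M s"
  shows "\<phi> (ae_class M s) = (\<integral>x. Z x * s x \<partial>M)" "integrable M (\<lambda>x. Z x * s x)"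
proof -
  define A where "A y = s -` {y} \<inter> space M" for y
  have [measurable]: "A y \<in> sets M" for y
    using s by (simp add: A_def simple_functionD(2))
  define g where "g y = (\<lambda>x. y * indicator (A y) x)" for y :: 'k
  have [measurable]: "g y \<in> borel_measurable M" for y
    by (simp add: g_def)
  \<comment> \<open>Integrability and carrier membership belong to the induction claim because the
    integral and \<open>\<phi>\<close> are additive only under these conditions.\<close>
  have *: "\<phi> (ae_class M (\<lambda>x. \<Sum>y\<in>F. g y x)) = (\<integral>x. Z x * (\<Sum>y\<in>F. g y x) \<partial>M)
    \<and> integrable M (\<lambda>x. Z x * (\<Sum>y\<in>F. g y x))
    \<and> ae_class M (\<lambda>x. \<Sum>y\<in>F. g y x) \<in> carrier X.V" if "finite F" for F
    using that
  proof induction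
    case empty
    show ?case
      using linear_zero[OF normed_X \<phi>] X.zero_in_carrier by (simp add: X.zero_eq)
  next
    case (insert y F)
    let ?f = "\<lambda>x. \<Sum>y\<in>F. g y x" and ?i = "indicator (A y) :: 'a \<Rightarrow> 'k"
    have i: "ae_class M ?i \<in> carrier X.V"
      by (rule indicator_bounded(1)[of _ "A y" 1]) (auto split: split_indicator)
    have yi: "ae_class M (g y) = y \<odot>\<^bsub>X.V\<^esub> ae_class M ?i"
      unfolding g_def by (rule X.smult_ae_class[symmetric]) simp
    have sum: "ae_class M (\<lambda>x. \<Sum>z\<in>insert y F. g z x) = (y \<odot>\<^bsub>X.V\<^esub> ae_class M ?i) \<oplus>\<^bsub>X.V\<^esub> ae_class M ?f"
      unfolding yi[symmetric] sum.insert[OF insert.hyps] by (rule X.add_ae_class[symmetric]; measurable)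
    have int_i: "integrable M (\<lambda>x. indicator (A y) x *\<^sub>R Z x)"
      by (rule integrable_mult_indicator[OF _ Z]) simp
    have eq: "Z x * g y x = y * (indicator (A y) x *\<^sub>R Z x)" for x
      by (auto simp: g_def split: split_indicator)
    have int: "integrable M (\<lambda>x. Z x * g y x)"
      unfolding eq using int_i by (rule integrable_mult_right)
    have "(\<integral>x. Z x * g y x \<partial>M) = y * \<phi> (ae_class M ?i)"
      unfolding eq using density[of "A y"]
      by (simp only: integral_mult_right_zero) (simp add: set_lebesgue_integral_def)
    moreover have "\<phi> (ae_class M (\<lambda>x. \<Sum>z\<in>insert y F. g z x)) = y * \<phi> (ae_class M ?i) + \<phi> (ae_class M ?f)"
      unfolding sum using insert.IH i X.smult_in_carrier[OF i, of y]
      by (simp add: linear_add[OF normed_X \<phi>] linear_smult[OF normed_X \<phi>])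
    moreover have "ae_class M (\<lambda>x. \<Sum>z\<in>insert y F. g z x) \<in> carrier X.V"
      unfolding sum using insert.IH i by (simp add: X.smult_in_carrier X.add_in_carrier)
    ultimately show ?case
      using insert int by (simp add: distrib_left[of "Z _"])
  qed
  have fin: "finite (s ` space M)"
    using s by (simp add: simple_function_def)
  have gA: "indicator (A y) x *\<^sub>R y = g y x" for x y
    by (simp add: g_def split: split_indicator)
  have rep: "s x = (\<Sum>y\<in>s ` space M. g y x)" if "x \<in> space M" for x
    using simple_function_indicator_representation_banach[OF s that]
    unfolding A_def[symmetric] gA .
  then have "ae_class M s = ae_class M (\<lambda>x. \<Sum>y\<in>s ` space M. g y x)"
    by (intro ae_class_cong AE_I2)
  moreover have "(\<integral>x. Z x * s x \<partial>M) = (\<integral>x. Z x * (\<Sum>y\<in>s ` space M. g y x) \<partial>M)"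
    by (intro Bochner_Integration.integral_cong refl arg_cong2[where f="(*)"] rep)
  moreover have "integrable M (\<lambda>x. Z x * s x) \<longleftrightarrow> integrable M (\<lambda>x. Z x * (\<Sum>y\<in>s ` space M. g y x))"
    by (intro Bochner_Integration.integrable_cong refl arg_cong2[where f="(*)"] rep)
  ultimately show "\<phi> (ae_class M s) = (\<integral>x. Z x * s x \<partial>M)" "integrable M (\<lambda>x. Z x * s x)"
    using *[OF fin] by simp_all
qed

text \<open>The factor 2 in the domination reappears as \<open>2 * C\<close> in
  \<open>surj_Phi\<close>.\<close>

lemma simple_approximation:
  fixes Y :: "'a \<Rightarrow> 'k"
  assumes "Y \<in> borel_measurable M"
  obtains s where "\<And>i. simple_function M (s i)" "\<And>x. x \<in> space M \<Longrightarrow> (\<lambda>i. s i x) \<longlonglongrightarrow> Y x"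
    "\<And>i x. x \<in> space M \<Longrightarrow> norm (s i x) \<le> 2 * norm (Y x)"
  using borel_measurable_implies_sequence_metric[OF assms, of 0] unfolding norm_conv_dist by metis

text \<open>The density Z represents \<open>\<phi>\<close> on simple functions. Before it can be
  paired with an arbitrary Y it must be shown to have finite dual norm, which has to be derived from
  simple functions alone.\<close>

lemma surj_Phi:
  assumes \<phi>: "\<phi> \<in> carrier X_dual"
  shows "\<exists>Z\<in>carrier L.V. Phi M \<sigma> Z = \<phi>"
proof -
  have lin: "linear_map_on X.V scalars \<phi>" and ext: "\<phi> \<in> extensional (carrier X.V)"
    using \<phi> by (auto simp: in_continuous_dual_iff[OF normed_X])
  obtain C where C: "0 \<le> C" and bound: "\<And>Y. Y \<in> carrier X.V \<Longrightarrow> norm (\<phi> Y) \<le> C * sigma1_norm M \<sigma> Y"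
    using \<phi> unfolding in_continuous_dual_iff[OF normed_X] by blast
  define \<nu> where "\<nu> A = \<phi> (ae_class M (indicator A))" for A
  have ind: "ae_class M (indicator A) \<in> carrier X.V"
    "sigma1_norm M \<sigma> (ae_class M (indicator A :: 'a \<Rightarrow> 'k)) \<le> 1 * enn2real (S (prob A))" if "A \<in> sets M" for A
    using that indicator_bounded[of "indicator A" A 1] by (auto split: split_indicator)
  have "\<exists>f. integrable M f \<and> (\<forall>A\<in>sets M. (LINT x:A|M. f x) = \<nu> A)"
  proof (rule radon_nikodym[OF _ C])
    fix A B assume AB [measurable]: "A \<in> sets M" "B \<in> sets M" and disj: "A \<inter> B = {}"
    have "indicator (A \<union> B) = (\<lambda>x. indicator A x + indicator B x :: 'k)"
      using disj by (auto simp: fun_eq_iff split: split_indicator)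
    then have "ae_class M (indicator (A \<union> B)) = ae_class M (indicator A) \<oplus>\<^bsub>X.V\<^esub> ae_class M (indicator B)"
      by (simp add: X.add_ae_class)
    then show "\<nu> (A \<union> B) = \<nu> A + \<nu> B"
      by (simp add: \<nu>_def linear_add[OF normed_X lin] ind)
  next
    fix A assume A: "A \<in> sets M"
    show "norm (\<nu> A) \<le> C * enn2real (S (prob A))"
      unfolding \<nu>_def using ind(2)[OF A] C
      by (intro order_trans[OF bound[OF ind(1)[OF A]]] mult_left_mono) auto
  qed
  then obtain Z where Z: "integrable M Z" and density: "\<And>A. A \<in> sets M \<Longrightarrow> (LINT x:A|M. Z x) = \<phi> (ae_class M (indicator A))"
    by (auto simp: \<nu>_def)
  have simple: "\<phi> (ae_class M s) = (\<integral>x. Z x * s x \<partial>M)" "integrable M (\<lambda>x. Z x * s x)"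
    if "simple_function M s" for s
    by (rule functional_simple_function[OF lin Z], erule density, rule that)+
  have [measurable]: "Z \<in> borel_measurable M"
    using Z by simp
  \<comment> \<open>The natural test function \<open>?Y\<close> need not be simple. Its simple
    approximants are bounded by twice the indicator of A, and integrability of Z lets the limit pass
    under the integral.\<close>
  have Z_fin: "sigma_inf_val M \<sigma> Z \<le> ennreal (2 * C)"
  proof (subst sigma_inf_val_le_iff, simp, unfold bounded_by_S_def, rule ballI)
    fix A assume A [measurable]: "A \<in> sets M"
    let ?Y = "\<lambda>x. phase (Z x) * indicator A x"
    have Y_le: "norm (?Y x) \<le> indicator A x" for x
      by (auto simp: norm_phase_le split: split_indicator)
    obtain s where s: "\<And>i. simple_function M (s i)" and lim: "\<And>x. x \<in> space M \<Longrightarrow> (\<lambda>i. s i x) \<longlonglongrightarrow> ?Y x"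
      and dom: "\<And>i x. x \<in> space M \<Longrightarrow> norm (s i x) \<le> 2 * norm (?Y x)"
      using simple_approximation[of ?Y] by auto
    have [measurable]: "s i \<in> borel_measurable M" for i
      by (rule borel_measurable_simple_function[OF s])
    have s_le: "norm (s i x) \<le> 2 * indicator A x" if "x \<in> space M" for i x
      using dom[OF that, of i] Y_le[of x] by linarith
    have "(\<lambda>i. \<integral>x. Z x * s i x \<partial>M) \<longlonglongrightarrow> (\<integral>x. Z x * ?Y x \<partial>M)"
    proof (rule integral_dominated_convergence)
      show "integrable M (\<lambda>x. 2 * norm (Z x))"
        using Z by simp
      show "AE x in M. (\<lambda>i. Z x * s i x) \<longlonglongrightarrow> Z x * ?Y x"
        by (intro AE_I2 tendsto_mult tendsto_const lim)
      show "AE x in M. norm (Z x * s i x) \<le> 2 * norm (Z x)" for i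
      proof (rule AE_I2)
        fix x assume "x \<in> space M"
        then have "norm (s i x) \<le> 2"
          using s_le[of x i] by (auto split: split_indicator_asm)
        from mult_left_mono[OF this, of "norm (Z x)"]
        show "norm (Z x * s i x) \<le> 2 * norm (Z x)"
          by (simp add: norm_mult mult.commute)
      qed
    qed auto
    moreover have "norm (\<integral>x. Z x * s i x \<partial>M) \<le> C * (2 * enn2real (S (prob A)))" for i
    proof -
      have "ae_class M (s i) \<in> carrier X.V" "sigma1_norm M \<sigma> (ae_class M (s i)) \<le> 2 * enn2real (S (prob A))"
        using s_le by (auto intro!: indicator_bounded[of "s i" A 2])
      then show ?thesis
        unfolding simple(1)[OF s, symmetric] using C
        by (intro order_trans[OF bound] mult_left_mono) auto
    qed
    ultimately have "norm (\<integral>x. Z x * ?Y x \<partial>M) \<le> C * (2 * enn2real (S (prob A)))"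
      by (intro Lim_norm_ubound[OF trivial_limit_sequentially]) auto
    moreover have "(\<integral>x. Z x * ?Y x \<partial>M) = of_real (\<integral>x. norm (Z x) * indicator A x \<partial>M)"
    proof -
      have "(\<integral>x. Z x * ?Y x \<partial>M) = (\<integral>x. of_real (norm (Z x) * indicator A x) \<partial>M)"
        by (intro Bochner_Integration.integral_cong)
          (auto simp: mult_phase mult.assoc[symmetric] split: split_indicator)
      then show ?thesis
        using Z by (simp add: integral_of_real integrable_real_mult_indicator del: of_real_mult)
    qed
    ultimately have le: "(\<integral>x. norm (Z x) * indicator A x \<partial>M) \<le> 2 * C * enn2real (S (prob A))"
      by simp
    have "(\<integral>\<^sup>+x. ennreal (norm (Z x)) * indicator A x \<partial>M) = (\<integral>\<^sup>+x. ennreal (norm (Z x) * indicator A x) \<partial>M)"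
      by (intro nn_integral_cong) (auto split: split_indicator)
    also have "\<dots> = ennreal (\<integral>x. norm (Z x) * indicator A x \<partial>M)"
      using Z by (intro nn_integral_eq_integral integrable_real_mult_indicator) auto
    also have "\<dots> \<le> ennreal (2 * C * enn2real (S (prob A)))"
      by (rule ennreal_leI[OF le])
    also have "\<dots> = ennreal (2 * C) * S (prob A)"
      using C S_finite[of "prob A"] by (simp add: ennreal_mult)
    finally show "(\<integral>\<^sup>+x. ennreal (norm (Z x)) * indicator A x \<partial>M) \<le> ennreal (2 * C) * S (prob A)" .
  qed
  then have fin: "sigma_inf_val M \<sigma> Z < \<infinity>"
    by (rule le_less_trans) simp
  have Z_carrier: "ae_class M Z \<in> carrier L.V"
    by (rule L.ae_class_in_carrier[OF _ fin]) simp
  \<comment> \<open>The integrals of \<open>Z x * s i x\<close> have two limits: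
    \<open>\<phi> Y\<close>, since the simple functions converge to Y in the primal norm, and E(ZY),
    by dominated convergence with the integrable bound 2 |ZY| from \<open>pairing\<close>.\<close>
  have "Phi M \<sigma> (ae_class M Z) Y = \<phi> Y" if Y: "Y \<in> carrier X.V" for Y
  proof -
    note [measurable] = X.rv_measurable[OF Y] L.rv_measurable[OF Z_carrier]
    obtain s where s: "\<And>i. simple_function M (s i)" and lim: "\<And>x. x \<in> space M \<Longrightarrow> (\<lambda>i. s i x) \<longlonglongrightarrow> rv Y x"
      and dom: "\<And>i x. x \<in> space M \<Longrightarrow> norm (s i x) \<le> 2 * norm (rv Y x)"
      using simple_approximation[of "rv Y"] by auto
    have [measurable]: "s i \<in> borel_measurable M" for i
      by (rule borel_measurable_simple_function[OF s])
    have Y_fin: "sigma1_val M \<sigma> (rv Y) < \<infinity>"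
      using Y by (simp add: X.carrier_iff)
    have "(\<lambda>i. sigma1_val M \<sigma> (\<lambda>x. rv Y x - s i x)) \<longlonglongrightarrow> 0"
    \<comment> \<open>The factor 3 is 1 for Y plus 2 for its approximants.\<close>
    proof (rule sigma1_val_dominated_convergence[where g="\<lambda>x. norm (3 * rv Y x)"])
      show "norm (rv Y x - s i x) \<le> norm (3 * rv Y x)" if "x \<in> space M" for i x
        using norm_triangle_ineq4[of "rv Y x" "s i x"] dom[OF that, of i] by (simp add: norm_mult)
      have "sigma1_val M \<sigma> (\<lambda>x. norm (3 * rv Y x)) = sigma1_val M \<sigma> (\<lambda>x. 3 * rv Y x)"
        by (simp add: sigma1_val_def)
      also have "\<dots> < \<infinity>"
        using Y_fin by (simp add: X.N_scale ennreal_mult_less_top)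
      finally show "sigma1_val M \<sigma> (\<lambda>x. norm (3 * rv Y x)) < \<infinity>" .
      show "AE x in M. (\<lambda>i. rv Y x - s i x) \<longlonglongrightarrow> 0"
      proof (rule AE_I2)
        fix x assume "x \<in> space M"
        from tendsto_diff[OF tendsto_const lim[OF this], of "rv Y x"]
        show "(\<lambda>i. rv Y x - s i x) \<longlonglongrightarrow> 0"
          by simp
      qed
    qed auto
    then have norm_lim: "(\<lambda>i. enn2real (sigma1_val M \<sigma> (\<lambda>x. rv Y x - s i x))) \<longlonglongrightarrow> enn2real 0"
      by (intro tendsto_enn2real) auto
    have diff_le: "norm (\<phi> Y - \<phi> (ae_class M (s i))) \<le> C * enn2real (sigma1_val M \<sigma> (\<lambda>x. rv Y x - s i x))" for i
    proof -
      have si: "ae_class M (s i) \<in> carrier X.V"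
        by (rule ae_class_simple_function[OF s])
      have "\<phi> Y - \<phi> (ae_class M (s i)) = \<phi> (Y \<ominus>\<^bsub>X.V\<^esub> ae_class M (s i))"
        by (simp add: linear_minus[OF normed_X lin Y si])
      moreover have "norm (\<phi> (Y \<ominus>\<^bsub>X.V\<^esub> ae_class M (s i))) \<le> C * sigma1_norm M \<sigma> (Y \<ominus>\<^bsub>X.V\<^esub> ae_class M (s i))"
        by (intro bound X.minus_in_carrier Y si)
      moreover have "Y \<ominus>\<^bsub>X.V\<^esub> ae_class M (s i) = ae_class M (\<lambda>x. rv Y x - s i x)"
        unfolding X.minus_eq[OF Y si] using rv_ae_class(2)[of "s i" M] by (intro ae_class_cong) auto
      ultimately show ?thesis
        by (simp add: sigma1_norm_ae_class)
    qed
    have "(\<lambda>i. C * enn2real (sigma1_val M \<sigma> (\<lambda>x. rv Y x - s i x))) \<longlonglongrightarrow> 0"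
      using tendsto_mult[OF tendsto_const norm_lim, of C] by simp
    then have "(\<lambda>i. \<phi> Y - \<phi> (ae_class M (s i))) \<longlonglongrightarrow> 0"
      by (rule Lim_null_comparison[OF always_eventually[OF allI[OF diff_le]]])
    from tendsto_diff[OF tendsto_const this, of "\<phi> Y"]
    have \<phi>_lim: "(\<lambda>i. \<integral>x. Z x * s i x \<partial>M) \<longlonglongrightarrow> \<phi> Y"
      by (simp add: simple(1)[OF s])
    have int: "integrable M (\<lambda>x. Z x * rv Y x)"
      using fin Y_fin by (intro pairing) auto
    have "(\<lambda>i. \<integral>x. Z x * s i x \<partial>M) \<longlonglongrightarrow> (\<integral>x. Z x * rv Y x \<partial>M)"
    proof (rule integral_dominated_convergence)
      show "integrable M (\<lambda>x. 2 * norm (Z x * rv Y x))"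
        using int by simp
      show "AE x in M. (\<lambda>i. Z x * s i x) \<longlonglongrightarrow> Z x * rv Y x"
        by (intro AE_I2 tendsto_mult tendsto_const lim)
      show "AE x in M. norm (Z x * s i x) \<le> 2 * norm (Z x * rv Y x)" for i
      proof (rule AE_I2)
        fix x assume "x \<in> space M"
        from mult_left_mono[OF dom[OF this, of i], of "norm (Z x)"]
        show "norm (Z x * s i x) \<le> 2 * norm (Z x * rv Y x)"
          by (simp add: norm_mult ac_simps)
      qed
    qed auto
    then have "\<phi> Y = (\<integral>x. Z x * rv Y x \<partial>M)"
      by (rule LIMSEQ_unique[OF \<phi>_lim])
    also have "\<dots> = (\<integral>x. rv (ae_class M Z) x * rv Y x \<partial>M)"
      using rv_ae_class(2)[of Z M] by (intro integral_cong_AE) auto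
    finally show ?thesis
      by (simp add: Phi_apply Y)
  qed
  moreover have "Phi M \<sigma> (ae_class M Z) \<in> extensional (carrier X.V)"
    by (simp add: Phi_def X_eq)
  ultimately have "Phi M \<sigma> (ae_class M Z) = \<phi>"
    using ext by (intro extensionalityI)
  then show ?thesis
    using Z_carrier by blast
qed

text \<open>The integrability clause certifies that \<open>Phi\<close> is the genuine expectation:
  the Bochner integral of a nonintegrable function is 0 by convention.\<close>

theorem duality:
  "let X = (L_sigma1 M \<sigma> :: ('k, ('a \<Rightarrow> 'k) set) module);
       L = (L_sigma_inf M \<sigma> :: ('k, ('a \<Rightarrow> 'k) set) module)
   in banach_space_on L (sigma_inf_norm M \<sigma>) \<and>
      (\<forall>Z\<in>carrier L. \<forall>Y\<in>carrier X. integrable M (\<lambda>x. rv Z x * rv Y x)) \<and>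
      isometric_isomorphism L (sigma_inf_norm M \<sigma>)
        (continuous_dual X (sigma1_norm M \<sigma>)) (dual_norm X (sigma1_norm M \<sigma>))
        (Phi M \<sigma>)"
  unfolding Let_def X_eq L_eq isometric_isomorphism_def bij_betw_def
  using banach_L integrable_rv linear_map_Phi inj_Phi dual_norm_Phi surj_Phi Phi_in_dual
  by blast

end

theorem theorem23:
  fixes M :: "'a measure" and \<sigma> :: "real \<Rightarrow> real"
  assumes "prob_space M"
    and "uniform_rvs M \<noteq> {}"
    and "distortion \<sigma>"
  shows
    "(let X = (L_sigma1 M \<sigma> :: (real, ('a \<Rightarrow> real) set) module);
          L = (L_sigma_inf M \<sigma> :: (real, ('a \<Rightarrow> real) set) module)
      in banach_space_on L (sigma_inf_norm M \<sigma>) \<and>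
         (\<forall>Z\<in>carrier L. \<forall>Y\<in>carrier X. integrable M (\<lambda>x. rv Z x * rv Y x)) \<and>
         isometric_isomorphism L (sigma_inf_norm M \<sigma>)
           (continuous_dual X (sigma1_norm M \<sigma>)) (dual_norm X (sigma1_norm M \<sigma>))
           (Phi M \<sigma>)) \<and>
     (let X = (L_sigma1 M \<sigma> :: (complex, ('a \<Rightarrow> complex) set) module);
          L = (L_sigma_inf M \<sigma> :: (complex, ('a \<Rightarrow> complex) set) module)
      in banach_space_on L (sigma_inf_norm M \<sigma>) \<and>
         (\<forall>Z\<in>carrier L. \<forall>Y\<in>carrier X. integrable M (\<lambda>x. rv Z x * rv Y x)) \<and>
         isometric_isomorphism L (sigma_inf_norm M \<sigma>)
           (continuous_dual X (sigma1_norm M \<sigma>)) (dual_norm X (sigma1_norm M \<sigma>))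
           (Phi M \<sigma>))"
proof
  interpret prob_space M
    by fact
  interpret distortion_prob_space M \<sigma>
    by unfold_locales fact+
  interpret real: sigma_duality M \<sigma> "TYPE(real)"
    by unfold_locales (simp add: radon_nikodym_real)
  interpret complex: sigma_duality M \<sigma> "TYPE(complex)"
    by unfold_locales (rule radon_nikodym_complex)
  show "let X = (L_sigma1 M \<sigma> :: (real, ('a \<Rightarrow> real) set) module);
          L = (L_sigma_inf M \<sigma> :: (real, ('a \<Rightarrow> real) set) module)
      in banach_space_on L (sigma_inf_norm M \<sigma>) \<and>
         (\<forall>Z\<in>carrier L. \<forall>Y\<in>carrier X. integrable M (\<lambda>x. rv Z x * rv Y x)) \<and>
         isometric_isomorphism L (sigma_inf_norm M \<sigma>)
           (continuous_dual X (sigma1_norm M \<sigma>)) (dual_norm X (sigma1_norm M \<sigma>))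
           (Phi M \<sigma>)"
    by (rule real.duality)
  show "let X = (L_sigma1 M \<sigma> :: (complex, ('a \<Rightarrow> complex) set) module);
          L = (L_sigma_inf M \<sigma> :: (complex, ('a \<Rightarrow> complex) set) module)
      in banach_space_on L (sigma_inf_norm M \<sigma>) \<and>
         (\<forall>Z\<in>carrier L. \<forall>Y\<in>carrier X. integrable M (\<lambda>x. rv Z x * rv Y x)) \<and>
         isometric_isomorphism L (sigma_inf_norm M \<sigma>)
           (continuous_dual X (sigma1_norm M \<sigma>)) (dual_norm X (sigma1_norm M \<sigma>))
           (Phi M \<sigma>)"
    by (rule complex.duality)
qed

end
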